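(* (1) Let $F$ be a finite group, and define groups recursively by $G_1=\mathbb{Z}^2\wr F$ and $G_{i+1}=\mathbb{Z}^2\wr G_i$. Then for some simple random walk on $G_i$ and for any $n$ large enough the drift satisfies $$L_n^{G_i}\asymp \frac{n}{\underbrace{\ln(\ln(\dots\ln}_{i}(n)\dots))}.$$ (2) Define groups recursively by $F_1=\mathbb{Z}$, $F_{i+1}=\mathbb{Z}\wr F_i$, and let $H_{1,i}=\mathbb{Z}^2\wr F_i$, $H_{j+1,i}=\mathbb{Z}^2\wr H_{j,i}$. Then for some simple random walk on $H_{j,i}$ and for any $n$ large enough the drift satisfies $$L_{H_{j,i}}(n)\asymp \frac{n}{\sqrt[2^i]{\underbrace{\ln(\ln(\dots\ln}_{j}(n)\dots))}}.$$
   Context: The indices $i,j$ are positive integers. The wreath product $C\wr D$ is the semidirect product of $C$ and $\sum_C D$ (the group of finitely supported functions $f:C\to D$ with pointwise multiplication), where $C$ acts by shifts: $f^c(x)=f(xc^{-1})$ for $c,x\in C$. Random walks on a finitely generated group $G$ start at the identity and are driven by a symmetric probability measure $\mu$ on $G$ whose support is finite and generates $G$; the position at time $n$ has distribution $\mu^{*n}$ (the $n$-th convolution power). The walk is called simple if $\mu$ is equidistributed on its support. The drift is $L(n)=L_n^G=L_G(n)=\mathbb{E}_{\mu^{*n}}\, l(g)$, where $l$ is the word metric (word length) on $G$ for a fixed finite generating set. For functions $a(n),b(n)$, $a(n)\asymp b(n)$ means there are constants $c_1,c_2>0$ with $c_1 b(n)\le a(n)\le c_2 b(n)$ for all sufficiently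 large $n$.
   Formalization: In part (1) the finite group F is assumed nontrivial; for trivial F one has G_1 = Z^2, whose drift is of order sqrt(n), so the stated estimate n/ln n fails. *)

theory Defs
  imports
    "HOL-Algebra.Algebra"
    "HOL-Probability.Probability"
    "HOL-Library.Landau_Symbols"
begin

text \<open>
  The shift \<open>f\<^sup>c(x) = f(x c\<^sup>-\<^sup>1)\<close> is a right action of \<open>C\<close> on the finitely supported functions
  \<open>C \<rightarrow> D\<close>, since \<open>(f\<^sup>c)\<^sup>d = f\<^sup>(\<^sup>c\<^sup>d\<^sup>)\<close>.  So the semidirect product has the multiplication
  \<open>(c, f) (d, g) = (c d, f\<^sup>d g)\<close>.  Elements of \<^const>\<open>sum_group\<close> are extensional functions, hence
  the restriction to \<^term>\<open>carrier C\<close>.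
\<close>

definition wreath_shift ::
    "('c, 'm) monoid_scheme \<Rightarrow> 'c \<Rightarrow> ('c \<Rightarrow> 'd) \<Rightarrow> 'c \<Rightarrow> 'd" where
  "wreath_shift C c f = (\<lambda>x\<in>carrier C. f (x \<otimes>\<^bsub>C\<^esub> inv\<^bsub>C\<^esub> c))"

definition wreath ::
    "('c, 'm) monoid_scheme \<Rightarrow> ('d, 'k) monoid_scheme \<Rightarrow> ('c \<times> ('c \<Rightarrow> 'd)) monoid" where
  "wreath C D =
     (let S = sum_group (carrier C) (\<lambda>_. D) in
      \<lparr>carrier = carrier C \<times> carrier S,
       monoid.mult = (\<lambda>(c, f) (d, g). (c \<otimes>\<^bsub>C\<^esub> d, wreath_shift C d f \<otimes>\<^bsub>S\<^esub> g)),
       one = (\<one>\<^bsub>C\<^esub>, \<one>\<^bsub>S\<^esub>)\<rparr>)"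

text \<open>
  The type of \<^term>\<open>wreath C D\<close> grows with the type of \<open>D\<close>, so the groups obtained by iterating
  \<open>D \<mapsto> C \<wr> D\<close> are placed in one type, by carrying each wreath product over along the
  injection \<open>(c, f) \<mapsto> Level c f\<close>.  The lemmas \<open>iter_wreath_0_iso\<close> and
  \<open>iter_wreath_Suc_iso\<close> below state that this does not change the groups.
\<close>

datatype ('c, 'd) tower = Base 'd | Level 'c "'c \<Rightarrow> ('c, 'd) tower"

primrec iter_wreath ::
    "('c, 'm) monoid_scheme \<Rightarrow> ('d, 'k) monoid_scheme \<Rightarrow> nat \<Rightarrow> ('c, 'd) tower monoid" where
  "iter_wreath C D 0 = image_group Base D"
| "iter_wreath C D (Suc i) =
     image_group (\<lambda>(c, f). Level c f) (wreath C (iter_wreath C D i))"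

lemma wreath_simps:
  assumes "group C" "group D"
  shows "carrier (wreath C D) =
           carrier C \<times> {f \<in> carrier C \<rightarrow>\<^sub>E carrier D. finite {x \<in> carrier C. f x \<noteq> \<one>\<^bsub>D\<^esub>}}"
    and "(c, f) \<otimes>\<^bsub>wreath C D\<^esub> (d, g) =
           (c \<otimes>\<^bsub>C\<^esub> d, \<lambda>x\<in>carrier C. f (x \<otimes>\<^bsub>C\<^esub> inv\<^bsub>C\<^esub> d) \<otimes>\<^bsub>D\<^esub> g x)"
    and "\<one>\<^bsub>wreath C D\<^esub> = (\<one>\<^bsub>C\<^esub>, \<lambda>x\<in>carrier C. \<one>\<^bsub>D\<^esub>)"
  using assms
  by (auto simp: wreath_def Let_def carrier_sum_group wreath_shift_def fun_eq_iff restrict_def)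

lemma group_wreath:
  assumes C: "group C" and D: "group D"
  shows "group (wreath C D)"
proof -
  interpret C: group C by (rule C)
  interpret D: group D by (rule D)
  note [simp] = wreath_simps[OF C D]
  have supp: "finite {x \<in> carrier C. f (x \<otimes>\<^bsub>C\<^esub> d) \<noteq> \<one>\<^bsub>D\<^esub>}"
    if "d \<in> carrier C" "finite {x \<in> carrier C. f x \<noteq> \<one>\<^bsub>D\<^esub>}" for d and f :: "'a \<Rightarrow> 'c"
  proof (rule finite_subset)
    show "{x \<in> carrier C. f (x \<otimes>\<^bsub>C\<^esub> d) \<noteq> \<one>\<^bsub>D\<^esub>}
        \<subseteq> (\<lambda>y. y \<otimes>\<^bsub>C\<^esub> inv\<^bsub>C\<^esub> d) ` {x \<in> carrier C. f x \<noteq> \<one>\<^bsub>D\<^esub>}"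
    proof
      fix x assume "x \<in> {x \<in> carrier C. f (x \<otimes>\<^bsub>C\<^esub> d) \<noteq> \<one>\<^bsub>D\<^esub>}"
      with that(1) have "x = (x \<otimes>\<^bsub>C\<^esub> d) \<otimes>\<^bsub>C\<^esub> inv\<^bsub>C\<^esub> d"
          "x \<otimes>\<^bsub>C\<^esub> d \<in> {x \<in> carrier C. f x \<noteq> \<one>\<^bsub>D\<^esub>}"
        by (auto simp: C.m_assoc)
      then show "x \<in> (\<lambda>y. y \<otimes>\<^bsub>C\<^esub> inv\<^bsub>C\<^esub> d) ` {x \<in> carrier C. f x \<noteq> \<one>\<^bsub>D\<^esub>}" by blast
    qed
  qed (use that in simp)
  show ?thesis
  proof (rule groupI)
    fix p q assume pq: "p \<in> carrier (wreath C D)" "q \<in> carrier (wreath C D)"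
    obtain c f d g where [simp]: "p = (c, f)" "q = (d, g)" by (cases p, cases q)
    have "finite {x \<in> carrier C. f (x \<otimes>\<^bsub>C\<^esub> inv\<^bsub>C\<^esub> d) \<otimes>\<^bsub>D\<^esub> g x \<noteq> \<one>\<^bsub>D\<^esub>}"
      by (rule finite_subset[of _ "{x \<in> carrier C. f (x \<otimes>\<^bsub>C\<^esub> inv\<^bsub>C\<^esub> d) \<noteq> \<one>\<^bsub>D\<^esub>} \<union> {x \<in> carrier C. g x \<noteq> \<one>\<^bsub>D\<^esub>}"])
        (use pq supp in auto)
    then show "p \<otimes>\<^bsub>wreath C D\<^esub> q \<in> carrier (wreath C D)"
      using pq by (auto simp: PiE_iff cong: conj_cong)
  next
    fix p q r assume pqr: "p \<in> carrier (wreath C D)" "q \<in> carrier (wreath C D)" "r \<in> carrier (wreath C D)"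
    obtain c f d g e h where [simp]: "p = (c, f)" "q = (d, g)" "r = (e, h)"
      by (cases p, cases q, cases r)
    show "p \<otimes>\<^bsub>wreath C D\<^esub> q \<otimes>\<^bsub>wreath C D\<^esub> r = p \<otimes>\<^bsub>wreath C D\<^esub> (q \<otimes>\<^bsub>wreath C D\<^esub> r)"
      using pqr by (auto simp: PiE_iff C.m_assoc D.m_assoc C.inv_mult_group fun_eq_iff restrict_def)
  next
    fix p assume p: "p \<in> carrier (wreath C D)"
    obtain c f where [simp]: "p = (c, f)" by (cases p)
    show "\<one>\<^bsub>wreath C D\<^esub> \<otimes>\<^bsub>wreath C D\<^esub> p = p"
      using p by (auto simp: PiE_iff fun_eq_iff restrict_def extensional_def)
    let ?q = "(inv\<^bsub>C\<^esub> c, \<lambda>x\<in>carrier C. inv\<^bsub>D\<^esub> (f (x \<otimes>\<^bsub>C\<^esub> c)))"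
    have "{x \<in> carrier C. inv\<^bsub>D\<^esub> (f (x \<otimes>\<^bsub>C\<^esub> c)) \<noteq> \<one>\<^bsub>D\<^esub>} = {x \<in> carrier C. f (x \<otimes>\<^bsub>C\<^esub> c) \<noteq> \<one>\<^bsub>D\<^esub>}"
      using p by (auto simp: PiE_iff D.inv_eq_1_iff)
    then have "?q \<in> carrier (wreath C D)"
      using p supp[of c f] by (auto simp: PiE_iff cong: conj_cong)
    moreover have "?q \<otimes>\<^bsub>wreath C D\<^esub> p = \<one>\<^bsub>wreath C D\<^esub>"
      using p by (auto simp: PiE_iff fun_eq_iff restrict_def C.m_assoc)
    ultimately show "\<exists>q\<in>carrier (wreath C D). q \<otimes>\<^bsub>wreath C D\<^esub> p = \<one>\<^bsub>wreath C D\<^esub>" by blast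
  qed (auto)
qed

lemma image_group_iso:
  assumes "group G" "inj f"
  shows "group (image_group f G)" "f \<in> iso G (image_group f G)"
proof -
  interpret group G by (rule assms)
  have *: "inv_into (carrier G) f (f x) = x" if "x \<in> carrier G" for x
    using that assms(2) by (auto intro: inv_into_f_f inj_on_subset)
  show "group (image_group f G)"
  proof (rule groupI)
    fix y assume "y \<in> carrier (image_group f G)"
    then obtain x where x: "x \<in> carrier G" "y = f x" by (auto simp: image_group_def)
    then have "f (inv\<^bsub>G\<^esub> x) \<otimes>\<^bsub>image_group f G\<^esub> y = \<one>\<^bsub>image_group f G\<^esub>"
      by (simp add: image_group_def *)
    moreover have "f (inv\<^bsub>G\<^esub> x) \<in> carrier (image_group f G)"
      using x by (simp add: image_group_def)
    ultimately show "\<exists>z\<in>carrier (image_group f G). z \<otimes>\<^bsub>image_group f G\<^esub> y = \<one>\<^bsub>image_group f G\<^esub>"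
      by blast
  qed (auto simp: image_group_def * m_assoc)
  show "f \<in> iso G (image_group f G)"
    using assms(2) by (auto simp: iso_def hom_def image_group_def * bij_betw_def intro: inj_on_subset)
qed

lemma group_iter_wreath:
  assumes "group C" "group D"
  shows "group (iter_wreath C D i)"
proof (induction i)
  case 0
  show ?case using image_group_iso(1)[OF assms(2), of Base] by (simp add: inj_def)
next
  case (Suc i)
  show ?case using image_group_iso(1)[OF group_wreath[OF assms(1) Suc], of "\<lambda>(c, f). Level c f"]
    by (simp add: inj_def)
qed

lemma iter_wreath_0_iso:
  assumes "group D"
  shows "D \<cong> iter_wreath C D 0"
  using image_group_iso(2)[OF assms, of Base] by (auto simp: is_iso_def inj_def)

lemma iter_wreath_Suc_iso:
  assumes "group C" "group D"
  shows "wreath C (iter_wreath C D i) \<cong> iter_wreath C D (Suc i)"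
  using image_group_iso(2)[OF group_wreath[OF assms(1) group_iter_wreath[OF assms, of i]],
      of "\<lambda>(c, f). Level c f"]
  by (auto simp: is_iso_def inj_def)

definition Z2_group :: "(int \<times> int) monoid" where
  "Z2_group = integer_group \<times>\<times> integer_group"

text \<open>
  \<open>G\<^sub>1 = \<int>\<^sup>2 \<wr> F\<close> and \<open>G\<^sub>i\<^sub>+\<^sub>1 = \<int>\<^sup>2 \<wr> G\<^sub>i\<close>, so \<open>G\<^sub>i\<close> is the result of \<open>i\<close> iterations starting from \<open>F\<close>.
\<close>

definition Z2_tower :: "('f, 'm) monoid_scheme \<Rightarrow> nat \<Rightarrow> (int \<times> int, 'f) tower monoid" where
  "Z2_tower F i = iter_wreath Z2_group F i"

text \<open>
  \<open>F\<^sub>1 = \<int>\<close> and \<open>F\<^sub>i\<^sub>+\<^sub>1 = \<int> \<wr> F\<^sub>i\<close>: here the indexing starts at the base group, so \<open>F\<^sub>i\<close> is the result of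
  \<open>i - 1\<close> iterations (\<open>i \<ge> 1\<close>).
\<close>

definition Z_tower :: "nat \<Rightarrow> (int, int) tower monoid" where
  "Z_tower i = iter_wreath integer_group integer_group (i - 1)"

text \<open>
  \<open>H\<^sub>1\<^sub>,\<^sub>i = \<int>\<^sup>2 \<wr> F\<^sub>i\<close> and \<open>H\<^sub>j\<^sub>+\<^sub>1\<^sub>,\<^sub>i = \<int>\<^sup>2 \<wr> H\<^sub>j\<^sub>,\<^sub>i\<close>.
\<close>

definition Z2_Z_tower :: "nat \<Rightarrow> nat \<Rightarrow> (int \<times> int, (int, int) tower) tower monoid" where
  "Z2_Z_tower j i = iter_wreath Z2_group (Z_tower i) j"

definition walk_measure :: "('g, 'm) monoid_scheme \<Rightarrow> 'g pmf \<Rightarrow> bool" where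
  "walk_measure G \<mu> \<longleftrightarrow>
     finite (set_pmf \<mu>) \<and> set_pmf \<mu> \<subseteq> carrier G \<and> generate G (set_pmf \<mu>) = carrier G \<and>
     (\<forall>g\<in>carrier G. pmf \<mu> (inv\<^bsub>G\<^esub> g) = pmf \<mu> g)"

definition simple_walk_measure :: "('g, 'm) monoid_scheme \<Rightarrow> 'g pmf \<Rightarrow> bool" where
  "simple_walk_measure G \<mu> \<longleftrightarrow> walk_measure G \<mu> \<and> \<mu> = pmf_of_set (set_pmf \<mu>)"

primrec conv_power :: "('g, 'm) monoid_scheme \<Rightarrow> 'g pmf \<Rightarrow> nat \<Rightarrow> 'g pmf" where
  "conv_power G \<mu> 0 = return_pmf \<one>\<^bsub>G\<^esub>"
| "conv_power G \<mu> (Suc n) = map_pmf (\<lambda>(x, y). x \<otimes>\<^bsub>G\<^esub> y) (pair_pmf (conv_power G \<mu> n) \<mu>)"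

text \<open>
  Group generation is by \<^const>\<open>generate\<close>, which closes under inverses; correspondingly, words
  are taken over \<open>S \<union> S\<^sup>-\<^sup>1\<close>.
\<close>

definition finite_generating_set :: "('g, 'm) monoid_scheme \<Rightarrow> 'g set \<Rightarrow> bool" where
  "finite_generating_set G S \<longleftrightarrow> finite S \<and> S \<subseteq> carrier G \<and> generate G S = carrier G"

definition word_length :: "('g, 'm) monoid_scheme \<Rightarrow> 'g set \<Rightarrow> 'g \<Rightarrow> nat" where
  "word_length G S g =
     (LEAST n. \<exists>xs. length xs = n \<and> set xs \<subseteq> S \<union> m_inv G ` S \<and> g = foldr (\<otimes>\<^bsub>G\<^esub>) xs \<one>\<^bsub>G\<^esub>)"

definition drift :: "('g, 'm) monoid_scheme \<Rightarrow> 'g set \<Rightarrow> 'g pmf \<Rightarrow> nat \<Rightarrow> real" where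
  "drift G S \<mu> n = measure_pmf.expectation (conv_power G \<mu> n) (\<lambda>g. real (word_length G S g))"

definition asymp_order :: "(nat \<Rightarrow> real) \<Rightarrow> (nat \<Rightarrow> real) \<Rightarrow> bool"  (infix "\<asymp>" 50) where
  "a \<asymp> b \<longleftrightarrow> (\<exists>c1>0. \<exists>c2>0. \<forall>\<^sub>F n in sequentially. c1 * b n \<le> a n \<and> a n \<le> c2 * b n)"

lemma asymp_order_iff_bigtheta:
  assumes a: "\<forall>\<^sub>F n in sequentially. 0 \<le> a n" and b: "\<forall>\<^sub>F n in sequentially. 0 \<le> b n"
  shows "a \<asymp> b \<longleftrightarrow> a \<in> \<Theta>(b)"
proof
  assume "a \<asymp> b"
  then obtain c1 c2 where c: "c1 > 0" "c2 > 0"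
    and *: "\<forall>\<^sub>F n in sequentially. c1 * b n \<le> a n \<and> a n \<le> c2 * b n"
    unfolding asymp_order_def by blast
  show "a \<in> \<Theta>(b)"
  proof (rule bigthetaI)
    show "a \<in> O(b)"
      by (rule bigoI[of _ c2]) (use a b * in eventually_elim, auto)
    show "a \<in> \<Omega>(b)"
      by (rule landau_omega.bigI[of c1]) (rule c, use a b * in eventually_elim, auto)
  qed
next
  assume *: "a \<in> \<Theta>(b)"
  from bigthetaD1[OF *] obtain c2 where c2: "c2 > 0" "\<forall>\<^sub>F n in sequentially. norm (a n) \<le> c2 * norm (b n)"
    by (elim landau_o.bigE)
  from bigthetaD2[OF *] obtain c1 where c1: "c1 > 0" "\<forall>\<^sub>F n in sequentially. norm (a n) \<ge> c1 * norm (b n)"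
    by (elim landau_omega.bigE)
  have "\<forall>\<^sub>F n in sequentially. c1 * b n \<le> a n \<and> a n \<le> c2 * b n"
    using a b c1(2) c2(2) by eventually_elim auto
  with c1(1) c2(1) show "a \<asymp> b" unfolding asymp_order_def by blast
qed

end

theory Submission
  imports Defs
begin

text \<open>
  The walk realizing the drift on \<open>C \<wr> D\<close> is the switch-walk-switch walk: a step is \<open>\<delta>\<^sup>a c \<delta>\<^sup>b\<close>, where
  \<open>c\<close> is a uniform step of a walk on \<open>C\<close>, and \<open>a\<close>, \<open>b\<close> are independent uniform steps of a walk on \<open>D\<close>
  that act on the lamp at the current position before and after the move.  If \<open>1\<close> is not a step of \<open>C\<close>,
  then \<open>a\<close>, \<open>b\<close>, \<open>c\<close> can be read off from the product, so the walk is simple.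

  Condition on the path of the base point.  The lamp at \<open>x\<close> is then distributed as the \<open>D\<close>-walk at time
  \<open>l(x)\<close>, where the local time \<open>l\<close> counts the switches made at \<open>x\<close> (lemma \<open>lamp_marginal\<close>).
  The length of \<open>(c, f)\<close> is at least \<open>\<Sum>\<^sub>x |f(x)|\<close>, and exceeds it by at most four times the number of visited
  sites, because the visited sites can be toured along a spanning tree
  (\<open>lamp_lengths_le_word_length\<close>, \<open>word_length_le_visited\<close>).  So the drift is the expectation of
  \<open>\<Sum>\<^sub>x L\<^sub>D(l(x))\<close>, up to the expected range.

  The base walk enters only through its Green function \<open>G(n) = \<Sum>\<^sub>k\<^sub>\<le>\<^sub>n P(X\<^sub>k = 1)\<close>.  The local times add up
  to \<open>2n\<close>; the expected range is at most \<open>(2n + 1) / G(n)\<close> (\<open>range_green_le\<close>); and the local times have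
  expected sum of squares at most \<open>8(n + 1) G(n)\<close> (\<open>expectation_local_time_sq_le\<close>).  Hence most of the
  time is spent at sites whose local time is of order \<open>G(n)\<close>.  If \<open>L\<^sub>D(k)\<close> is of order \<open>k / \<psi>(k)\<close>, with
  \<open>\<psi>\<close> and \<open>k / \<psi>(k)\<close> nondecreasing, then cutting the local times at a multiple of \<open>G(n)\<close> shows that
  \<open>C \<wr> D\<close> has drift of order \<open>n / \<psi>(G(n))\<close> (\<open>drift_gauge_wreath\<close>).

  A wreath product with base \<open>C\<close> thus replaces \<open>\<psi>\<close> by \<open>\<psi> \<circ> \<gamma>\<close>, where \<open>\<gamma>\<close> is the order of \<open>G\<close>.  The steps
  \<open>\<plusminus>1, \<plusminus>2\<close> on \<open>\<int>\<close> have return probability of order \<open>n\<^sup>-\<^sup>1\<^sup>/\<^sup>2\<close>, so \<open>\<gamma>\<close> is the square root; on \<open>\<int>\<^sup>2\<close> two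
  independent copies have return probability of order \<open>1 / n\<close>, so \<open>\<gamma>\<close> is the logarithm.  The induction
  starts from \<open>\<psi>(k) = k\<close> for a nontrivial finite group and from \<open>\<psi>(k) = \<surd>k\<close> for \<open>\<int>\<close>.  Taking \<open>\<gamma>(x) = 1 + ln x\<close>
  instead of \<open>ln x\<close> keeps all iterates at least \<open>1\<close>, and changes them by at most a factor \<open>2\<close> for large \<open>x\<close>.
\<close>

section \<open>Word length\<close>

abbreviation word_prod :: "('g, 'm) monoid_scheme \<Rightarrow> 'g list \<Rightarrow> 'g" where
  "word_prod G xs \<equiv> foldr (\<otimes>\<^bsub>G\<^esub>) xs \<one>\<^bsub>G\<^esub>"

lemma (in group) word_prod_closed:
  "set xs \<subseteq> carrier G \<Longrightarrow> word_prod G xs \<in> carrier G"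
  by (induction xs) auto

lemma (in group) word_prod_append:
  "set xs \<subseteq> carrier G \<Longrightarrow> set ys \<subseteq> carrier G \<Longrightarrow>
   word_prod G (xs @ ys) = word_prod G xs \<otimes> word_prod G ys"
  by (induction xs) (auto simp: word_prod_closed m_assoc)

locale marked_group = group G for G (structure) +
  fixes S
  assumes generating: "finite_generating_set G S"
begin

abbreviation letters where "letters \<equiv> S \<union> m_inv G ` S"
abbreviation len where "len \<equiv> word_length G S"

lemma S_carrier: "S \<subseteq> carrier G"
  and letters_carrier: "letters \<subseteq> carrier G"
  and finite_letters: "finite letters"
  using generating by (auto simp: finite_generating_set_def)

lemma word_exists:
  assumes "g \<in> carrier G"
  shows "\<exists>xs. set xs \<subseteq> letters \<and> g = word_prod G xs"
proof -
  have "g \<in> generate G S" using assms generating by (simp add: finite_generating_set_def)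
  then show ?thesis
  proof (induction g rule: generate.induct)
    case one
    show ?case by (rule exI[of _ "[]"]) auto
  next
    case (incl h)
    then show ?case using S_carrier by (intro exI[of _ "[h]"]) auto
  next
    case (inv h)
    then show ?case using S_carrier by (intro exI[of _ "[inv h]"]) auto
  next
    case (eng h1 h2)
    then obtain xs ys where "set xs \<subseteq> letters" "h1 = word_prod G xs"
      "set ys \<subseteq> letters" "h2 = word_prod G ys" by blast
    then show ?case using letters_carrier
      by (intro exI[of _ "xs @ ys"]) (subst word_prod_append; auto)
  qed
qed

lemma word_length_attained:
  assumes "g \<in> carrier G"
  obtains xs where "length xs = len g" "set xs \<subseteq> letters" "g = word_prod G xs"
proof -
  have "\<exists>n xs. length xs = n \<and> set xs \<subseteq> letters \<and> g = word_prod G xs"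
    using word_exists[OF assms] by blast
  from LeastI_ex[OF this] show ?thesis
    using that unfolding word_length_def by blast
qed

lemma word_length_le:
  "set xs \<subseteq> letters \<Longrightarrow> len (word_prod G xs) \<le> length xs"
  unfolding word_length_def by (rule Least_le) blast

lemma word_length_one: "len \<one> = 0"
  using word_length_le[of "[]"] by simp

lemma word_length_pos:
  assumes "g \<in> carrier G" "g \<noteq> \<one>"
  shows "len g \<ge> 1"
proof -
  obtain xs where xs: "length xs = len g" "set xs \<subseteq> letters" "g = word_prod G xs"
    using word_length_attained[OF assms(1)] .
  with assms(2) show ?thesis by (cases xs) auto
qed

lemma word_length_mult:
  assumes "g \<in> carrier G" "h \<in> carrier G"
  shows "len (g \<otimes> h) \<le> len g + len h"
proof -
  obtain xs where xs: "length xs = len g" "set xs \<subseteq> letters" "g = word_prod G xs"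
    using word_length_attained[OF assms(1)] .
  obtain ys where ys: "length ys = len h" "set ys \<subseteq> letters" "h = word_prod G ys"
    using word_length_attained[OF assms(2)] .
  have "g \<otimes> h = word_prod G (xs @ ys)"
    using xs ys letters_carrier by (subst word_prod_append) auto
  then show ?thesis using word_length_le[of "xs @ ys"] xs ys by auto
qed

lemma word_length_letter: "s \<in> letters \<Longrightarrow> len s \<le> 1"
  using word_length_le[of "[s]"] letters_carrier by auto

lemma word_length_word_prod:
  assumes "set xs \<subseteq> carrier G" "\<And>x. x \<in> set xs \<Longrightarrow> len x \<le> K"
  shows "len (word_prod G xs) \<le> K * length xs"
  using assms
proof (induction xs)
  case (Cons x xs)
  have "len (word_prod G (x # xs)) \<le> len x + len (word_prod G xs)"
    using Cons.prems word_prod_closed by (auto intro!: word_length_mult)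
  also have "\<dots> \<le> K + K * length xs"
    using Cons by (intro add_mono) auto
  finally show ?case by simp
qed (simp add: word_length_one)

end

lemma word_length_comparable:
  assumes "marked_group G S" "marked_group G T"
  obtains K where "K \<ge> 1" "\<And>g. g \<in> carrier G \<Longrightarrow> word_length G T g \<le> K * word_length G S g"
proof -
  interpret S: marked_group G S by fact
  interpret T: marked_group G T by fact
  define K where "K = Max (insert 1 (T.len ` S.letters))"
  have K: "T.len x \<le> K" if "x \<in> S.letters" for x
    unfolding K_def using that S.finite_letters by (intro Max_ge) auto
  show ?thesis
  proof (rule that[of K])
    show "K \<ge> 1" unfolding K_def using S.finite_letters by (intro Max_ge) auto
    fix g assume "g \<in> carrier G"
    then obtain xs where xs: "length xs = S.len g" "set xs \<subseteq> S.letters" "g = word_prod G xs"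
      by (rule S.word_length_attained)
    then have "T.len (word_prod G xs) \<le> K * length xs"
      using S.letters_carrier by (intro T.word_length_word_prod K) blast+
    then show "T.len g \<le> K * S.len g" using xs by simp
  qed
qed

section \<open>Random words\<close>

lemma expectation_cong_pmf:
  "(\<And>x. x \<in> set_pmf p \<Longrightarrow> f x = g x) \<Longrightarrow>
   measure_pmf.expectation p f = measure_pmf.expectation p (g :: _ \<Rightarrow> real)"
  by (rule integral_cong_AE) (auto simp: AE_measure_pmf_iff)

lemma expectation_mono_pmf:
  assumes "finite (set_pmf p)" "\<And>x. x \<in> set_pmf p \<Longrightarrow> f x \<le> g x"
  shows "measure_pmf.expectation p f \<le> measure_pmf.expectation p (g :: _ \<Rightarrow> real)"
  using assms by (intro integral_mono_AE) (auto simp: AE_measure_pmf_iff integrable_measure_pmf_finite)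

lemma expectation_bind_pmf:
  fixes h :: "'b \<Rightarrow> real"
  assumes p: "finite (set_pmf p)" and f: "\<And>x. x \<in> set_pmf p \<Longrightarrow> finite (set_pmf (f x))"
  shows "measure_pmf.expectation (bind_pmf p f) h =
         measure_pmf.expectation p (\<lambda>x. measure_pmf.expectation (f x) h)"
  using pmf_expectation_bind[of "set_pmf p" f p h] p f
  by (simp add: integral_measure_pmf_real[of "set_pmf p"] mult.commute)

lemma expectation_sum_pmf:
  fixes f :: "'i \<Rightarrow> 'a \<Rightarrow> real"
  assumes "finite (set_pmf p)"
  shows "measure_pmf.expectation p (\<lambda>x. \<Sum>i\<in>I. f i x) = (\<Sum>i\<in>I. measure_pmf.expectation p (f i))"
  by (rule Bochner_Integration.integral_sum) (use assms in \<open>auto intro: integrable_measure_pmf_finite\<close>)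

lemma expectation_add_pmf:
  fixes f g :: "'a \<Rightarrow> real"
  assumes "finite (set_pmf p)"
  shows "measure_pmf.expectation p (\<lambda>x. f x + g x) =
         measure_pmf.expectation p f + measure_pmf.expectation p g"
  by (rule Bochner_Integration.integral_add) (use assms in \<open>auto intro: integrable_measure_pmf_finite\<close>)

lemma pmf_eq_expectation: "pmf p x = measure_pmf.expectation p (\<lambda>y. of_bool (y = x))"
  by (subst integral_measure_pmf_real[of "{x}"]) auto

lemma pmf_of_set_Times:
  assumes "finite A" "A \<noteq> {}" "finite B" "B \<noteq> {}"
  shows "pmf_of_set (A \<times> B) = pair_pmf (pmf_of_set A) (pmf_of_set B)"
proof (rule pmf_eqI)
  fix z :: "'a \<times> 'b"
  show "pmf (pmf_of_set (A \<times> B)) z = pmf (pair_pmf (pmf_of_set A) (pmf_of_set B)) z"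
    using assms by (cases z) (simp add: pmf_pair indicator_def card_cartesian_product)
qed

lemma finite_replicate_pmf: "finite (set_pmf p) \<Longrightarrow> finite (set_pmf (replicate_pmf n p))"
  by (simp add: set_replicate_pmf finite_lists_length_eq lists_eq_set)

lemma set_replicate_pmfD:
  "cs \<in> set_pmf (replicate_pmf n p) \<Longrightarrow> length cs = n"
  "cs \<in> set_pmf (replicate_pmf n p) \<Longrightarrow> set cs \<subseteq> set_pmf p"
  by (auto simp: set_replicate_pmf)

lemma expectation_replicate_pmf_split:
  fixes f g :: "'a list \<Rightarrow> real"
  assumes fin: "finite (set_pmf p)" and "k \<le> n"
  shows "measure_pmf.expectation (replicate_pmf n p) (\<lambda>cs. f (take k cs) * g (drop k cs)) =
         measure_pmf.expectation (replicate_pmf k p) f * measure_pmf.expectation (replicate_pmf (n - k) p) g"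
proof -
  have n: "n = k + (n - k)" using assms by simp
  note [simp] = finite_replicate_pmf[OF fin]
  have "measure_pmf.expectation (replicate_pmf n p) (\<lambda>cs. f (take k cs) * g (drop k cs)) =
    measure_pmf.expectation (replicate_pmf k p) (\<lambda>xs. measure_pmf.expectation (replicate_pmf (n - k) p)
      (\<lambda>ys. f (take k (xs @ ys)) * g (drop k (xs @ ys))))"
    by (subst n, subst replicate_pmf_distrib) (simp add: expectation_bind_pmf)
  also have "\<dots> = measure_pmf.expectation (replicate_pmf k p) (\<lambda>xs. measure_pmf.expectation (replicate_pmf (n - k) p)
      (\<lambda>ys. f xs * g ys))"
    by (intro expectation_cong_pmf) (simp add: set_replicate_pmf)
  finally show ?thesis by simp
qed

lemma (in group) conv_power_carrier:
  "set_pmf \<mu> \<subseteq> carrier G \<Longrightarrow> set_pmf (conv_power G \<mu> n) \<subseteq> carrier G"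
  by (induction n) auto

lemma finite_conv_power:
  "finite (set_pmf \<mu>) \<Longrightarrow> finite (set_pmf (conv_power G \<mu> n))"
  by (induction n) auto

text \<open>
  A walk with independent identically distributed steps has the same law at a fixed time whether the
  new step is multiplied on the right or on the left.  The left is the convenient side for wreath products:
  with the given action, a step multiplied on the left of \<open>(p, f)\<close> only changes lamps near \<open>p\<close>, whereas
  a step multiplied on the right shifts the whole configuration.
\<close>
lemma (in group) conv_power_Suc_left:
  assumes "set_pmf \<mu> \<subseteq> carrier G"
  shows "conv_power G \<mu> (Suc n) = map_pmf (\<lambda>(x, y). x \<otimes> y) (pair_pmf \<mu> (conv_power G \<mu> n))"
proof (induction n)
  case 0
  show ?case using assms
    by (auto simp: pair_return_pmf1 pair_return_pmf2 pmf.map_comp o_def intro!: map_pmf_cong)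
next
  case (Suc n)
  have "conv_power G \<mu> (Suc (Suc n)) =
    map_pmf (\<lambda>((x, y), z). (x \<otimes> y) \<otimes> z) (pair_pmf (pair_pmf \<mu> (conv_power G \<mu> n)) \<mu>)"
    by (subst conv_power.simps(2), subst Suc)
       (simp add: pair_map_pmf1 pmf.map_comp o_def case_prod_unfold)
  also have "\<dots> = map_pmf (\<lambda>((x, y), z). x \<otimes> (y \<otimes> z)) (pair_pmf (pair_pmf \<mu> (conv_power G \<mu> n)) \<mu>)"
    using assms conv_power_carrier[OF assms] by (intro map_pmf_cong) (auto simp: m_assoc subset_iff)
  also have "\<dots> = map_pmf (\<lambda>(x, y). x \<otimes> y) (pair_pmf \<mu> (conv_power G \<mu> (Suc n)))"
    by (simp add: pair_pmf_def map_pmf_def bind_assoc_pmf bind_return_pmf)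
  finally show ?case .
qed

lemma (in group) conv_power_Suc_bind:
  assumes "set_pmf \<mu> \<subseteq> carrier G"
  shows "conv_power G \<mu> (Suc n) = bind_pmf \<mu> (\<lambda>a. map_pmf ((\<otimes>) a) (conv_power G \<mu> n))"
  unfolding conv_power_Suc_left[OF assms]
  by (simp add: pair_pmf_def map_pmf_def bind_assoc_pmf bind_return_pmf)

lemma (in group) conv_power_word_prod:
  assumes "set_pmf \<mu> \<subseteq> carrier G"
  shows "conv_power G \<mu> n = map_pmf (word_prod G) (replicate_pmf n \<mu>)"
proof (induction n)
  case (Suc n)
  show ?case
    by (subst conv_power_Suc_left[OF assms], subst Suc)
       (simp add: pair_pmf_def map_pmf_def bind_assoc_pmf bind_return_pmf)
qed simp

section \<open>Green function, range and local times\<close>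

text \<open>
  A path is the list of its increments, the latest one first.  Its position is the product of the list,
  and its earlier positions are the products of the suffixes.
\<close>
locale finite_walk = group G for G (structure) +
  fixes \<nu>
  assumes finite_support: "finite (set_pmf \<nu>)"
    and support_carrier: "set_pmf \<nu> \<subseteq> carrier G"
begin

definition return_prob :: "nat \<Rightarrow> real" where
  "return_prob k = pmf (conv_power G \<nu> k) \<one>"

definition green :: "nat \<Rightarrow> real" where
  "green n = (\<Sum>k\<le>n. return_prob k)"

abbreviation "steps n \<equiv> replicate_pmf n \<nu>"

primrec visited :: "'a list \<Rightarrow> 'a set" where
  "visited [] = {\<one>}"
| "visited (c # cs) = insert (word_prod G (c # cs)) (visited cs)"

text \<open>
  Each step counts once at its start and once at its end, because the switch-walk-switch walk switches
  the lamp at both places.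
\<close>
primrec local_time :: "'a list \<Rightarrow> 'a \<Rightarrow> nat" where
  "local_time [] x = 0"
| "local_time (c # cs) x =
     local_time cs x + of_bool (word_prod G cs = x) + of_bool (word_prod G (c # cs) = x)"

text \<open>
  Read from the head of the list, that is backwards in time: the path does not come back to its
  endpoint.  Equivalently, its last position is new.
\<close>
definition no_return :: "'a list \<Rightarrow> bool" where
  "no_return cs \<longleftrightarrow> (\<forall>k\<in>{1..length cs}. word_prod G (take k cs) \<noteq> \<one>)"

lemma finite_steps: "finite (set_pmf (steps n))"
  by (rule finite_replicate_pmf[OF finite_support])

lemma steps_carrier: "cs \<in> set_pmf (steps n) \<Longrightarrow> set cs \<subseteq> carrier G"
  using support_carrier by (auto simp: set_replicate_pmf)

lemma finite_visited: "finite (visited cs)"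
  by (induction cs) auto

lemma visited_carrier: "set cs \<subseteq> carrier G \<Longrightarrow> visited cs \<subseteq> carrier G"
  using word_prod_closed by (induction cs) auto

lemma word_prod_in_visited: "word_prod G cs \<in> visited cs"
  by (cases cs) auto

lemma visited_eq_suffixes: "visited cs = (\<lambda>k. word_prod G (drop k cs)) ` {..length cs}"
proof (induction cs)
  case (Cons c cs)
  have "{..length (c # cs)} = insert 0 (Suc ` {..length cs})"
    by (simp add: atMost_Suc_eq_insert_0)
  then show ?case by (simp add: Cons image_image)
qed simp

text \<open>
  A coincidence between two positions only depends on the increments in between.  This makes return
  events independent of what comes before and after.
\<close>
lemma suffix_prod_eq_iff:
  assumes "set cs \<subseteq> carrier G"
  shows "word_prod G (drop k cs) = word_prod G cs \<longleftrightarrow> word_prod G (take k cs) = \<one>"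
proof -
  have "set (take k cs) \<subseteq> carrier G" "set (drop k cs) \<subseteq> carrier G"
    using assms set_take_subset[of k cs] set_drop_subset[of k cs] by auto
  then have eq: "word_prod G cs = word_prod G (take k cs) \<otimes> word_prod G (drop k cs)"
    and closed: "word_prod G (take k cs) \<in> carrier G" "word_prod G (drop k cs) \<in> carrier G"
    using word_prod_append[of "take k cs" "drop k cs"] word_prod_closed by auto
  from closed show ?thesis by (subst eq) simp
qed

lemma card_visited:
  assumes "set cs \<subseteq> carrier G"
  shows "card (visited cs) = (\<Sum>k\<le>length cs. of_bool (no_return (drop k cs)))"
  using assms
proof (induction cs)
  case Nil
  show ?case by (simp add: no_return_def)
next
  case (Cons c cs)
  have "word_prod G (c # cs) \<in> visited cs \<longleftrightarrow>
      (\<exists>k\<in>{..length cs}. word_prod G (drop (Suc k) (c # cs)) = word_prod G (c # cs))"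
    by (auto simp: visited_eq_suffixes image_iff eq_commute)
  also have "\<dots> \<longleftrightarrow> (\<exists>k\<in>{..length cs}. word_prod G (take (Suc k) (c # cs)) = \<one>)"
    by (subst suffix_prod_eq_iff[OF Cons.prems]) simp
  also have "\<dots> \<longleftrightarrow> (\<exists>k\<in>Suc ` {..length cs}. word_prod G (take k (c # cs)) = \<one>)"
    by blast
  also have "Suc ` {..length cs} = {1..length (c # cs)}"
    by (simp add: image_Suc_atMost)
  finally have *: "word_prod G (c # cs) \<in> visited cs \<longleftrightarrow> \<not> no_return (c # cs)"
    by (simp add: no_return_def)
  have "(\<Sum>k\<le>length (c # cs). of_bool (no_return (drop k (c # cs)))) =
      of_bool (no_return (c # cs)) + (\<Sum>k\<le>length cs. of_bool (no_return (drop k cs)))"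
    by (simp del: sum.atMost_Suc add: sum.atMost_Suc_shift)
  moreover have "card (visited cs) = (\<Sum>k\<le>length cs. of_bool (no_return (drop k cs)))"
    using Cons by auto
  moreover have "card (visited (c # cs)) = of_bool (no_return (c # cs)) + card (visited cs)"
    using * by (simp add: finite_visited card_insert_if)
  ultimately show ?case by metis
qed

text \<open>
  Decompose a path at the longest prefix with trivial product.  It is followed by a piece without
  return, so exactly one summand is nonzero.
\<close>
lemma last_return_unique:
  assumes "set cs \<subseteq> carrier G"
  shows "(\<Sum>k\<le>length cs. of_bool (word_prod G (take k cs) = \<one>) * of_bool (no_return (drop k cs))) = (1::real)"
proof -
  define A where "A = {k. k \<le> length cs \<and> word_prod G (take k cs) = \<one>}"
  have A: "finite A" "A \<noteq> {}" unfolding A_def by (auto intro!: exI[of _ 0])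
  have sub: "set (take k cs) \<subseteq> carrier G" "set (drop k cs) \<subseteq> carrier G" for k
    using assms set_take_subset[of k cs] set_drop_subset[of k cs] by auto
  have iff: "no_return (drop k cs) \<longleftrightarrow> k = Max A" if k: "k \<in> A" for k
  proof -
    have shift: "word_prod G (take (k + j) cs) = word_prod G (take j (drop k cs))" for j
    proof -
      have s: "set (take j (drop k cs)) \<subseteq> carrier G"
        using sub(2)[of k] set_take_subset[of j "drop k cs"] by blast
      show ?thesis
        using k word_prod_append[OF sub(1)[of k] s] word_prod_closed[OF s]
        by (simp add: take_add A_def)
    qed
    have "no_return (drop k cs) \<longleftrightarrow> (\<forall>l. l \<in> A \<longrightarrow> l \<le> k)"
    proof
      assume nr: "no_return (drop k cs)"
      show "\<forall>l. l \<in> A \<longrightarrow> l \<le> k"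
      proof (intro allI impI, rule ccontr)
        fix l assume l: "l \<in> A" "\<not> l \<le> k"
        then have "l - k \<in> {1..length (drop k cs)}" by (auto simp: A_def)
        with nr have "word_prod G (take (l - k) (drop k cs)) \<noteq> \<one>" by (auto simp: no_return_def)
        with shift[of "l - k"] l show False by (simp add: A_def)
      qed
    next
      assume "\<forall>l. l \<in> A \<longrightarrow> l \<le> k"
      then have "k + j \<notin> A" if "j \<ge> 1" for j using that by (metis add_le_same_cancel1 not_one_le_zero order_trans)
      then show "no_return (drop k cs)"
        using k by (auto simp: no_return_def A_def shift)
    qed
    also have "\<dots> \<longleftrightarrow> k = Max A"
      using A k by (metis Max_eqI Max_ge)
    finally show ?thesis .
  qed
  have "(\<Sum>k\<le>length cs. of_bool (word_prod G (take k cs) = \<one>) * of_bool (no_return (drop k cs))) =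
        (\<Sum>k\<le>length cs. of_bool (k = Max A) :: real)"
  proof (rule sum.cong)
    fix k assume "k \<in> {..length cs}"
    then show "of_bool (word_prod G (take k cs) = \<one>) * of_bool (no_return (drop k cs)) = (of_bool (k = Max A) :: real)"
      using iff[of k] Max_in[OF A] by (auto simp: A_def)
  qed simp
  also have "\<dots> = 1" using Max_in[OF A] by (simp add: A_def of_bool_def)
  finally show ?thesis .
qed

lemma return_prob_eq:
  "return_prob k = measure_pmf.expectation (steps k) (\<lambda>cs. of_bool (word_prod G cs = \<one>))"
  unfolding return_prob_def conv_power_word_prod[OF support_carrier]
  by (simp add: pmf_eq_expectation)

lemma return_prob_nonneg: "return_prob k \<ge> 0"
  by (simp add: return_prob_def)

lemma green_nonneg: "green n \<ge> 0"
  by (simp add: green_def sum_nonneg return_prob_nonneg)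

text \<open>
  With \<open>p\<^sub>k\<close> the return probability and \<open>q\<^sub>k\<close> the probability of no return in \<open>k\<close> steps, the decomposition
  above reads \<open>\<Sum>\<^sub>k\<^sub>\<le>\<^sub>m p\<^sub>k q\<^sub>m\<^sub>-\<^sub>k = 1\<close>.  The expected range is \<open>\<Sum>\<^sub>k\<^sub>\<le>\<^sub>n q\<^sub>k\<close>, since \<open>q\<^sub>k\<close> is also the
  probability that the position at time \<open>k\<close> is new.  Summing the identity over \<open>m \<le> 2n\<close> covers every
  pair of indices up to \<open>n\<close>.
\<close>
lemma range_green_le:
  "measure_pmf.expectation (steps n) (\<lambda>cs. real (card (visited cs))) * green n \<le> 2 * real n + 1"
proof -
  define q where "q k = measure_pmf.expectation (steps k) (\<lambda>cs. of_bool (no_return cs) :: real)" for k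
  have q_nonneg: "q k \<ge> 0" for k by (simp add: q_def)
  have renewal: "(\<Sum>k\<le>m. return_prob k * q (m - k)) = 1" for m
  proof -
    have "(\<Sum>k\<le>m. return_prob k * q (m - k)) = (\<Sum>k\<le>m. measure_pmf.expectation (steps m)
        (\<lambda>cs. of_bool (word_prod G (take k cs) = \<one>) * of_bool (no_return (drop k cs))))"
      unfolding return_prob_eq q_def
      by (intro sum.cong refl expectation_replicate_pmf_split[OF finite_support, symmetric]) simp
    also have "\<dots> = measure_pmf.expectation (steps m)
        (\<lambda>cs. \<Sum>k\<le>m. of_bool (word_prod G (take k cs) = \<one>) * of_bool (no_return (drop k cs)))"
      by (rule expectation_sum_pmf[OF finite_steps, symmetric])
    also have "\<dots> = measure_pmf.expectation (steps m) (\<lambda>cs. 1)"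
      using last_return_unique steps_carrier
      by (intro expectation_cong_pmf) (metis set_replicate_pmfD(1))
    finally show ?thesis by simp
  qed
  have "measure_pmf.expectation (steps n) (\<lambda>cs. real (card (visited cs))) =
     measure_pmf.expectation (steps n) (\<lambda>cs. \<Sum>k\<le>n. 1 * of_bool (no_return (drop k cs)))"
  proof (rule expectation_cong_pmf)
    fix cs assume cs: "cs \<in> set_pmf (steps n)"
    show "real (card (visited cs)) = (\<Sum>k\<le>n. 1 * of_bool (no_return (drop k cs)))"
      using card_visited[OF steps_carrier[OF cs]] set_replicate_pmfD(1)[OF cs] by simp
  qed
  also have "\<dots> = (\<Sum>k\<le>n. measure_pmf.expectation (steps n) (\<lambda>cs. 1 * of_bool (no_return (drop k cs))))"
    by (rule expectation_sum_pmf[OF finite_steps])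
  also have "\<dots> = (\<Sum>k\<le>n. q (n - k))"
    unfolding q_def
  proof (rule sum.cong)
    fix k assume "k \<in> {..n}"
    then show "measure_pmf.expectation (steps n) (\<lambda>cs. 1 * of_bool (no_return (drop k cs)) :: real) =
        measure_pmf.expectation (steps (n - k)) (\<lambda>cs. of_bool (no_return cs))"
      using expectation_replicate_pmf_split[OF finite_support, of k n "\<lambda>_. 1" "\<lambda>cs. of_bool (no_return cs)"]
      by (simp del: mult_1)
  qed simp
  also have "\<dots> = (\<Sum>k\<le>n. q k)"
    using sum.nat_diff_reindex[of q "Suc n"] by (simp only: lessThan_Suc_atMost diff_Suc_Suc)
  finally have range_eq: "measure_pmf.expectation (steps n) (\<lambda>cs. real (card (visited cs))) = (\<Sum>k\<le>n. q k)" .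
  have "(\<Sum>k\<le>n. q k) * green n = (\<Sum>k\<le>n. return_prob k) * (\<Sum>j\<le>n. q j)"
    by (simp only: green_def mult.commute)
  also have "\<dots> = (\<Sum>k\<le>n. \<Sum>j\<le>n. return_prob k * q j)"
    by (rule sum_product)
  also have "\<dots> = (\<Sum>(k, j)\<in>{..n} \<times> {..n}. return_prob k * q j)"
    by (rule sum.cartesian_product)
  also have "\<dots> \<le> (\<Sum>(k, j)\<in>{(k, j). k + j \<le> 2 * n}. return_prob k * q j)"
  proof (rule sum_mono2)
    have "{(k, j). k + j \<le> 2 * n} \<subseteq> {..2 * n} \<times> {..2 * n}" by auto
    then show "finite {(k, j). k + j \<le> 2 * n}" by (rule finite_subset) simp
  qed (auto simp: return_prob_nonneg q_nonneg)
  also have "\<dots> = (\<Sum>m\<le>2 * n. \<Sum>k\<le>m. return_prob k * q (m - k))"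
    by (rule sum.triangle_reindex_eq)
  also have "\<dots> = 2 * real n + 1" by (simp add: renewal)
  finally show ?thesis by (simp add: range_eq)
qed

lemma local_time_eq_0: "x \<notin> visited cs \<Longrightarrow> local_time cs x = 0"
  using word_prod_in_visited by (induction cs) auto

lemma sum_local_time: "(\<Sum>x\<in>visited cs. local_time cs x) = 2 * length cs"
proof (induction cs)
  case (Cons c cs)
  let ?A = "visited (c # cs)"
  have "(\<Sum>x\<in>?A. local_time cs x) = (\<Sum>x\<in>visited cs. local_time cs x)"
    by (rule sum.mono_neutral_right) (auto simp: finite_visited local_time_eq_0)
  moreover have "(\<Sum>x\<in>?A. of_bool (word_prod G cs = x)) = (1::nat)"
    "(\<Sum>x\<in>?A. of_bool (word_prod G (c # cs) = x)) = (1::nat)"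
    using word_prod_in_visited[of cs] by (simp_all add: of_bool_def finite_visited)
  ultimately show ?case by (simp add: sum.distrib Cons del: visited.simps foldr.simps)
qed simp

definition visits :: "'a list \<Rightarrow> 'a \<Rightarrow> nat" where
  "visits cs x = (\<Sum>k\<le>length cs. of_bool (word_prod G (drop k cs) = x))"

lemma local_time_le_visits: "local_time cs x \<le> 2 * visits cs x"
proof -
  have "local_time cs x + of_bool (word_prod G cs = x) \<le> 2 * visits cs x"
  proof (induction cs)
    case (Cons c cs)
    have "visits (c # cs) x = visits cs x + of_bool (word_prod G (c # cs) = x)"
      unfolding visits_def by (simp del: sum.atMost_Suc add: sum.atMost_Suc_shift)
    with Cons show ?case by (simp del: foldr.simps)
  qed (simp add: visits_def)
  then show ?thesis by simp
qed

lemma sum_visits_sq: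
  "(\<Sum>x\<in>visited cs. (visits cs x)\<^sup>2) =
   (\<Sum>j\<le>length cs. \<Sum>k\<le>length cs. of_bool (word_prod G (drop j cs) = word_prod G (drop k cs)))"
proof -
  have "(\<Sum>x\<in>visited cs. (visits cs x)\<^sup>2) = (\<Sum>x\<in>visited cs. \<Sum>j\<le>length cs. \<Sum>k\<le>length cs.
     of_bool (word_prod G (drop j cs) = x) * of_bool (word_prod G (drop k cs) = x))"
    by (simp add: visits_def power2_eq_square sum_product del: sum_of_bool_eq sum_of_bool_mult_eq sum_mult_of_bool_eq)
  also have "\<dots> = (\<Sum>j\<le>length cs. \<Sum>x\<in>visited cs. \<Sum>k\<le>length cs.
     of_bool (word_prod G (drop j cs) = x) * of_bool (word_prod G (drop k cs) = x))"
    by (rule sum.swap)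
  also have "\<dots> = (\<Sum>j\<le>length cs. \<Sum>k\<le>length cs. \<Sum>x\<in>visited cs.
     of_bool (word_prod G (drop j cs) = x) * of_bool (word_prod G (drop k cs) = x))"
    by (intro sum.cong refl sum.swap)
  also have "\<dots> = (\<Sum>j\<le>length cs. \<Sum>k\<le>length cs. of_bool (word_prod G (drop j cs) = word_prod G (drop k cs)))"
  proof (intro sum.cong refl)
    fix j k assume "j \<in> {..length cs}" "k \<in> {..length cs}"
    then have "word_prod G (drop j cs) \<in> visited cs" by (auto simp: visited_eq_suffixes)
    moreover have "(\<Sum>x\<in>visited cs. of_bool (word_prod G (drop j cs) = x) * of_bool (word_prod G (drop k cs) = x)) =
       (\<Sum>x\<in>visited cs. if word_prod G (drop j cs) = x then of_bool (word_prod G (drop k cs) = word_prod G (drop j cs)) else (0::nat))"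
      by (intro sum.cong) auto
    ultimately show "(\<Sum>x\<in>visited cs. of_bool (word_prod G (drop j cs) = x) * of_bool (word_prod G (drop k cs) = x)) =
      (of_bool (word_prod G (drop j cs) = word_prod G (drop k cs)) :: nat)"
      by (simp add: finite_visited eq_commute del: sum_of_bool_eq sum_of_bool_mult_eq sum_mult_of_bool_eq)
  qed
  finally show ?thesis .
qed

lemma collision_prob:
  assumes "j \<le> k" "k \<le> n"
  shows "measure_pmf.expectation (steps n) (\<lambda>cs. of_bool (word_prod G (drop j cs) = word_prod G (drop k cs)) :: real) =
         return_prob (k - j)"
proof -
  have "measure_pmf.expectation (steps n) (\<lambda>cs. of_bool (word_prod G (drop j cs) = word_prod G (drop k cs)) :: real) =
    measure_pmf.expectation (steps n) (\<lambda>cs. 1 * of_bool (word_prod G (take (k - j) (drop j cs)) = \<one>))"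
  proof (rule expectation_cong_pmf)
    fix cs assume "cs \<in> set_pmf (steps n)"
    then have "set (drop j cs) \<subseteq> carrier G"
      using steps_carrier set_drop_subset[of j cs] by blast
    from suffix_prod_eq_iff[OF this, of "k - j"] assms
    show "of_bool (word_prod G (drop j cs) = word_prod G (drop k cs)) =
      1 * (of_bool (word_prod G (take (k - j) (drop j cs)) = \<one>) :: real)"
      by (simp add: eq_commute)
  qed
  also have "\<dots> = measure_pmf.expectation (steps (n - j)) (\<lambda>cs. of_bool (word_prod G (take (k - j) cs) = \<one>) * 1)"
    using expectation_replicate_pmf_split[OF finite_support, of j n "\<lambda>_. 1"
        "\<lambda>cs. of_bool (word_prod G (take (k - j) cs) = \<one>)"] assms by simp
  also have "\<dots> = return_prob (k - j)"
    using expectation_replicate_pmf_split[OF finite_support, of "k - j" "n - j"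
        "\<lambda>cs. of_bool (word_prod G cs = \<one>)" "\<lambda>_. 1"] assms by (simp add: return_prob_eq)
  finally show ?thesis .
qed

text \<open>
  The sum of the squared visit numbers counts the pairs of times at which the path is at the same place;
  for a fixed first time, the expected number of such second times is at most \<open>2 G(n)\<close>.
\<close>
lemma expectation_local_time_sq_le:
  "measure_pmf.expectation (steps n) (\<lambda>cs. \<Sum>x\<in>visited cs. (real (local_time cs x))\<^sup>2) \<le> 8 * (real n + 1) * green n"
proof -
  have "measure_pmf.expectation (steps n) (\<lambda>cs. \<Sum>x\<in>visited cs. (real (local_time cs x))\<^sup>2) \<le>
    measure_pmf.expectation (steps n) (\<lambda>cs. \<Sum>j\<le>n. \<Sum>k\<le>n. 4 * of_bool (word_prod G (drop j cs) = word_prod G (drop k cs)))"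
  proof (rule expectation_mono_pmf[OF finite_steps])
    fix cs assume cs: "cs \<in> set_pmf (steps n)"
    have "(\<Sum>x\<in>visited cs. (real (local_time cs x))\<^sup>2) \<le> (\<Sum>x\<in>visited cs. (real (2 * visits cs x))\<^sup>2)"
      by (intro sum_mono power_mono) (use local_time_le_visits in \<open>auto simp del: of_nat_mult\<close>)
    also have "\<dots> = 4 * real (\<Sum>x\<in>visited cs. (visits cs x)\<^sup>2)"
      by (simp add: sum_distrib_left power_mult_distrib)
    also have "\<dots> = (\<Sum>j\<le>n. \<Sum>k\<le>n. 4 * of_bool (word_prod G (drop j cs) = word_prod G (drop k cs)))"
      unfolding sum_visits_sq set_replicate_pmfD(1)[OF cs] by (simp add: sum_distrib_left del: sum_of_bool_eq sum_of_bool_mult_eq sum_mult_of_bool_eq)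
    finally show "(\<Sum>x\<in>visited cs. (real (local_time cs x))\<^sup>2) \<le> \<dots>" .
  qed
  also have "\<dots> = (\<Sum>j\<le>n. \<Sum>k\<le>n. 4 * measure_pmf.expectation (steps n)
      (\<lambda>cs. of_bool (word_prod G (drop j cs) = word_prod G (drop k cs))))"
    by (simp add: expectation_sum_pmf[OF finite_steps] del: sum_of_bool_eq sum_of_bool_mult_eq sum_mult_of_bool_eq)
  also have "\<dots> \<le> (\<Sum>j\<le>n. 8 * green n)"
  proof (rule sum_mono)
    fix j assume j: "j \<in> {..n}"
    let ?e = "\<lambda>k. measure_pmf.expectation (steps n)
      (\<lambda>cs. of_bool (word_prod G (drop j cs) = word_prod G (drop k cs)) :: real)"
    have le: "(\<Sum>k\<in>A. return_prob (f k)) \<le> green n" if "inj_on f A" "f ` A \<subseteq> {..n}" for f and A :: "nat set"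
    proof -
      have "(\<Sum>k\<in>A. return_prob (f k)) = (\<Sum>k\<in>f ` A. return_prob k)"
        using that by (simp add: sum.reindex)
      also have "\<dots> \<le> green n"
        unfolding green_def by (rule sum_mono2) (use that return_prob_nonneg in auto)
      finally show ?thesis .
    qed
    have split: "{..n} = {..<j} \<union> {j..n}" using j by auto
    have "(\<Sum>k\<le>n. ?e k) = (\<Sum>k<j. ?e k) + (\<Sum>k=j..n. ?e k)"
      unfolding split by (rule sum.union_disjoint) auto
    also have "(\<Sum>k<j. ?e k) = (\<Sum>k<j. return_prob (j - k))"
    proof (rule sum.cong)
      fix k assume "k \<in> {..<j}"
      then show "?e k = return_prob (j - k)"
        using collision_prob[of k j n] j by (simp add: eq_commute)
    qed simp
    also have "(\<Sum>k=j..n. ?e k) = (\<Sum>k=j..n. return_prob (k - j))"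
      by (intro sum.cong refl collision_prob) auto
    also have "(\<Sum>k<j. return_prob (j - k)) + (\<Sum>k=j..n. return_prob (k - j)) \<le> green n + green n"
      by (intro add_mono le) (use j in \<open>auto intro!: inj_onI\<close>)
    finally show "(\<Sum>k\<le>n. 4 * ?e k) \<le> 8 * green n"
      by (simp add: sum_distrib_left[symmetric])
  qed
  also have "\<dots> = 8 * (real n + 1) * green n" by simp
  finally show ?thesis .
qed

lemma visited_append_supset: "visited v \<subseteq> visited (u @ v)"
  by (induction u) auto

lemma visited_append_mono:
  assumes "word_prod G r = word_prod G r'" "visited r \<subseteq> visited r'"
  shows "visited (u @ r) \<subseteq> visited (u @ r')"
proof -
  have "word_prod G (u @ r) = word_prod G (u @ r')" for u
    by (induction u) (simp_all add: assms del: foldr_append)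
  then show ?thesis using assms(2) by (induction u) (auto simp del: foldr_append)
qed

lemma visited_split:
  assumes "x \<in> visited cs"
  obtains u v where "cs = u @ v" "word_prod G v = x"
proof -
  from assms obtain k where "x = word_prod G (drop k cs)" unfolding visited_eq_suffixes by blast
  then show ?thesis using that[of "take k cs" "drop k cs"] by simp
qed

text \<open>
  A closed tour of all visited sites that traverses each edge of a spanning tree twice: whenever the path
  reaches a new site, a detour of two steps is inserted at the place where the tour passes the
  previous site.
\<close>
lemma closed_tour:
  assumes "A \<subseteq> carrier G" "\<And>x. x \<in> A \<Longrightarrow> inv x \<in> A" "set cs \<subseteq> A"
  shows "\<exists>u. set u \<subseteq> A \<and> word_prod G u = \<one> \<and> visited cs \<subseteq> visited u \<and> length u + 2 \<le> 2 * card (visited cs)"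
  using assms(3)
proof (induction cs)
  case Nil
  show ?case by (rule exI[of _ "[]"]) simp
next
  case (Cons c cs)
  then obtain u where u: "set u \<subseteq> A" "word_prod G u = \<one>" "visited cs \<subseteq> visited u"
    "length u + 2 \<le> 2 * card (visited cs)" by auto
  show ?case
  proof (cases "word_prod G (c # cs) \<in> visited cs")
    case True
    then have "visited (c # cs) = visited cs" by auto
    with u show ?thesis by auto
  next
    case False
    have "word_prod G cs \<in> visited u" using u(3) word_prod_in_visited by blast
    then obtain u1 u2 where u12: "u = u1 @ u2" "word_prod G u2 = word_prod G cs"
      by (rule visited_split)
    define r where "r = inv c # c # u2"
    have c: "c \<in> carrier G" "inv c \<in> A" "c \<in> A" using Cons.prems assms by auto
    have sub: "set u1 \<subseteq> carrier G" "set u2 \<subseteq> carrier G" "set r \<subseteq> carrier G"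
      using u(1) u12(1) assms(1) c by (auto simp: r_def)
    have w2: "word_prod G u2 \<in> carrier G" by (rule word_prod_closed[OF sub(2)])
    then have r: "word_prod G r = word_prod G u2" using c by (simp add: r_def m_assoc[symmetric])
    have vr: "visited u2 \<subseteq> visited r" by (auto simp: r_def)
    have "word_prod G (c # cs) \<in> visited r" using u12(2) by (simp add: r_def)
    then have "word_prod G (c # cs) \<in> visited (u1 @ r)" using visited_append_supset by blast
    moreover have "visited u \<subseteq> visited (u1 @ r)"
      unfolding u12(1) by (rule visited_append_mono) (use r vr in auto)
    ultimately have "visited (c # cs) \<subseteq> visited (u1 @ r)" using u(3) by auto
    moreover have "word_prod G (u1 @ r) = \<one>"
      using word_prod_append[OF sub(1,3)] word_prod_append[OF sub(1,2)] r u(2) u12(1) by simp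
    moreover have "length (u1 @ r) + 2 \<le> 2 * card (visited (c # cs))"
      using u(4) u12(1) False by (simp add: r_def finite_visited)
    moreover have "set (u1 @ r) \<subseteq> A" using u(1) u12(1) c by (auto simp: r_def)
    ultimately show ?thesis by blast
  qed
qed

end

section \<open>Words in a wreath product\<close>

locale wreath_groups = C: group C + D: group D
  for C :: "('c, 'm) monoid_scheme" and D :: "('d, 'k) monoid_scheme"
begin

abbreviation "W \<equiv> wreath C D"

definition lamp :: "'d \<Rightarrow> 'c \<times> ('c \<Rightarrow> 'd)" where
  "lamp a = (\<one>\<^bsub>C\<^esub>, \<lambda>x\<in>carrier C. if x = \<one>\<^bsub>C\<^esub> then a else \<one>\<^bsub>D\<^esub>)"

definition move :: "'c \<Rightarrow> 'c \<times> ('c \<Rightarrow> 'd)" where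
  "move c = (c, \<lambda>x\<in>carrier C. \<one>\<^bsub>D\<^esub>)"

sublocale W: group "wreath C D"
  by (rule group_wreath) (rule C.group_axioms D.group_axioms)+

lemmas wreath_simps' = wreath_simps[OF C.group_axioms D.group_axioms]

lemma lamp_closed [simp]: "a \<in> carrier D \<Longrightarrow> lamp a \<in> carrier W"
  by (auto simp: lamp_def wreath_simps' intro: finite_subset[of _ "{\<one>\<^bsub>C\<^esub>}"])

lemma move_closed [simp]: "c \<in> carrier C \<Longrightarrow> move c \<in> carrier W"
  by (auto simp: move_def wreath_simps')

lemma carrier_wreathD:
  assumes "(p, f) \<in> carrier W"
  shows "p \<in> carrier C" "\<And>x. x \<in> carrier C \<Longrightarrow> f x \<in> carrier D"
    "f \<in> extensional (carrier C)" "finite {x \<in> carrier C. f x \<noteq> \<one>\<^bsub>D\<^esub>}"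
  using assms by (auto simp: wreath_simps' PiE_iff)

lemma carrier_wreathI:
  assumes "p \<in> carrier C" "\<And>x. x \<in> carrier C \<Longrightarrow> f x \<in> carrier D"
    "f \<in> extensional (carrier C)" "finite {x \<in> carrier C. f x \<noteq> \<one>\<^bsub>D\<^esub>}"
  shows "(p, f) \<in> carrier W"
  using assms by (auto simp: wreath_simps' PiE_iff)

text \<open>
  Multiplying by \<open>lamp a\<close> on the left acts on the lamp at the current position \<open>p\<close>, since the shift by
  \<open>p\<close> moves the lamp at \<open>1\<close> there.
\<close>
lemma lamp_mult:
  assumes a: "a \<in> carrier D" and pf: "(p, f) \<in> carrier W"
  shows "lamp a \<otimes>\<^bsub>W\<^esub> (p, f) = (p, f(p := a \<otimes>\<^bsub>D\<^esub> f p))"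
proof -
  note pf = carrier_wreathD[OF pf]
  have "x \<otimes>\<^bsub>C\<^esub> inv\<^bsub>C\<^esub> p = \<one>\<^bsub>C\<^esub> \<longleftrightarrow> x = p" if "x \<in> carrier C" for x
    using that pf(1) by (metis C.inv_closed C.inv_comm C.inv_equality C.inv_inv C.r_inv)
  then show ?thesis
    using assms pf by (auto simp: lamp_def wreath_simps' fun_eq_iff restrict_def extensional_def)
qed

lemma move_mult:
  assumes "c \<in> carrier C" and pf: "(p, f) \<in> carrier W"
  shows "move c \<otimes>\<^bsub>W\<^esub> (p, f) = (c \<otimes>\<^bsub>C\<^esub> p, f)"
  using assms carrier_wreathD[OF pf]
  by (auto simp: move_def wreath_simps' fun_eq_iff restrict_def extensional_def)

lemma lamp_one: "lamp \<one>\<^bsub>D\<^esub> = \<one>\<^bsub>W\<^esub>"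
  by (auto simp: lamp_def wreath_simps' fun_eq_iff)

lemma move_one: "move \<one>\<^bsub>C\<^esub> = \<one>\<^bsub>W\<^esub>"
  by (auto simp: move_def wreath_simps' fun_eq_iff)

lemma lamp_lamp:
  assumes "a \<in> carrier D" "b \<in> carrier D"
  shows "lamp a \<otimes>\<^bsub>W\<^esub> lamp b = lamp (a \<otimes>\<^bsub>D\<^esub> b)"
  using lamp_mult[OF assms(1), of "\<one>\<^bsub>C\<^esub>" "snd (lamp b)"] lamp_closed[OF assms(2)]
  by (auto simp: lamp_def fun_eq_iff)

lemma move_move:
  assumes "c \<in> carrier C" "d \<in> carrier C"
  shows "move c \<otimes>\<^bsub>W\<^esub> move d = move (c \<otimes>\<^bsub>C\<^esub> d)"
  using move_mult[OF assms(1), of d "snd (move d)"] move_closed[OF assms(2)]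
  by (auto simp: move_def fun_eq_iff)

lemma inv_lamp: "a \<in> carrier D \<Longrightarrow> inv\<^bsub>W\<^esub> lamp a = lamp (inv\<^bsub>D\<^esub> a)"
  by (rule W.inv_equality) (simp_all add: lamp_lamp lamp_one)

lemma inv_move: "c \<in> carrier C \<Longrightarrow> inv\<^bsub>W\<^esub> move c = move (inv\<^bsub>C\<^esub> c)"
  by (rule W.inv_equality) (simp_all add: move_move move_one)

text \<open>
  A finitely supported configuration is built up one site \<open>y\<close> at a time, by going to \<open>y\<close>, switching the lamp
  there and going back.
\<close>
lemma generate_wreathI:
  fixes Y :: "('c \<times> ('c \<Rightarrow> 'd)) set"
  assumes X: "Y \<subseteq> carrier W"
    and moves: "\<And>x. x \<in> carrier C \<Longrightarrow> move x \<in> generate W Y"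
    and lamps: "\<And>x. x \<in> carrier D \<Longrightarrow> lamp x \<in> generate W Y"
  shows "generate W Y = carrier W"
proof
  show "generate W Y \<subseteq> carrier W" using X by (rule W.generate_incl)
  have *: "(\<one>\<^bsub>C\<^esub>, f) \<in> generate W Y"
    if "finite A" "A \<subseteq> carrier C" "f \<in> extensional (carrier C)" "\<And>x. x \<in> carrier C \<Longrightarrow> f x \<in> carrier D"
      "\<And>x. x \<in> carrier C \<Longrightarrow> x \<notin> A \<Longrightarrow> f x = \<one>\<^bsub>D\<^esub>" for A f
    using that
  proof (induction A arbitrary: f rule: finite_induct)
    case empty
    then have "(\<one>\<^bsub>C\<^esub>, f) = \<one>\<^bsub>W\<^esub>"
      by (auto simp: wreath_simps' fun_eq_iff extensional_def restrict_def)
    then show ?case by (simp add: generate.one)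
  next
    case (insert y A)
    define f' where "f' = f(y := \<one>\<^bsub>D\<^esub>)"
    have y: "y \<in> carrier C" and fy: "f y \<in> carrier D" using insert.prems by auto
    have IH: "(\<one>\<^bsub>C\<^esub>, f') \<in> generate W Y"
      by (rule insert.IH) (use insert.prems in \<open>auto simp: f'_def extensional_def\<close>)
    then have f': "(\<one>\<^bsub>C\<^esub>, f') \<in> carrier W" using X W.generate_in_carrier by blast
    then have yf': "(y, f') \<in> carrier W" using y by (simp add: wreath_simps')
    have "finite {x \<in> carrier C. f x \<noteq> \<one>\<^bsub>D\<^esub>}"
      by (rule finite_subset[of _ "insert y A"]) (use insert in auto)
    then have yf: "(y, f) \<in> carrier W" using insert.prems y by (intro carrier_wreathI) auto
    have "(\<one>\<^bsub>C\<^esub>, f) = move (inv\<^bsub>C\<^esub> y) \<otimes>\<^bsub>W\<^esub> (lamp (f y) \<otimes>\<^bsub>W\<^esub> (move y \<otimes>\<^bsub>W\<^esub> (\<one>\<^bsub>C\<^esub>, f')))"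
      using y fy f' yf' yf by (simp add: move_mult lamp_mult f'_def)
    also have "\<dots> \<in> generate W Y"
      using y fy by (intro generate.eng moves lamps IH) auto
    finally show ?case .
  qed
  show "carrier W \<subseteq> generate W Y"
  proof
    fix g assume g: "g \<in> carrier W"
    obtain p f where [simp]: "g = (p, f)" by (cases g)
    note pf = carrier_wreathD[OF g[simplified]]
    have f: "(\<one>\<^bsub>C\<^esub>, f) \<in> generate W Y"
      by (rule *[of "{x \<in> carrier C. f x \<noteq> \<one>\<^bsub>D\<^esub>}"]) (use pf in auto)
    then have "(\<one>\<^bsub>C\<^esub>, f) \<in> carrier W" using X W.generate_in_carrier by blast
    then have "g = move p \<otimes>\<^bsub>W\<^esub> (\<one>\<^bsub>C\<^esub>, f)" using pf by (simp add: move_mult)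
    with f pf show "g \<in> generate W Y" by (auto intro: generate.eng moves)
  qed
qed

end

locale marked_wreath = wreath_groups C D + C: marked_group C S + D: marked_group D T
  for C :: "('c, 'm) monoid_scheme" and D :: "('d, 'k) monoid_scheme" and S T
begin

definition marking :: "('c \<times> ('c \<Rightarrow> 'd)) set" where
  "marking = move ` S \<union> lamp ` T"

lemma marking_carrier: "marking \<subseteq> carrier W"
  using C.S_carrier D.S_carrier by (auto simp: marking_def)

lemma move_generated: "c \<in> carrier C \<Longrightarrow> move c \<in> generate W marking"
proof -
  assume "c \<in> carrier C"
  then have "c \<in> generate C S" using C.generating by (simp add: finite_generating_set_def)
  then show "move c \<in> generate W marking"
  proof (induction rule: generate.induct)
    case one
    show ?case by (simp add: move_one generate.one)
  next
    case (incl h)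
    then show ?case by (auto intro: generate.incl simp: marking_def)
  next
    case (inv h)
    then have "inv\<^bsub>W\<^esub> move h \<in> generate W marking" by (auto intro: generate.inv simp: marking_def)
    with inv show ?case using C.S_carrier by (auto simp: inv_move)
  next
    case (eng h1 h2)
    then have "h1 \<in> carrier C" "h2 \<in> carrier C"
      using C.generate_in_carrier[OF C.S_carrier] by auto
    with eng show ?case using generate.eng[of "move h1" W marking "move h2"] by (simp add: move_move)
  qed
qed

lemma lamp_generated: "a \<in> carrier D \<Longrightarrow> lamp a \<in> generate W marking"
proof -
  assume "a \<in> carrier D"
  then have "a \<in> generate D T" using D.generating by (simp add: finite_generating_set_def)
  then show "lamp a \<in> generate W marking"
  proof (induction rule: generate.induct)
    case one
    show ?case by (simp add: lamp_one generate.one)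
  next
    case (incl h)
    then show ?case by (auto intro: generate.incl simp: marking_def)
  next
    case (inv h)
    then have "inv\<^bsub>W\<^esub> lamp h \<in> generate W marking" by (auto intro: generate.inv simp: marking_def)
    with inv show ?case using D.S_carrier by (auto simp: inv_lamp)
  next
    case (eng h1 h2)
    then have "h1 \<in> carrier D" "h2 \<in> carrier D"
      using D.generate_in_carrier[OF D.S_carrier] by auto
    with eng show ?case using generate.eng[of "lamp h1" W marking "lamp h2"] by (simp add: lamp_lamp)
  qed
qed

sublocale W: marked_group "wreath C D" marking
proof
  show "finite_generating_set W marking"
    unfolding finite_generating_set_def
    using marking_carrier C.generating D.generating
      generate_wreathI[OF marking_carrier move_generated lamp_generated]
    by (auto simp: marking_def finite_generating_set_def)
qed

lemma letters_wreath: "W.letters = move ` C.letters \<union> lamp ` D.letters"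
proof -
  have "m_inv W ` move ` S = move ` m_inv C ` S"
    unfolding image_image using C.S_carrier by (intro image_cong) (auto simp: inv_move)
  moreover have "m_inv W ` lamp ` T = lamp ` m_inv D ` T"
    unfolding image_image using D.S_carrier by (intro image_cong) (auto simp: inv_lamp)
  ultimately show ?thesis by (auto simp: marking_def image_Un)
qed

text \<open>
  A letter of the standard marking changes at most one lamp, and that by one letter of \<open>D\<close>.
\<close>
lemma lamp_lengths_le_word_length:
  assumes "finite A" "A \<subseteq> carrier C" "g \<in> carrier W"
  shows "(\<Sum>x\<in>A. D.len (snd g x)) \<le> W.len g"
proof -
  have *: "(\<Sum>x\<in>A. D.len (snd (word_prod W xs) x)) \<le> length xs" if "set xs \<subseteq> W.letters" for xs
    using that
  proof (induction xs)
    case Nil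
    have "(\<Sum>x\<in>A. D.len (snd \<one>\<^bsub>W\<^esub> x)) = 0"
      using assms(2) by (auto simp: wreath_simps' D.word_length_one subset_iff)
    then show ?case by simp
  next
    case (Cons s xs)
    obtain p f where pf: "word_prod W xs = (p, f)" by (cases "word_prod W xs")
    have "word_prod W xs \<in> carrier W"
      using Cons.prems W.letters_carrier by (intro W.word_prod_closed) auto
    then have cpf: "(p, f) \<in> carrier W" by (simp add: pf)
    have IH: "(\<Sum>x\<in>A. D.len (f x)) \<le> length xs" using Cons by (simp add: pf)
    from Cons.prems have "s \<in> move ` C.letters \<union> lamp ` D.letters" by (simp add: letters_wreath)
    then consider c where "c \<in> carrier C" "s = move c" | t where "t \<in> D.letters" "s = lamp t"
      using C.letters_carrier by blast
    then show ?case
    proof cases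
      case 1
      with IH show ?thesis by (simp add: pf move_mult[OF _ cpf])
    next
      case 2
      then have t: "t \<in> carrier D" using D.letters_carrier by blast
      have "(\<Sum>x\<in>A. D.len ((f(p := t \<otimes>\<^bsub>D\<^esub> f p)) x)) \<le> (\<Sum>x\<in>A. D.len (f x) + of_bool (x = p))"
      proof (rule sum_mono)
        fix x assume "x \<in> A"
        then have "x \<in> carrier C" using assms by blast
        with carrier_wreathD[OF cpf] t D.word_length_mult[of t "f x"] D.word_length_letter[OF 2(1)]
        show "D.len ((f(p := t \<otimes>\<^bsub>D\<^esub> f p)) x) \<le> D.len (f x) + of_bool (x = p)"
          by fastforce
      qed
      also have "\<dots> \<le> length xs + 1"
        using IH assms(1) by (simp add: sum.distrib of_bool_def)
      finally show ?thesis using 2 by (simp add: pf lamp_mult[OF t cpf])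
    qed
  qed
  obtain xs where "length xs = W.len g" "set xs \<subseteq> W.letters" "g = word_prod W xs"
    using W.word_length_attained[OF assms(3)] .
  with * show ?thesis by metis
qed

lemma word_length_lamp:
  assumes "a \<in> carrier D"
  shows "W.len (lamp a) \<le> D.len a"
proof -
  obtain xs where xs: "length xs = D.len a" "set xs \<subseteq> D.letters" "a = word_prod D xs"
    using D.word_length_attained[OF assms] .
  have "word_prod W (map lamp xs) = lamp (word_prod D xs)"
    using xs(2)
  proof (induction xs)
    case (Cons x xs)
    then have "x \<in> carrier D" "word_prod D xs \<in> carrier D"
      using D.letters_carrier by (auto intro!: D.word_prod_closed)
    with Cons show ?case by (simp add: lamp_lamp)
  qed (simp add: lamp_one)
  moreover have "set (map lamp xs) \<subseteq> W.letters"
    unfolding letters_wreath set_map using image_mono[OF xs(2)] by (rule le_supI2)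
  ultimately show ?thesis using W.word_length_le[of "map lamp xs"] xs by simp
qed

end

section \<open>The switch-walk-switch walk\<close>

text \<open>
  The condition that the products of two steps generate the whole group excludes a parity.  For
  instance, with the steps \<open>\<plusminus>1\<close> on \<open>D = \<int>\<close> the sum of all lamps would stay even, and the steps
  \<open>switch a c b\<close> would not generate the wreath product.  The condition passes to the wreath product
  (lemma \<open>switches_aperiodic\<close>), so it survives the iteration.  The condition that \<open>1\<close> is not in \<open>S\<close> makes
  \<open>switch\<close> injective, hence the uniform measure on its values the law of a switch-walk-switch step.
\<close>
locale switch_walk = marked_wreath C D S T
  for C :: "('c, 'm) monoid_scheme" and D :: "('d, 'k) monoid_scheme" and S T +
  assumes S_inv: "\<And>x. x \<in> S \<Longrightarrow> inv\<^bsub>C\<^esub> x \<in> S"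
    and T_inv: "\<And>x. x \<in> T \<Longrightarrow> inv\<^bsub>D\<^esub> x \<in> T"
    and S_nontrivial: "\<one>\<^bsub>C\<^esub> \<notin> S" "S \<noteq> {}"
    and T_nonempty: "T \<noteq> {}"
    and S_aperiodic: "generate C (S <#>\<^bsub>C\<^esub> S) = carrier C"
    and T_aperiodic: "generate D (T <#>\<^bsub>D\<^esub> T) = carrier D"
begin

abbreviation "\<nu> \<equiv> pmf_of_set S"
abbreviation "\<eta> \<equiv> pmf_of_set T"

lemma finite_S: "finite S" and finite_T: "finite T"
  using C.generating D.generating by (auto simp: finite_generating_set_def)

lemma set_walk_pmfs [simp]: "set_pmf \<nu> = S" "set_pmf \<eta> = T"
  using finite_S finite_T S_nontrivial T_nonempty by auto

sublocale C: finite_walk C \<nu>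
  by unfold_locales (use finite_S C.S_carrier in simp_all)

definition switch :: "'d \<Rightarrow> 'c \<Rightarrow> 'd \<Rightarrow> 'c \<times> ('c \<Rightarrow> 'd)" where
  "switch a c b = lamp a \<otimes>\<^bsub>W\<^esub> (move c \<otimes>\<^bsub>W\<^esub> lamp b)"

definition switches :: "('c \<times> ('c \<Rightarrow> 'd)) set" where
  "switches = (\<lambda>(a, c, b). switch a c b) ` (T \<times> S \<times> T)"

abbreviation "\<mu> \<equiv> pmf_of_set switches"

lemma T_carrier [simp]: "a \<in> T \<Longrightarrow> a \<in> carrier D" and S_carrier' [simp]: "c \<in> S \<Longrightarrow> c \<in> carrier C"
  using C.S_carrier D.S_carrier by auto

lemma switch_closed [simp]:
  "a \<in> carrier D \<Longrightarrow> c \<in> carrier C \<Longrightarrow> b \<in> carrier D \<Longrightarrow> switch a c b \<in> carrier W"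
  by (simp add: switch_def)

lemma switches_carrier: "switches \<subseteq> carrier W"
  by (auto simp: switches_def)

lemma switchesI: "a \<in> T \<Longrightarrow> c \<in> S \<Longrightarrow> b \<in> T \<Longrightarrow> switch a c b \<in> switches"
  by (force simp: switches_def)

lemma finite_switches: "finite switches" and switches_nonempty: "switches \<noteq> {}"
  using finite_S finite_T S_nontrivial T_nonempty by (auto simp: switches_def)

lemma switch_mult:
  assumes "a \<in> carrier D" "c \<in> carrier C" "b \<in> carrier D" and pf: "(p, f) \<in> carrier W"
  shows "switch a c b \<otimes>\<^bsub>W\<^esub> (p, f) =
    (c \<otimes>\<^bsub>C\<^esub> p, (f(p := b \<otimes>\<^bsub>D\<^esub> f p))
       (c \<otimes>\<^bsub>C\<^esub> p := a \<otimes>\<^bsub>D\<^esub> (f(p := b \<otimes>\<^bsub>D\<^esub> f p)) (c \<otimes>\<^bsub>C\<^esub> p)))"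
proof -
  let ?f = "f(p := b \<otimes>\<^bsub>D\<^esub> f p)"
  have 1: "(p, ?f) \<in> carrier W"
    using lamp_mult[OF assms(3) pf] W.m_closed[OF lamp_closed[OF assms(3)] pf] by simp
  have 2: "(c \<otimes>\<^bsub>C\<^esub> p, ?f) \<in> carrier W"
    using move_mult[OF assms(2) 1] W.m_closed[OF move_closed[OF assms(2)] 1] by simp
  have "switch a c b \<otimes>\<^bsub>W\<^esub> (p, f) = lamp a \<otimes>\<^bsub>W\<^esub> (move c \<otimes>\<^bsub>W\<^esub> (lamp b \<otimes>\<^bsub>W\<^esub> (p, f)))"
    unfolding switch_def using assms by (simp add: W.m_assoc)
  also have "lamp b \<otimes>\<^bsub>W\<^esub> (p, f) = (p, ?f)" by (rule lamp_mult[OF assms(3) pf])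
  also have "move c \<otimes>\<^bsub>W\<^esub> (p, ?f) = (c \<otimes>\<^bsub>C\<^esub> p, ?f)" by (rule move_mult[OF assms(2) 1])
  also have "lamp a \<otimes>\<^bsub>W\<^esub> (c \<otimes>\<^bsub>C\<^esub> p, ?f) = (c \<otimes>\<^bsub>C\<^esub> p, ?f(c \<otimes>\<^bsub>C\<^esub> p := a \<otimes>\<^bsub>D\<^esub> ?f (c \<otimes>\<^bsub>C\<^esub> p)))"
    by (rule lamp_mult[OF assms(1) 2])
  finally show ?thesis .
qed

lemma switch_eq:
  assumes "a \<in> carrier D" "c \<in> carrier C" "b \<in> carrier D"
  shows "fst (switch a c b) = c" "c \<noteq> \<one>\<^bsub>C\<^esub> \<Longrightarrow> snd (switch a c b) \<one>\<^bsub>C\<^esub> = b"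
    "c \<noteq> \<one>\<^bsub>C\<^esub> \<Longrightarrow> snd (switch a c b) c = a"
proof -
  have one: "\<one>\<^bsub>W\<^esub> = (\<one>\<^bsub>C\<^esub>, \<lambda>x\<in>carrier C. \<one>\<^bsub>D\<^esub>)" by (simp add: wreath_simps')
  have "switch a c b = switch a c b \<otimes>\<^bsub>W\<^esub> (\<one>\<^bsub>C\<^esub>, \<lambda>x\<in>carrier C. \<one>\<^bsub>D\<^esub>)"
    unfolding one[symmetric] using assms by simp
  also have "\<dots> = (c \<otimes>\<^bsub>C\<^esub> \<one>\<^bsub>C\<^esub>, ((\<lambda>x\<in>carrier C. \<one>\<^bsub>D\<^esub>)(\<one>\<^bsub>C\<^esub> := b \<otimes>\<^bsub>D\<^esub> (\<lambda>x\<in>carrier C. \<one>\<^bsub>D\<^esub>) \<one>\<^bsub>C\<^esub>))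
       (c \<otimes>\<^bsub>C\<^esub> \<one>\<^bsub>C\<^esub> := a \<otimes>\<^bsub>D\<^esub> ((\<lambda>x\<in>carrier C. \<one>\<^bsub>D\<^esub>)(\<one>\<^bsub>C\<^esub> := b \<otimes>\<^bsub>D\<^esub> (\<lambda>x\<in>carrier C. \<one>\<^bsub>D\<^esub>) \<one>\<^bsub>C\<^esub>)) (c \<otimes>\<^bsub>C\<^esub> \<one>\<^bsub>C\<^esub>)))"
    by (rule switch_mult[OF assms]) (simp add: one[symmetric])
  finally have eq: "switch a c b = \<dots>" .
  show "fst (switch a c b) = c" "c \<noteq> \<one>\<^bsub>C\<^esub> \<Longrightarrow> snd (switch a c b) \<one>\<^bsub>C\<^esub> = b"
    "c \<noteq> \<one>\<^bsub>C\<^esub> \<Longrightarrow> snd (switch a c b) c = a"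
    using assms by (simp_all add: eq)
qed

lemma inj_switch: "inj_on (\<lambda>(a, c, b). switch a c b) (T \<times> S \<times> T)"
proof (rule inj_onI)
  fix u v
  assume uv: "u \<in> T \<times> S \<times> T" "v \<in> T \<times> S \<times> T"
    and "(\<lambda>(a, c, b). switch a c b) u = (\<lambda>(a, c, b). switch a c b) v"
  then obtain a c b a' c' b' where u: "u = (a, c, b)" and v: "v = (a', c', b')"
    and in_sets: "a \<in> T" "c \<in> S" "b \<in> T" "a' \<in> T" "c' \<in> S" "b' \<in> T"
    and eq: "switch a c b = switch a' c' b'"
    by auto
  then have "c = c'" by (metis switch_eq(1) T_carrier S_carrier')
  moreover have "c \<noteq> \<one>\<^bsub>C\<^esub>" using S_nontrivial in_sets by auto
  ultimately show "u = v"
    unfolding u v using eq in_sets by (metis switch_eq(2,3) T_carrier S_carrier')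
qed

lemma inv_switch:
  assumes "a \<in> carrier D" "c \<in> carrier C" "b \<in> carrier D"
  shows "inv\<^bsub>W\<^esub> switch a c b = switch (inv\<^bsub>D\<^esub> b) (inv\<^bsub>C\<^esub> c) (inv\<^bsub>D\<^esub> a)"
  unfolding switch_def using assms by (simp add: W.inv_mult_group inv_lamp inv_move W.m_assoc)

lemma inv_switches: "g \<in> switches \<Longrightarrow> inv\<^bsub>W\<^esub> g \<in> switches"
  by (auto simp: switches_def inv_switch intro!: image_eqI[where x = "(inv\<^bsub>D\<^esub> b, inv\<^bsub>C\<^esub> c, inv\<^bsub>D\<^esub> a)" for a b c] S_inv T_inv)

text \<open>
  A step followed by a step that undoes the move leaves a product of two lamp steps at the position \<open>1\<close>, so
  all lamps are obtained.  Two steps whose intermediate switches cancel give, up to lamps, a product of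
  two moves, so all moves are obtained.
\<close>
lemma switches_aperiodic: "generate W (switches <#>\<^bsub>W\<^esub> switches) = carrier W"
proof -
  let ?X = "switches <#>\<^bsub>W\<^esub> switches"
  have X: "?X \<subseteq> carrier W" using switches_carrier unfolding set_mult_def by blast
  have XI: "switch a c b \<otimes>\<^bsub>W\<^esub> switch a' c' b' \<in> generate W ?X"
    if "a \<in> T" "c \<in> S" "b \<in> T" "a' \<in> T" "c' \<in> S" "b' \<in> T" for a c b a' c' b'
    using that switchesI unfolding set_mult_def by (intro generate.incl) blast
  obtain c0 t0 where c0: "c0 \<in> S" and t0: "t0 \<in> T" using S_nontrivial T_nonempty by auto
  have lamp2: "lamp (a \<otimes>\<^bsub>D\<^esub> b) \<in> generate W ?X" if ab: "a \<in> T" "b \<in> T" for a b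
  proof -
    have "switch a c0 t0 \<otimes>\<^bsub>W\<^esub> switch (inv\<^bsub>D\<^esub> t0) (inv\<^bsub>C\<^esub> c0) b =
      lamp a \<otimes>\<^bsub>W\<^esub> (move c0 \<otimes>\<^bsub>W\<^esub> (lamp t0 \<otimes>\<^bsub>W\<^esub> inv\<^bsub>W\<^esub> lamp t0) \<otimes>\<^bsub>W\<^esub> inv\<^bsub>W\<^esub> move c0) \<otimes>\<^bsub>W\<^esub> lamp b"
      unfolding switch_def using ab c0 t0 by (simp add: inv_lamp inv_move W.m_assoc)
    also have "\<dots> = lamp (a \<otimes>\<^bsub>D\<^esub> b)" using ab c0 t0 by (simp add: lamp_lamp)
    finally show ?thesis using XI[of a c0 t0 "inv\<^bsub>D\<^esub> t0" "inv\<^bsub>C\<^esub> c0" b] ab c0 t0 S_inv T_inv by simp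
  qed
  have lamps: "lamp a \<in> generate W ?X" if "a \<in> carrier D" for a
  proof -
    have TT: "T <#>\<^bsub>D\<^esub> T \<subseteq> carrier D" by (auto simp: set_mult_def)
    from that have "a \<in> generate D (T <#>\<^bsub>D\<^esub> T)" by (simp add: T_aperiodic)
    then show ?thesis
    proof (induction a rule: generate.induct)
      case one
      show ?case by (simp add: lamp_one generate.one)
    next
      case (incl h)
      then show ?case using lamp2 by (auto simp: set_mult_def)
    next
      case (inv h)
      then have "lamp h \<in> generate W ?X" using lamp2 by (auto simp: set_mult_def)
      then have "inv\<^bsub>W\<^esub> lamp h \<in> generate W ?X" by (rule W.generate_m_inv_closed[OF X])
      with inv TT show ?case by (simp add: inv_lamp subset_iff)
    next
      case (eng h1 h2)
      then have "h1 \<in> carrier D" "h2 \<in> carrier D" using D.generate_in_carrier[OF TT] by auto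
      with eng show ?case using generate.eng[of "lamp h1" W ?X "lamp h2"] by (simp add: lamp_lamp)
    qed
  qed
  have move2: "move (c \<otimes>\<^bsub>C\<^esub> d) \<in> generate W ?X" if cd: "c \<in> S" "d \<in> S" for c d
  proof -
    have "lamp (inv\<^bsub>D\<^esub> t0) \<otimes>\<^bsub>W\<^esub> (switch t0 c t0 \<otimes>\<^bsub>W\<^esub> switch (inv\<^bsub>D\<^esub> t0) d t0) \<otimes>\<^bsub>W\<^esub> lamp (inv\<^bsub>D\<^esub> t0) =
      (inv\<^bsub>W\<^esub> lamp t0 \<otimes>\<^bsub>W\<^esub> lamp t0) \<otimes>\<^bsub>W\<^esub> (move c \<otimes>\<^bsub>W\<^esub> (lamp t0 \<otimes>\<^bsub>W\<^esub> inv\<^bsub>W\<^esub> lamp t0) \<otimes>\<^bsub>W\<^esub> move d) \<otimes>\<^bsub>W\<^esub> (lamp t0 \<otimes>\<^bsub>W\<^esub> inv\<^bsub>W\<^esub> lamp t0)"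
      unfolding switch_def using cd t0 by (simp add: inv_lamp inv_move W.m_assoc del: W.l_inv W.r_inv)
    also have "\<dots> = move (c \<otimes>\<^bsub>C\<^esub> d)" using cd t0 by (simp add: move_move)
    finally show ?thesis
      using XI[of t0 c t0 "inv\<^bsub>D\<^esub> t0" d t0] cd t0 T_inv lamps[of "inv\<^bsub>D\<^esub> t0"]
      by (metis D.inv_closed T_carrier generate.eng)
  qed
  have moves: "move c \<in> generate W ?X" if "c \<in> carrier C" for c
  proof -
    have SS: "S <#>\<^bsub>C\<^esub> S \<subseteq> carrier C" by (auto simp: set_mult_def)
    from that have "c \<in> generate C (S <#>\<^bsub>C\<^esub> S)" by (simp add: S_aperiodic)
    then show ?thesis
    proof (induction c rule: generate.induct)
      case one
      show ?case by (simp add: move_one generate.one)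
    next
      case (incl h)
      then show ?case using move2 by (auto simp: set_mult_def)
    next
      case (inv h)
      then have "move h \<in> generate W ?X" using move2 by (auto simp: set_mult_def)
      then have "inv\<^bsub>W\<^esub> move h \<in> generate W ?X" by (rule W.generate_m_inv_closed[OF X])
      with inv SS show ?case by (simp add: inv_move subset_iff)
    next
      case (eng h1 h2)
      then have "h1 \<in> carrier C" "h2 \<in> carrier C" using C.generate_in_carrier[OF SS] by auto
      with eng show ?case using generate.eng[of "move h1" W ?X "move h2"] by (simp add: move_move)
    qed
  qed
  show ?thesis by (rule generate_wreathI[OF X moves lamps])
qed

lemma set_switch_pmf [simp]: "set_pmf \<mu> = switches"
  using finite_switches switches_nonempty by simp

lemma simple_walk_switch: "simple_walk_measure W \<mu>"
proof -
  have "generate W switches = carrier W"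
  proof
    show "generate W switches \<subseteq> carrier W" by (rule W.generate_incl[OF switches_carrier])
    have "generate W (switches <#>\<^bsub>W\<^esub> switches) \<subseteq> generate W switches"
    proof (rule W.generate_subgroup_incl)
      show "switches <#>\<^bsub>W\<^esub> switches \<subseteq> generate W switches"
        unfolding set_mult_def by (blast intro: generate.incl generate.eng)
      show "subgroup (generate W switches) W" by (rule W.generate_is_subgroup[OF switches_carrier])
    qed
    then show "carrier W \<subseteq> generate W switches" by (simp add: switches_aperiodic)
  qed
  moreover have "pmf \<mu> (inv\<^bsub>W\<^esub> g) = pmf \<mu> g" if "g \<in> carrier W" for g
  proof -
    have "inv\<^bsub>W\<^esub> g \<in> switches \<longleftrightarrow> g \<in> switches"
      using inv_switches[of g] inv_switches[of "inv\<^bsub>W\<^esub> g"] that by auto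
    then show ?thesis using finite_switches switches_nonempty by (simp add: indicator_def)
  qed
  ultimately show ?thesis
    using finite_switches switches_carrier by (auto simp: simple_walk_measure_def walk_measure_def)
qed

end

section \<open>Touring the visited sites\<close>

context switch_walk
begin

text \<open>
  Each lamp is set when the path \<open>v\<close> arrives at its site for the first time.
\<close>
lemma word_length_le_along_path:
  assumes "set v \<subseteq> S" "(word_prod C v, f) \<in> carrier W"
    "\<And>x. x \<in> carrier C \<Longrightarrow> x \<notin> C.visited v \<Longrightarrow> f x = \<one>\<^bsub>D\<^esub>"
  shows "W.len (word_prod C v, f) \<le> length v + (\<Sum>x\<in>C.visited v. D.len (f x))"
  using assms
proof (induction v arbitrary: f)
  case Nil
  note f = carrier_wreathD[OF Nil(2)]
  have "(word_prod C [], f) = lamp (f \<one>\<^bsub>C\<^esub>)"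
    using Nil(3) f(3) by (auto simp: lamp_def fun_eq_iff extensional_def)
  then show ?case using word_length_lamp[of "f \<one>\<^bsub>C\<^esub>"] f(2) by simp
next
  case (Cons c v)
  let ?q = "word_prod C (c # v)"
  note f = carrier_wreathD[OF Cons.prems(2)]
  have c: "c \<in> S" and v: "set v \<subseteq> S" using Cons.prems by auto
  have pv: "word_prod C v \<in> carrier C" using v C.S_carrier by (intro C.word_prod_closed) auto
  have move_len: "W.len (move c) \<le> 1"
    by (rule W.word_length_letter) (use c in \<open>auto simp: letters_wreath\<close>)
  show ?case
  proof (cases "?q \<in> C.visited v")
    case True
    then have vis: "C.visited (c # v) = C.visited v" by auto
    have cf: "(word_prod C v, f) \<in> carrier W" using f pv by (intro carrier_wreathI)
    have "W.len (?q, f) \<le> W.len (move c) + W.len (word_prod C v, f)"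
      using W.word_length_mult[of "move c" "(word_prod C v, f)"] cf c move_mult[of c "word_prod C v" f] by simp
    also have "\<dots> \<le> 1 + (length v + (\<Sum>x\<in>C.visited v. D.len (f x)))"
      using move_len Cons.IH[OF v cf] Cons.prems(3) vis by (intro add_mono) auto
    finally show ?thesis by (simp add: vis del: C.visited.simps)
  next
    case False
    let ?f = "f(?q := \<one>\<^bsub>D\<^esub>)"
    have q: "?q \<in> carrier C" using f(1) .
    have "finite {x \<in> carrier C. ?f x \<noteq> \<one>\<^bsub>D\<^esub>}"
      by (rule finite_subset[OF _ f(4)]) auto
    then have cf: "(p, ?f) \<in> carrier W" if "p \<in> carrier C" for p
      using f q that by (intro carrier_wreathI) (auto simp: extensional_def)
    have IH: "W.len (word_prod C v, ?f) \<le> length v + (\<Sum>x\<in>C.visited v. D.len (?f x))"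
      by (rule Cons.IH[OF v cf[OF pv]]) (use Cons.prems(3) in auto)
    have eq: "(?q, f) = lamp (f ?q) \<otimes>\<^bsub>W\<^esub> (move c \<otimes>\<^bsub>W\<^esub> (word_prod C v, ?f))"
      using c f(2)[OF q] cf[OF q] cf[OF pv] by (simp add: move_mult lamp_mult)
    have "W.len (?q, f) \<le> W.len (lamp (f ?q)) + W.len (move c \<otimes>\<^bsub>W\<^esub> (word_prod C v, ?f))"
      unfolding eq using c f(2)[OF q] cf[OF pv] by (intro W.word_length_mult) auto
    also have "\<dots> \<le> D.len (f ?q) + (W.len (move c) + W.len (word_prod C v, ?f))"
      using c f(2)[OF q] cf[OF pv] by (intro add_mono word_length_lamp W.word_length_mult) auto
    also have "\<dots> \<le> D.len (f ?q) + (1 + (length v + (\<Sum>x\<in>C.visited v. D.len (?f x))))"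
      using IH move_len by simp
    also have "(\<Sum>x\<in>C.visited v. D.len (?f x)) = (\<Sum>x\<in>C.visited v. D.len (f x))"
      using False by (intro sum.cong) auto
    finally show ?thesis using False by (simp add: C.finite_visited)
  qed
qed

text \<open>
  A closed tour through all visited sites, followed by the initial part of the same tour up to the final
  position, takes at most twice the length of the tour.
\<close>
lemma word_length_le_visited:
  assumes "set cs \<subseteq> S" "(word_prod C cs, f) \<in> carrier W"
    "\<And>x. x \<in> carrier C \<Longrightarrow> x \<notin> C.visited cs \<Longrightarrow> f x = \<one>\<^bsub>D\<^esub>"
  shows "W.len (word_prod C cs, f) \<le> 4 * card (C.visited cs) + (\<Sum>x\<in>C.visited cs. D.len (f x))"
proof -
  obtain u where u: "set u \<subseteq> S" "word_prod C u = \<one>\<^bsub>C\<^esub>" "C.visited cs \<subseteq> C.visited u"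
    "length u + 2 \<le> 2 * card (C.visited cs)"
    using C.closed_tour[OF C.S_carrier S_inv assms(1)] by auto
  have "word_prod C cs \<in> C.visited u" using u(3) C.word_prod_in_visited by blast
  then obtain u1 u2 where u12: "u = u1 @ u2" "word_prod C u2 = word_prod C cs" by (rule C.visited_split)
  let ?v = "u2 @ u"
  have v: "set ?v \<subseteq> S" using u(1) u12(1) by auto
  have sub: "set u2 \<subseteq> carrier C" "set u \<subseteq> carrier C" "set ?v \<subseteq> carrier C"
    using v C.S_carrier u(1) by auto
  have wv: "word_prod C ?v = word_prod C cs"
    using C.word_prod_append[OF sub(1,2)] C.word_prod_closed[OF sub(1)] u(2) u12(2) by simp
  have vis: "C.visited cs \<subseteq> C.visited ?v" using u(3) C.visited_append_supset by blast
  have "W.len (word_prod C ?v, f) \<le> length ?v + (\<Sum>x\<in>C.visited ?v. D.len (f x))"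
    by (rule word_length_le_along_path[OF v]) (use assms(2,3) wv vis in auto)
  also have "(\<Sum>x\<in>C.visited ?v. D.len (f x)) = (\<Sum>x\<in>C.visited cs. D.len (f x))"
    using vis C.visited_carrier[OF sub(3)] assms(3)
    by (intro sum.mono_neutral_right) (auto simp: C.finite_visited D.word_length_one subset_iff)
  also have "length ?v \<le> 4 * card (C.visited cs)" using u(4) u12(1) by simp
  finally show ?thesis by (simp only: wv)
qed

section \<open>Conditioning on the base path\<close>

text \<open>
  The conditional law of the walk on the wreath product, given the increments of the base path.
\<close>
primrec lamps_pmf :: "'c list \<Rightarrow> ('c \<times> ('c \<Rightarrow> 'd)) pmf" where
  "lamps_pmf [] = return_pmf \<one>\<^bsub>W\<^esub>"
| "lamps_pmf (c # cs) =
     bind_pmf \<eta> (\<lambda>a. bind_pmf \<eta> (\<lambda>b. map_pmf (\<lambda>g. switch a c b \<otimes>\<^bsub>W\<^esub> g) (lamps_pmf cs)))"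

lemma switch_pmf_eq:
  "\<mu> = bind_pmf \<eta> (\<lambda>a. bind_pmf \<nu> (\<lambda>c. bind_pmf \<eta> (\<lambda>b. return_pmf (switch a c b))))"
proof -
  have ne: "T \<times> S \<times> T \<noteq> {}" "finite (T \<times> S \<times> T)"
    using T_nonempty S_nontrivial finite_T finite_S by auto
  have "\<mu> = map_pmf (\<lambda>(a, c, b). switch a c b) (pmf_of_set (T \<times> S \<times> T))"
    unfolding switches_def by (rule map_pmf_of_set_inj[OF inj_switch ne, symmetric])
  also have "pmf_of_set (T \<times> S \<times> T) = pair_pmf \<eta> (pair_pmf \<nu> \<eta>)"
    using T_nonempty S_nontrivial finite_T finite_S by (simp add: pmf_of_set_Times)
  finally show ?thesis
    by (simp add: pair_pmf_def map_pmf_def bind_assoc_pmf bind_return_pmf)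
qed

lemma conv_power_switch: "conv_power W \<mu> n = bind_pmf (C.steps n) lamps_pmf"
proof (induction n)
  case 0
  show ?case by (simp add: bind_return_pmf)
next
  case (Suc n)
  let ?K = "\<lambda>a c b cs. map_pmf (\<lambda>g. switch a c b \<otimes>\<^bsub>W\<^esub> g) (lamps_pmf cs)"
  have "conv_power W \<mu> (Suc n) = bind_pmf \<mu> (\<lambda>s. map_pmf ((\<otimes>\<^bsub>W\<^esub>) s) (conv_power W \<mu> n))"
    by (rule W.conv_power_Suc_bind) (simp add: switches_carrier)
  also have "\<dots> = bind_pmf \<eta> (\<lambda>a. bind_pmf \<nu> (\<lambda>c. bind_pmf \<eta> (\<lambda>b. bind_pmf (C.steps n) (\<lambda>cs. ?K a c b cs))))"
    unfolding Suc by (subst switch_pmf_eq) (simp add: bind_assoc_pmf bind_return_pmf map_bind_pmf)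
  also have "\<dots> = bind_pmf \<nu> (\<lambda>c. bind_pmf \<eta> (\<lambda>a. bind_pmf \<eta> (\<lambda>b. bind_pmf (C.steps n) (\<lambda>cs. ?K a c b cs))))"
    by (rule bind_commute_pmf)
  also have "\<dots> = bind_pmf \<nu> (\<lambda>c. bind_pmf \<eta> (\<lambda>a. bind_pmf (C.steps n) (\<lambda>cs. bind_pmf \<eta> (\<lambda>b. ?K a c b cs))))"
    by (subst bind_commute_pmf[of \<eta> "C.steps n"]) (rule refl)
  also have "\<dots> = bind_pmf \<nu> (\<lambda>c. bind_pmf (C.steps n) (\<lambda>cs. bind_pmf \<eta> (\<lambda>a. bind_pmf \<eta> (\<lambda>b. ?K a c b cs))))"
    by (subst bind_commute_pmf[of \<eta> "C.steps n"]) (rule refl)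
  also have "\<dots> = bind_pmf (C.steps (Suc n)) lamps_pmf"
    by (simp add: bind_assoc_pmf bind_return_pmf)
  finally show ?case .
qed

lemma finite_lamps_pmf: "finite (set_pmf (lamps_pmf cs))"
  using finite_T by (induction cs) auto

lemma lamps_pmf_support:
  assumes "set cs \<subseteq> S" "g \<in> set_pmf (lamps_pmf cs)"
  shows "g \<in> carrier W \<and> fst g = word_prod C cs \<and>
    (\<forall>x\<in>carrier C. x \<notin> C.visited cs \<longrightarrow> snd g x = \<one>\<^bsub>D\<^esub>)"
  using assms
proof (induction cs arbitrary: g)
  case Nil
  then show ?case by (simp add: wreath_simps')
next
  case (Cons c cs)
  then obtain a b h where abh: "a \<in> T" "b \<in> T" "h \<in> set_pmf (lamps_pmf cs)" "g = switch a c b \<otimes>\<^bsub>W\<^esub> h"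
    by auto
  obtain p f where h: "h = (p, f)" by (cases h)
  have IH: "(p, f) \<in> carrier W" "p = word_prod C cs"
    "\<forall>x\<in>carrier C. x \<notin> C.visited cs \<longrightarrow> f x = \<one>\<^bsub>D\<^esub>"
    using Cons.IH[OF _ abh(3)] Cons.prems(1) h by auto
  have c: "c \<in> carrier C" "a \<in> carrier D" "b \<in> carrier D" using abh Cons.prems by auto
  have "g \<in> carrier W" using abh IH(1) c h by simp
  moreover have "fst g = word_prod C (c # cs)"
    using switch_mult[OF c(2,1,3) IH(1)] abh(4) h IH(2) by simp
  moreover have "snd g x = \<one>\<^bsub>D\<^esub>" if "x \<in> carrier C" "x \<notin> C.visited (c # cs)" for x
  proof -
    have "x \<noteq> p" using that(2) C.word_prod_in_visited[of cs] by (auto simp: IH(2))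
    then show ?thesis
      using switch_mult[OF c(2,1,3) IH(1)] abh(4) h IH(2,3) that by simp
  qed
  ultimately show ?case by blast
qed

text \<open>
  A step of the base path multiplies the lamp at \<open>x\<close> by a fresh step of the \<open>D\<close>-walk if it starts at \<open>x\<close>,
  and by another one if it ends at \<open>x\<close>, which is how the local time grows.  Only the law of each single
  lamp is needed, because the drift is bounded through sums over lamps.
\<close>
lemma lamp_marginal:
  assumes "set cs \<subseteq> S" "x \<in> carrier C"
  shows "map_pmf (\<lambda>g. snd g x) (lamps_pmf cs) = conv_power D \<eta> (C.local_time cs x)"
  using assms(1)
proof (induction cs)
  case Nil
  then show ?case using assms(2) by (simp add: wreath_simps')
next
  case (Cons c cs)
  let ?p = "word_prod C cs" and ?q = "word_prod C (c # cs)" and ?k = "C.local_time cs x"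
  define at_p where "at_p b = (if x = ?p then (\<otimes>\<^bsub>D\<^esub>) b else id)" for b
  define at_q where "at_q a = (if x = ?q then (\<otimes>\<^bsub>D\<^esub>) a else id)" for a
  have c: "c \<in> carrier C" and cs: "set cs \<subseteq> S" using Cons.prems by auto
  have one_step: "map_pmf (\<lambda>g. snd (switch a c b \<otimes>\<^bsub>W\<^esub> g) x) (lamps_pmf cs) =
      map_pmf (at_q a) (map_pmf (at_p b) (conv_power D \<eta> ?k))" if "a \<in> T" "b \<in> T" for a b
  proof -
    have "map_pmf (\<lambda>g. snd (switch a c b \<otimes>\<^bsub>W\<^esub> g) x) (lamps_pmf cs) =
      map_pmf (\<lambda>g. at_q a (at_p b (snd g x))) (lamps_pmf cs)"
    proof (rule map_pmf_cong[OF refl])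
      fix g assume "g \<in> set_pmf (lamps_pmf cs)"
      moreover obtain p f where g: "g = (p, f)" by (cases g)
      ultimately have pf: "(p, f) \<in> carrier W" "p = ?p" using lamps_pmf_support[OF cs] by fastforce+
      show "snd (switch a c b \<otimes>\<^bsub>W\<^esub> g) x = at_q a (at_p b (snd g x))"
        using switch_mult[OF T_carrier[OF that(1)] c T_carrier[OF that(2)] pf(1)] pf(2)
        by (simp add: g at_p_def at_q_def)
    qed
    also have "\<dots> = map_pmf (at_q a) (map_pmf (at_p b) (conv_power D \<eta> ?k))"
      by (simp add: Cons.IH[OF cs, symmetric] pmf.map_comp o_def)
    finally show ?thesis .
  qed
  have "map_pmf (\<lambda>g. snd g x) (lamps_pmf (c # cs)) =
      bind_pmf \<eta> (\<lambda>a. bind_pmf \<eta> (\<lambda>b. map_pmf (\<lambda>g. snd (switch a c b \<otimes>\<^bsub>W\<^esub> g) x) (lamps_pmf cs)))"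
    by (simp add: map_bind_pmf pmf.map_comp o_def)
  also have "\<dots> = bind_pmf \<eta> (\<lambda>a. bind_pmf \<eta> (\<lambda>b. map_pmf (at_q a) (map_pmf (at_p b) (conv_power D \<eta> ?k))))"
    by (intro bind_pmf_cong refl one_step) auto
  also have "\<dots> = bind_pmf \<eta> (\<lambda>a. map_pmf (at_q a) (bind_pmf \<eta> (\<lambda>b. map_pmf (at_p b) (conv_power D \<eta> ?k))))"
    by (simp add: map_bind_pmf)
  also have "bind_pmf \<eta> (\<lambda>b. map_pmf (at_p b) (conv_power D \<eta> ?k)) = conv_power D \<eta> (?k + of_bool (?p = x))"
    using D.conv_power_Suc_bind[of \<eta> ?k] D.S_carrier
    by (cases "x = ?p") (auto simp: at_p_def pmf.map_id simp del: conv_power.simps)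
  also have "bind_pmf \<eta> (\<lambda>a. map_pmf (at_q a) (conv_power D \<eta> (?k + of_bool (?p = x)))) =
      conv_power D \<eta> (?k + of_bool (?p = x) + of_bool (?q = x))"
    using D.conv_power_Suc_bind[of \<eta> "?k + of_bool (?p = x)"] D.S_carrier
    by (cases "x = ?q") (auto simp: at_q_def pmf.map_id simp del: conv_power.simps)
  also have "\<dots> = conv_power D \<eta> (C.local_time (c # cs) x)" by (simp only: C.local_time.simps)
  finally show ?case .
qed

abbreviation "lamp_drift \<equiv> drift D T \<eta>"

lemma expectation_lamp_lengths:
  assumes "set cs \<subseteq> S"
  shows "measure_pmf.expectation (lamps_pmf cs) (\<lambda>g. \<Sum>x\<in>C.visited cs. real (D.len (snd g x))) =
    (\<Sum>x\<in>C.visited cs. lamp_drift (C.local_time cs x))"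
proof -
  have "C.visited cs \<subseteq> carrier C" using assms C.S_carrier by (intro C.visited_carrier) auto
  then show ?thesis
    unfolding expectation_sum_pmf[OF finite_lamps_pmf] drift_def
    by (intro sum.cong refl) (auto simp: lamp_marginal[OF assms, symmetric] subset_iff)
qed

lemma drift_switch_eq:
  "drift W marking \<mu> n = measure_pmf.expectation (C.steps n)
     (\<lambda>cs. measure_pmf.expectation (lamps_pmf cs) (\<lambda>g. real (W.len g)))"
  unfolding drift_def conv_power_switch
  by (rule expectation_bind_pmf[OF C.finite_steps finite_lamps_pmf])

lemma steps_S: "cs \<in> set_pmf (C.steps n) \<Longrightarrow> set cs \<subseteq> S"
  using set_replicate_pmfD(2)[of cs n \<nu>] by simp

lemma drift_switch_ge:
  "drift W marking \<mu> n \<ge> measure_pmf.expectation (C.steps n)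
     (\<lambda>cs. \<Sum>x\<in>C.visited cs. lamp_drift (C.local_time cs x))"
  unfolding drift_switch_eq
proof (rule expectation_mono_pmf[OF C.finite_steps])
  fix cs assume "cs \<in> set_pmf (C.steps n)"
  then have cs: "set cs \<subseteq> S" by (rule steps_S)
  then have vis: "C.visited cs \<subseteq> carrier C" using C.S_carrier by (intro C.visited_carrier) auto
  show "(\<Sum>x\<in>C.visited cs. lamp_drift (C.local_time cs x)) \<le> measure_pmf.expectation (lamps_pmf cs) (\<lambda>g. real (W.len g))"
    unfolding expectation_lamp_lengths[OF cs, symmetric]
  proof (rule expectation_mono_pmf[OF finite_lamps_pmf])
    fix g assume "g \<in> set_pmf (lamps_pmf cs)"
    then have "g \<in> carrier W" using lamps_pmf_support[OF cs] by blast
    then show "(\<Sum>x\<in>C.visited cs. real (D.len (snd g x))) \<le> real (W.len g)"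
      using lamp_lengths_le_word_length[OF C.finite_visited vis] by (metis of_nat_le_iff of_nat_sum)
  qed
qed

lemma drift_switch_le:
  "drift W marking \<mu> n \<le> measure_pmf.expectation (C.steps n)
     (\<lambda>cs. 4 * real (card (C.visited cs)) + (\<Sum>x\<in>C.visited cs. lamp_drift (C.local_time cs x)))"
  unfolding drift_switch_eq
proof (rule expectation_mono_pmf[OF C.finite_steps])
  fix cs assume "cs \<in> set_pmf (C.steps n)"
  then have cs: "set cs \<subseteq> S" by (rule steps_S)
  have "measure_pmf.expectation (lamps_pmf cs) (\<lambda>g. real (W.len g)) \<le> measure_pmf.expectation (lamps_pmf cs)
      (\<lambda>g. 4 * real (card (C.visited cs)) + (\<Sum>x\<in>C.visited cs. real (D.len (snd g x))))"
  proof (rule expectation_mono_pmf[OF finite_lamps_pmf])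
    fix g assume "g \<in> set_pmf (lamps_pmf cs)"
    moreover obtain p f where g: "g = (p, f)" by (cases g)
    ultimately have "(p, f) \<in> carrier W" "p = word_prod C cs" "\<forall>x\<in>carrier C. x \<notin> C.visited cs \<longrightarrow> f x = \<one>\<^bsub>D\<^esub>"
      using lamps_pmf_support[OF cs] by fastforce+
    then have "W.len g \<le> 4 * card (C.visited cs) + (\<Sum>x\<in>C.visited cs. D.len (f x))"
      using word_length_le_visited[OF cs] g by auto
    then have "real (W.len g) \<le> real (4 * card (C.visited cs) + (\<Sum>x\<in>C.visited cs. D.len (f x)))"
      by (rule of_nat_mono)
    then show "real (W.len g) \<le> 4 * real (card (C.visited cs)) + (\<Sum>x\<in>C.visited cs. real (D.len (snd g x)))"
      by (simp add: g)
  qed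
  also have "\<dots> = 4 * real (card (C.visited cs)) + (\<Sum>x\<in>C.visited cs. lamp_drift (C.local_time cs x))"
    by (simp add: expectation_add_pmf[OF finite_lamps_pmf] expectation_lamp_lengths[OF cs])
  finally show "measure_pmf.expectation (lamps_pmf cs) (\<lambda>g. real (W.len g)) \<le> \<dots>" .
qed

end

section \<open>Drift of a wreath product\<close>

text \<open>
  The admissible functions \<open>\<psi>\<close> in a drift of order \<open>n / \<psi>(n)\<close>.  The second monotonicity says that \<open>\<psi>\<close> grows at
  most linearly, so constants can be pulled out of its argument, and both monotonicities are stable
  under composition.
\<close>
definition gauge_function :: "(real \<Rightarrow> real) \<Rightarrow> bool" where
  "gauge_function \<psi> \<longleftrightarrow> (\<forall>x\<ge>1. 0 < \<psi> x) \<and>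
     (\<forall>x y. 1 \<le> x \<longrightarrow> x \<le> y \<longrightarrow> \<psi> x \<le> \<psi> y \<and> x / \<psi> x \<le> y / \<psi> y)"

lemma gauge_functionD:
  assumes "gauge_function \<psi>" "1 \<le> x"
  shows "0 < \<psi> x" "x \<le> y \<Longrightarrow> \<psi> x \<le> \<psi> y" "x \<le> y \<Longrightarrow> x / \<psi> x \<le> y / \<psi> y"
  using assms by (auto simp: gauge_function_def)

lemma gauge_function_scale:
  assumes "gauge_function \<psi>" "1 \<le> x" "1 \<le> K"
  shows "\<psi> (K * x) \<le> K * \<psi> x"
proof -
  have le: "x \<le> K * x" using assms mult_right_mono[of 1 K x] by simp
  have "x / \<psi> x \<le> K * x / \<psi> (K * x)" by (rule gauge_functionD(3)[OF assms(1,2) le])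
  moreover have "0 < \<psi> x" "0 < \<psi> (K * x)"
    using gauge_functionD(1)[OF assms(1)] assms(2) order_trans[OF assms(2) le] by auto
  ultimately have "x * \<psi> (K * x) \<le> x * (K * \<psi> x)" by (simp add: field_simps)
  then show ?thesis using assms(2) by simp
qed

lemma gauge_function_comp:
  assumes \<psi>: "gauge_function \<psi>" and g: "gauge_function g" "\<And>x. 1 \<le> x \<Longrightarrow> 1 \<le> g x"
  shows "gauge_function (\<lambda>x. \<psi> (g x))"
  unfolding gauge_function_def
proof (intro conjI allI impI)
  fix x y :: real assume xy: "1 \<le> x" "x \<le> y"
  note g_xy = gauge_functionD[OF g(1) xy(1)]
  have gx: "1 \<le> g x" "1 \<le> g y" using g(2) xy by auto
  show "\<psi> (g x) \<le> \<psi> (g y)" by (rule gauge_functionD(2)[OF \<psi> gx(1) g_xy(2)[OF xy(2)]])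
  have "x / \<psi> (g x) = x / g x * (g x / \<psi> (g x))" using gx by simp
  also have "\<dots> \<le> y / g y * (g y / \<psi> (g y))"
    using xy gx gauge_functionD(1)[OF \<psi>] g_xy gauge_functionD(3)[OF \<psi> gx(1) g_xy(2)[OF xy(2)]]
    by (intro mult_mono) (auto intro!: divide_nonneg_pos less_imp_le)
  also have "\<dots> = y / \<psi> (g y)" using gx by simp
  finally show "x / \<psi> (g x) \<le> y / \<psi> (g y)" .
next
  fix x :: real assume "1 \<le> x"
  then show "0 < \<psi> (g x)" using gauge_functionD(1)[OF \<psi>] g(2) by auto
qed

text \<open>
  All word metrics on a finitely generated group are bi-Lipschitz equivalent, so the order of the drift
  may be computed with whichever generating set is convenient.
\<close>
lemma drift_comparable:
  assumes "marked_group G S" "marked_group G T" "finite (set_pmf \<mu>)" "set_pmf \<mu> \<subseteq> carrier G"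
  obtains K :: real where "K \<ge> 1" "\<And>n. drift G T \<mu> n \<le> K * drift G S \<mu> n"
proof -
  interpret S: marked_group G S by fact
  obtain K where K: "K \<ge> 1" "\<And>g. g \<in> carrier G \<Longrightarrow> word_length G T g \<le> K * word_length G S g"
    using word_length_comparable[OF assms(1,2)] by blast
  show ?thesis
  proof (rule that[of "real K"])
    show "real K \<ge> 1" using K(1) by simp
    fix n
    have "drift G T \<mu> n \<le> measure_pmf.expectation (conv_power G \<mu> n) (\<lambda>g. real K * real (word_length G S g))"
      unfolding drift_def
    proof (rule expectation_mono_pmf[OF finite_conv_power[OF assms(3)]])
      fix g assume "g \<in> set_pmf (conv_power G \<mu> n)"
      then have "g \<in> carrier G" using S.conv_power_carrier[OF assms(4)] by blast
      from K(2)[OF this] show "real (word_length G T g) \<le> real K * real (word_length G S g)"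
        by (metis of_nat_le_iff of_nat_mult)
    qed
    then show "drift G T \<mu> n \<le> real K * drift G S \<mu> n" by (simp add: drift_def)
  qed
qed

definition aperiodic_symmetric :: "('g, 'm) monoid_scheme \<Rightarrow> 'g set \<Rightarrow> bool" where
  "aperiodic_symmetric G S \<longleftrightarrow> group G \<and> finite_generating_set G S \<and> S \<noteq> {} \<and>
     (\<forall>x\<in>S. inv\<^bsub>G\<^esub> x \<in> S) \<and> generate G (S <#>\<^bsub>G\<^esub> S) = carrier G"

text \<open>
  The bounds hold from \<open>k = 1\<close> on, not only for large \<open>k\<close>, because the lamps of a wreath product run this walk
  up to all local times, small ones included.
\<close>
definition drift_gauge :: "('g, 'm) monoid_scheme \<Rightarrow> 'g set \<Rightarrow> (real \<Rightarrow> real) \<Rightarrow> bool" where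
  "drift_gauge G S \<psi> \<longleftrightarrow> (\<exists>c1>0. \<exists>c2>0. \<forall>k\<ge>1.
     c1 * (real k / \<psi> (real k)) \<le> drift G S (pmf_of_set S) k \<and>
     drift G S (pmf_of_set S) k \<le> c2 * (real k / \<psi> (real k)))"

definition green_gauge :: "('g, 'm) monoid_scheme \<Rightarrow> 'g set \<Rightarrow> (real \<Rightarrow> real) \<Rightarrow> bool" where
  "green_gauge G S \<gamma> \<longleftrightarrow> (\<exists>c1>0. \<exists>c2>0. \<forall>n\<ge>1.
     c1 * \<gamma> (real n) \<le> finite_walk.green G (pmf_of_set S) n \<and>
     finite_walk.green G (pmf_of_set S) n \<le> c2 * \<gamma> (real n))"

context switch_walk
begin

lemma lamp_drift_nonneg: "0 \<le> lamp_drift k"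
  by (simp add: drift_def)

lemma lamp_drift_0: "lamp_drift 0 = 0"
  by (simp add: drift_def D.word_length_one)

context
  fixes \<psi> \<gamma> :: "real \<Rightarrow> real" and c1 c2 b1 b2 :: real
  assumes \<psi>: "gauge_function \<psi>"
    and \<gamma>: "\<And>x. 1 \<le> x \<Longrightarrow> 1 \<le> \<gamma> x"
    and pos: "0 < c1" "0 < c2" "0 < b1" "0 < b2"
    and lamp_lower: "\<And>k. 1 \<le> k \<Longrightarrow> c1 * (real k / \<psi> (real k)) \<le> lamp_drift k"
    and lamp_upper: "\<And>k. 1 \<le> k \<Longrightarrow> lamp_drift k \<le> c2 * (real k / \<psi> (real k))"
    and green_lower: "\<And>n. 1 \<le> n \<Longrightarrow> b1 * \<gamma> (real n) \<le> C.green n"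
    and green_upper: "\<And>n. 1 \<le> n \<Longrightarrow> C.green n \<le> b2 * \<gamma> (real n)"
begin

text \<open>
  A bound that is linear in \<open>k\<close> and, after summation over the sites, can be expressed through the range and
  the total local time: below \<open>M\<close> it uses that \<open>k / \<psi>(k)\<close> is nondecreasing, above \<open>M\<close> that \<open>\<psi>\<close> is.
\<close>
lemma lamp_drift_le_at_scale:
  assumes "1 \<le> M"
  shows "lamp_drift k \<le> c2 * ((M + real k) / \<psi> M)"
proof (cases "k = 0")
  case True
  then show ?thesis using assms pos gauge_functionD(1)[OF \<psi> assms] by (simp add: lamp_drift_0)
next
  case False
  have \<psi>M: "0 < \<psi> M" by (rule gauge_functionD(1)[OF \<psi> assms])
  have "real k / \<psi> (real k) \<le> (M + real k) / \<psi> M"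
  proof (cases "real k \<le> M")
    case True
    then have "real k / \<psi> (real k) \<le> M / \<psi> M" using False by (intro gauge_functionD(3)[OF \<psi>]) auto
    also have "\<dots> \<le> (M + real k) / \<psi> M" using \<psi>M by (simp add: divide_right_mono)
    finally show ?thesis .
  next
    case False
    then have "real k / \<psi> (real k) \<le> real k / \<psi> M"
      using \<psi>M assms by (intro divide_left_mono gauge_functionD[OF \<psi>] mult_pos_pos) auto
    also have "\<dots> \<le> (M + real k) / \<psi> M" using \<psi>M assms by (simp add: divide_right_mono)
    finally show ?thesis .
  qed
  then have "c2 * (real k / \<psi> (real k)) \<le> c2 * ((M + real k) / \<psi> M)"
    using pos by (intro mult_left_mono) auto
  moreover have "lamp_drift k \<le> c2 * (real k / \<psi> (real k))" using False by (intro lamp_upper) simp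
  ultimately show ?thesis by linarith
qed

text \<open>
  The quadratic term makes the left-hand side nonpositive above \<open>M\<close>; below \<open>M\<close>, replacing \<open>\<psi>(k)\<close> by \<open>\<psi>(M)\<close>
  lowers the value.
\<close>
lemma lamp_drift_ge_at_scale:
  assumes "1 \<le> M"
  shows "c1 / \<psi> M * (real k - (real k)\<^sup>2 / M) \<le> lamp_drift k"
proof (cases "k = 0")
  case True
  then show ?thesis by (simp add: lamp_drift_0)
next
  case False
  have \<psi>M: "0 < \<psi> M" by (rule gauge_functionD(1)[OF \<psi> assms])
  show ?thesis
  proof (cases "real k \<le> M")
    case True
    have "c1 / \<psi> M * (real k - (real k)\<^sup>2 / M) \<le> c1 / \<psi> M * real k"
      using pos \<psi>M assms by (intro mult_left_mono) auto
    also have "\<dots> = c1 * (real k / \<psi> M)" by simp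
    also have "\<dots> \<le> c1 * (real k / \<psi> (real k))"
      using pos True False \<psi>M by (intro mult_left_mono divide_left_mono gauge_functionD[OF \<psi>] mult_pos_pos) auto
    also have "\<dots> \<le> lamp_drift k" using lamp_lower[of k] False by simp
    finally show ?thesis .
  next
    case False
    then have "real k - (real k)\<^sup>2 / M \<le> 0"
      using assms by (simp add: field_simps power2_eq_square)
    then have "c1 / \<psi> M * (real k - (real k)\<^sup>2 / M) \<le> 0"
      using pos \<psi>M by (intro mult_nonneg_nonpos) auto
    then show ?thesis using lamp_drift_nonneg[of k] by linarith
  qed
qed

text \<open>
  At the scale \<open>M = \<gamma>(n)\<close> the range is of order \<open>n / M\<close>, so the term \<open>M\<close> per visited site contributes a multiple of
  \<open>n / \<psi>(M)\<close>, as does the total local time.  The tour of length of order \<open>n / M\<close> is dominated by this.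
\<close>
lemma drift_switch_upper:
  assumes n: "1 \<le> n"
  shows "drift W marking \<mu> n \<le> (12 * \<psi> 1 / b1 + c2 * (3 / b1 + 2)) * (real n / \<psi> (\<gamma> (real n)))"
proof -
  define M where "M = \<gamma> (real n)"
  have M: "1 \<le> M" using \<gamma> n by (simp add: M_def)
  have \<psi>M: "0 < \<psi> M" by (rule gauge_functionD(1)[OF \<psi> M])
  define R where "R = measure_pmf.expectation (C.steps n) (\<lambda>cs. real (card (C.visited cs)))"
  have R_nonneg: "0 \<le> R" by (simp add: R_def)
  have "R * (b1 * M) \<le> R * C.green n"
    using green_lower[OF n] R_nonneg by (intro mult_left_mono) (auto simp: M_def)
  also have "\<dots> \<le> 2 * real n + 1" unfolding R_def by (rule C.range_green_le)
  also have "\<dots> \<le> 3 * real n" using n by simp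
  finally have RM: "R * M \<le> 3 * real n / b1" using pos by (simp add: field_simps)
  have "drift W marking \<mu> n \<le> measure_pmf.expectation (C.steps n)
     (\<lambda>cs. 4 * real (card (C.visited cs)) + (\<Sum>x\<in>C.visited cs. lamp_drift (C.local_time cs x)))"
    by (rule drift_switch_le)
  also have "\<dots> \<le> measure_pmf.expectation (C.steps n)
     (\<lambda>cs. (4 + c2 * M / \<psi> M) * real (card (C.visited cs)) + c2 / \<psi> M * (2 * real n))"
  proof (rule expectation_mono_pmf[OF C.finite_steps])
    fix cs assume cs: "cs \<in> set_pmf (C.steps n)"
    have "(\<Sum>x\<in>C.visited cs. lamp_drift (C.local_time cs x)) \<le>
          (\<Sum>x\<in>C.visited cs. c2 * ((M + real (C.local_time cs x)) / \<psi> M))"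
      by (intro sum_mono lamp_drift_le_at_scale M)
    also have "\<dots> = c2 * M / \<psi> M * real (card (C.visited cs)) + c2 / \<psi> M * real (\<Sum>x\<in>C.visited cs. C.local_time cs x)"
      by (simp add: add_divide_distrib distrib_left sum.distrib sum_distrib_left sum_divide_distrib)
    also have "(\<Sum>x\<in>C.visited cs. C.local_time cs x) = 2 * n"
      using C.sum_local_time[of cs] set_replicate_pmfD(1)[OF cs] by simp
    finally show "4 * real (card (C.visited cs)) + (\<Sum>x\<in>C.visited cs. lamp_drift (C.local_time cs x)) \<le>
        (4 + c2 * M / \<psi> M) * real (card (C.visited cs)) + c2 / \<psi> M * (2 * real n)"
      by (simp add: distrib_right)
  qed
  also have "\<dots> = (4 + c2 * M / \<psi> M) * R + c2 / \<psi> M * (2 * real n)"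
    by (subst expectation_add_pmf[OF C.finite_steps]) (simp add: R_def)
  also have "\<dots> = 4 * (R * M) / M + c2 / \<psi> M * (R * M) + c2 / \<psi> M * (2 * real n)"
    using M by (simp add: distrib_right)
  also have "\<dots> \<le> 4 * (3 * real n / b1) * (\<psi> 1 / \<psi> M) + c2 / \<psi> M * (3 * real n / b1) + c2 / \<psi> M * (2 * real n)"
  proof (intro add_mono mult_left_mono RM)
    have "1 / \<psi> 1 \<le> M / \<psi> M" by (rule gauge_functionD(3)[OF \<psi> _ M]) simp
    then have "1 / M \<le> \<psi> 1 / \<psi> M" using M \<psi>M gauge_functionD(1)[OF \<psi>, of 1] by (simp add: field_simps)
    then have "4 * (R * M) * (1 / M) \<le> 4 * (3 * real n / b1) * (\<psi> 1 / \<psi> M)"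
      using RM R_nonneg M pos by (intro mult_mono) auto
    then show "4 * (R * M) / M \<le> 4 * (3 * real n / b1) * (\<psi> 1 / \<psi> M)" by simp
  qed (use pos \<psi>M in auto)
  also have "\<dots> = (12 * \<psi> 1 / b1 + c2 * (3 / b1 + 2)) * (real n / \<psi> M)"
    using pos \<psi>M by (simp add: field_simps)
  finally show ?thesis by (simp add: M_def)
qed

text \<open>
  The factor \<open>K\<close> in the scale \<open>M = K \<gamma>(n)\<close> is chosen such that the quadratic term takes away at most half of
  the total local time \<open>2n\<close>.
\<close>
lemma drift_switch_lower:
  assumes n: "1 \<le> n"
  shows "c1 / (16 * max 1 b2) * (real n / \<psi> (\<gamma> (real n))) \<le> drift W marking \<mu> n"
proof -
  define K where "K = 16 * max 1 b2"
  have K: "1 \<le> K" "16 * b2 \<le> K" by (auto simp: K_def)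
  define M where "M = K * \<gamma> (real n)"
  have \<gamma>n: "1 \<le> \<gamma> (real n)" using \<gamma> n by simp
  then have M: "1 \<le> M" using K(1) mult_mono[of 1 K 1 "\<gamma> (real n)"] by (simp add: M_def)
  have \<psi>M: "0 < \<psi> M" by (rule gauge_functionD(1)[OF \<psi> M])
  let ?V = "measure_pmf.expectation (C.steps n) (\<lambda>cs. \<Sum>x\<in>C.visited cs. (real (C.local_time cs x))\<^sup>2)"
  have "?V \<le> 8 * (real n + 1) * C.green n" by (rule C.expectation_local_time_sq_le)
  also have "\<dots> \<le> (16 * real n) * (b2 * \<gamma> (real n))"
  proof (rule mult_mono)
    have "real n + 1 \<le> 2 * real n" using n by simp
    from mult_left_mono[OF this, of 8] show "8 * (real n + 1) \<le> 16 * real n" by simp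
  qed (use green_upper[OF n] C.green_nonneg[of n] in auto)
  also have "\<dots> = real n * (16 * b2 * \<gamma> (real n))" by simp
  also have "\<dots> \<le> real n * M" unfolding M_def using K \<gamma>n by (intro mult_left_mono mult_right_mono) auto
  finally have V: "?V / M \<le> real n" using M by (simp add: field_simps)
  have "c1 / K * (real n / \<psi> (\<gamma> (real n))) = c1 * real n / (K * \<psi> (\<gamma> (real n)))" by simp
  also have "\<dots> \<le> c1 * real n / \<psi> M"
    using gauge_function_scale[OF \<psi> \<gamma>n K(1)] \<psi>M pos gauge_functionD(1)[OF \<psi> \<gamma>n] K(1)
    by (intro divide_left_mono mult_pos_pos) (auto simp: M_def)
  also have "\<dots> = c1 / \<psi> M * (2 * real n - real n)" by simp
  also have "\<dots> \<le> c1 / \<psi> M * (2 * real n - ?V / M)"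
    using V pos \<psi>M by (intro mult_left_mono) auto
  also have "\<dots> = measure_pmf.expectation (C.steps n)
      (\<lambda>cs. c1 / \<psi> M * (2 * real n) + (- (c1 / \<psi> M / M)) * (\<Sum>x\<in>C.visited cs. (real (C.local_time cs x))\<^sup>2))"
    by (subst expectation_add_pmf[OF C.finite_steps]) (simp add: algebra_simps)
  also have "\<dots> \<le> measure_pmf.expectation (C.steps n) (\<lambda>cs. \<Sum>x\<in>C.visited cs. lamp_drift (C.local_time cs x))"
  proof (rule expectation_mono_pmf[OF C.finite_steps])
    fix cs assume cs: "cs \<in> set_pmf (C.steps n)"
    have "2 * real n = real (\<Sum>x\<in>C.visited cs. C.local_time cs x)"
      using C.sum_local_time[of cs] set_replicate_pmfD(1)[OF cs] by simp
    then have "c1 / \<psi> M * (2 * real n) + (- (c1 / \<psi> M / M)) * (\<Sum>x\<in>C.visited cs. (real (C.local_time cs x))\<^sup>2) =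
       (\<Sum>x\<in>C.visited cs. c1 / \<psi> M * (real (C.local_time cs x) - (real (C.local_time cs x))\<^sup>2 / M))"
      by (simp add: right_diff_distrib sum_subtractf sum_distrib_left sum_divide_distrib sum_negf)
    also have "\<dots> \<le> (\<Sum>x\<in>C.visited cs. lamp_drift (C.local_time cs x))"
      by (intro sum_mono lamp_drift_ge_at_scale M)
    finally show "c1 / \<psi> M * (2 * real n) + (- (c1 / \<psi> M / M)) * (\<Sum>x\<in>C.visited cs. (real (C.local_time cs x))\<^sup>2) \<le> \<dots>" .
  qed
  also have "\<dots> \<le> drift W marking \<mu> n" by (rule drift_switch_ge)
  finally show ?thesis by (simp add: K_def)
qed

end

end

text \<open>
  The set \<open>U\<close> of steps also serves as the generating set that defines the drift, so the conclusion has the form of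
  the hypothesis on \<open>D\<close> and can be iterated.
\<close>
lemma drift_gauge_wreath:
  assumes C: "aperiodic_symmetric C S" "\<one>\<^bsub>C\<^esub> \<notin> S" and green: "green_gauge C S \<gamma>"
    and \<gamma>: "\<And>x. 1 \<le> x \<Longrightarrow> 1 \<le> \<gamma> x"
    and D: "aperiodic_symmetric D T" and drift: "drift_gauge D T \<psi>" and \<psi>: "gauge_function \<psi>"
  shows "\<exists>U. aperiodic_symmetric (wreath C D) U \<and> drift_gauge (wreath C D) U (\<lambda>x. \<psi> (\<gamma> x))"
proof -
  interpret C: group C using C by (simp add: aperiodic_symmetric_def)
  interpret D: group D using D by (simp add: aperiodic_symmetric_def)
  interpret switch_walk C D S T
    by unfold_locales (use C D in \<open>auto simp: aperiodic_symmetric_def\<close>)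
  have gen: "generate W switches = carrier W"
    using simple_walk_switch by (simp add: simple_walk_measure_def walk_measure_def)
  then have fgs: "finite_generating_set W switches"
    using finite_switches switches_carrier by (simp add: finite_generating_set_def)
  then have marked: "marked_group W switches" by unfold_locales
  have "aperiodic_symmetric W switches"
    using fgs switches_nonempty inv_switches switches_aperiodic W.group_axioms
    by (auto simp: aperiodic_symmetric_def)
  moreover have "drift_gauge W switches (\<lambda>x. \<psi> (\<gamma> x))"
  proof -
    obtain c1 c2 where c: "0 < c1" "0 < c2" "\<And>k. 1 \<le> k \<Longrightarrow> c1 * (real k / \<psi> (real k)) \<le> lamp_drift k"
      "\<And>k. 1 \<le> k \<Longrightarrow> lamp_drift k \<le> c2 * (real k / \<psi> (real k))"
      using drift unfolding drift_gauge_def by blast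
    obtain b1 b2 where b: "0 < b1" "0 < b2" "\<And>n. 1 \<le> n \<Longrightarrow> b1 * \<gamma> (real n) \<le> C.green n"
      "\<And>n. 1 \<le> n \<Longrightarrow> C.green n \<le> b2 * \<gamma> (real n)"
      using green unfolding green_gauge_def by blast
    define a1 where "a1 = c1 / (16 * max 1 b2)"
    define a2 where "a2 = 12 * \<psi> 1 / b1 + c2 * (3 / b1 + 2)"
    have a: "0 < a1" "0 < a2"
      using c(1,2) b(1,2) gauge_functionD(1)[OF \<psi>, of 1] by (auto simp: a1_def a2_def intro!: add_pos_pos mult_pos_pos)
    have upper: "drift W marking \<mu> n \<le> a2 * (real n / \<psi> (\<gamma> (real n)))" if "1 \<le> n" for n
      unfolding a2_def by (rule drift_switch_upper[of \<psi> \<gamma> c1 c2 b1 b2]; fact \<psi> \<gamma> c b that)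
    have lower: "a1 * (real n / \<psi> (\<gamma> (real n))) \<le> drift W marking \<mu> n" if "1 \<le> n" for n
      unfolding a1_def by (rule drift_switch_lower[of \<psi> \<gamma> c1 c2 b1 b2]; fact \<psi> \<gamma> c b that)
    have fin: "finite (set_pmf \<mu>)" "set_pmf \<mu> \<subseteq> carrier W"
      using finite_switches switches_carrier by auto
    obtain K1 :: real where K1: "K1 \<ge> 1" "\<And>n. drift W switches \<mu> n \<le> K1 * drift W marking \<mu> n"
      using drift_comparable[OF W.marked_group_axioms marked fin] by blast
    obtain K2 :: real where K2: "K2 \<ge> 1" "\<And>n. drift W marking \<mu> n \<le> K2 * drift W switches \<mu> n"
      using drift_comparable[OF marked W.marked_group_axioms fin] by blast
    show ?thesis
      unfolding drift_gauge_def
    proof (intro exI conjI allI impI)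
      show "0 < a1 / K2" "0 < K1 * a2" using a K1 K2 by auto
      fix n :: nat assume n: "1 \<le> n"
      have "a1 * (real n / \<psi> (\<gamma> (real n))) \<le> K2 * drift W switches \<mu> n"
        using lower[OF n] K2(2)[of n] by linarith
      then have "(a1 * (real n / \<psi> (\<gamma> (real n)))) / K2 \<le> drift W switches \<mu> n"
        using K2(1) by (subst pos_divide_le_eq) (auto simp: mult.commute)
      then show "a1 / K2 * (real n / \<psi> (\<gamma> (real n))) \<le> drift W switches \<mu> n" by (simp add: mult.commute)
      have "drift W switches \<mu> n \<le> K1 * drift W marking \<mu> n" by (rule K1(2))
      also have "\<dots> \<le> K1 * (a2 * (real n / \<psi> (\<gamma> (real n))))"
        using upper[OF n] K1(1) by (intro mult_left_mono) auto
      finally show "drift W switches \<mu> n \<le> K1 * a2 * (real n / \<psi> (\<gamma> (real n)))" by simp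
    qed
  qed
  ultimately show ?thesis by blast
qed

section \<open>A walk on the integers and its square\<close>

text \<open>
  These steps are not all odd, so no parity arises, and they do not include \<open>0\<close>.  Moreover, a uniform step
  is the sum of independent uniform elements of \<open>{-2, 1}\<close> and \<open>{0, 1}\<close>.
\<close>
definition Z_steps :: "int set" where
  "Z_steps = {-2, -1, 1, 2}"

abbreviation "Z_walk \<equiv> conv_power integer_group (pmf_of_set Z_steps)"

lemma finite_Z_steps [simp]: "finite Z_steps" and Z_steps_nonempty [simp]: "Z_steps \<noteq> {}"
  and card_Z_steps [simp]: "card Z_steps = 4"
  by (auto simp: Z_steps_def)

lemma sum_Z_steps: "(\<Sum>s\<in>Z_steps. f s) = f (-2) + f (-1) + f 1 + f 2"
  for f :: "int \<Rightarrow> real"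
  by (simp add: Z_steps_def)

lemma finite_Z_walk [simp]: "finite (set_pmf (Z_walk n))"
  by (rule finite_conv_power) simp

text \<open>
  From here on, walks are unfolded at the left end, by conditioning on the step added there.
\<close>
declare conv_power.simps(2) [simp del]

lemma group_integer: "group integer_group" by simp

lemma conv_power_integer_Suc:
  "conv_power integer_group p (Suc n) = bind_pmf p (\<lambda>s. map_pmf ((+) s) (conv_power integer_group p n))"
proof -
  have "(\<otimes>\<^bsub>integer_group\<^esub>) = (+)" by (intro ext) simp
  then show ?thesis using group.conv_power_Suc_bind[OF group_integer, of p n] by simp
qed

lemma pmf_map_add: "pmf (map_pmf ((+) s) q) x = pmf q (x - s)" for s :: int
proof -
  have "pmf (map_pmf ((+) s) q) (s + (x - s)) = pmf q (x - s)"
    by (rule pmf_map_inj') (simp add: inj_def)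
  then show ?thesis by simp
qed

lemma pmf_integer_Suc:
  assumes "finite A" "A \<noteq> {}"
  shows "pmf (conv_power integer_group (pmf_of_set A) (Suc n)) x =
    (\<Sum>s\<in>A. pmf (conv_power integer_group (pmf_of_set A) n) (x - s)) / real (card A)"
  unfolding conv_power_integer_Suc pmf_bind pmf_map_add
  using assms by (subst integral_pmf_of_set) auto

lemma expectation_Z_walk_Suc:
  "measure_pmf.expectation (Z_walk (Suc n)) f = measure_pmf.expectation (Z_walk n)
     (\<lambda>x. (f (x - 2) + f (x - 1) + f (x + 1) + f (x + 2)) / 4)" for f :: "int \<Rightarrow> real"
proof -
  have "measure_pmf.expectation (Z_walk (Suc n)) f =
      measure_pmf.expectation (pmf_of_set Z_steps) (\<lambda>s. measure_pmf.expectation (Z_walk n) (\<lambda>x. f (s + x)))"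
    unfolding conv_power_integer_Suc by (subst expectation_bind_pmf) auto
  also have "\<dots> = (\<Sum>s\<in>Z_steps. measure_pmf.expectation (Z_walk n) (\<lambda>x. f (s + x))) / 4"
    by (subst integral_pmf_of_set) auto
  also have "\<dots> = measure_pmf.expectation (Z_walk n) (\<lambda>x. \<Sum>s\<in>Z_steps. f (s + x)) / 4"
    by (simp add: expectation_sum_pmf)
  also have "\<dots> = measure_pmf.expectation (Z_walk n) (\<lambda>x. (\<Sum>s\<in>Z_steps. f (s + x)) / 4)"
    by simp
  finally show ?thesis by (simp add: sum_Z_steps add.commute)
qed

lemma Z_walk_second_moment: "measure_pmf.expectation (Z_walk n) (\<lambda>x. (real_of_int x)\<^sup>2) = 5 / 2 * real n"
proof (induction n)
  case (Suc n)
  have "measure_pmf.expectation (Z_walk (Suc n)) (\<lambda>x. (real_of_int x)\<^sup>2) =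
    measure_pmf.expectation (Z_walk n) (\<lambda>x. (real_of_int x)\<^sup>2 + 5 / 2)"
    unfolding expectation_Z_walk_Suc
    by (intro expectation_cong_pmf) (simp add: power2_eq_square field_simps)
  also have "\<dots> = 5 / 2 * real n + 5 / 2"
    by (subst expectation_add_pmf) (simp_all add: Suc)
  finally show ?case by simp
qed simp

text \<open>
  The fourth moment grows by \<open>(75/2) n + 17/2\<close> in one step, which is less than \<open>28 (2 n + 1)\<close>.
\<close>
lemma Z_walk_fourth_moment: "measure_pmf.expectation (Z_walk n) (\<lambda>x. (real_of_int x) ^ 4) \<le> 28 * (real n)\<^sup>2"
proof (induction n)
  case (Suc n)
  have "measure_pmf.expectation (Z_walk (Suc n)) (\<lambda>x. (real_of_int x) ^ 4) =
    measure_pmf.expectation (Z_walk n) (\<lambda>x. (real_of_int x) ^ 4 + (15 * (real_of_int x)\<^sup>2 + 17 / 2))"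
    unfolding expectation_Z_walk_Suc
    by (intro expectation_cong_pmf) (simp add: power2_eq_square power4_eq_xxxx field_simps)
  also have "\<dots> = measure_pmf.expectation (Z_walk n) (\<lambda>x. (real_of_int x) ^ 4) + (75 / 2 * real n + 17 / 2)"
    by (simp add: expectation_add_pmf Z_walk_second_moment del: Bochner_Integration.integral_add)
  also have "\<dots> \<le> 28 * (real (Suc n))\<^sup>2" using Suc by (simp add: power2_eq_square field_simps)
  finally show ?case .
qed simp

lemma pmf_Z_walk_uminus: "pmf (Z_walk n) (- x) = pmf (Z_walk n) x"
proof (induction n arbitrary: x)
  case (Suc n)
  have "pmf (Z_walk n) (- x - s) = pmf (Z_walk n) (x - (- s))" for s
    using Suc[of "x + s"] by simp
  then show ?case by (simp add: pmf_integer_Suc sum_Z_steps)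
qed (simp add: indicator_def)

lemma Z_walk_add: "conv_power integer_group p (m + n) =
   map_pmf (\<lambda>(x, y). x + y) (pair_pmf (conv_power integer_group p m) (conv_power integer_group p n))"
proof (induction m)
  case 0
  show ?case by (simp add: pair_return_pmf1 pmf.map_comp o_def)
next
  case (Suc m)
  show ?case
    unfolding add_Suc conv_power_integer_Suc Suc
    by (simp add: pair_pmf_def map_pmf_def bind_assoc_pmf bind_return_pmf add.assoc)
qed

lemma pmf_map_add_pair:
  "pmf (map_pmf (\<lambda>(x, y). x + y) (pair_pmf p q)) z = measure_pmf.expectation p (\<lambda>a. pmf q (z - a))" for z :: int
proof -
  have "map_pmf (\<lambda>(x, y). x + y) (pair_pmf p q) = bind_pmf p (\<lambda>a. map_pmf ((+) a) q)"
    by (simp add: pair_pmf_def map_pmf_def bind_assoc_pmf bind_return_pmf)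
  then show ?thesis by (simp add: pmf_bind pmf_map_add)
qed

text \<open>
  The walk at time \<open>n\<close> has variance of order \<open>n\<close>, so half of its mass \<open>p\<close> lies on an interval of length of
  order \<open>\<surd>n\<close>, and Cauchy-Schwarz bounds \<open>\<Sum>\<^sub>x p(x)\<^sup>2\<close>, the return probability at time \<open>2n\<close>, from below.
  The weight \<open>w\<close> combines both steps: it is supported on the interval and lies above the parabola whose
  expectation is given by the variance.
\<close>
lemma Z_return_lower:
  assumes n: "1 \<le> n"
  shows "1 / (32 * sqrt (real n)) \<le> pmf (Z_walk (2 * n)) 0"
proof -
  \<comment> \<open>Twice the variance is \<open>5 n\<close>, so the parabola below has expectation at least \<open>1/2\<close>.\<close>
  define s where "s = nat \<lceil>sqrt (5 * real n)\<rceil>"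
  have s: "sqrt (5 * real n) \<le> real s" "real s \<le> sqrt (5 * real n) + 1"
    by (auto simp: s_def of_nat_nat intro: less_imp_le)
  have sqrt_n: "1 \<le> sqrt (real n)" using n by simp
  have "sqrt 5 \<le> (5 / 2 :: real)" by (rule real_le_lsqrt) (auto simp: power2_eq_square)
  then have "sqrt (5 * real n) \<le> 5 / 2 * sqrt (real n)"
    unfolding real_sqrt_mult by (rule mult_right_mono) simp
  then have s_le: "2 * real s + 1 \<le> 8 * sqrt (real n)" using s sqrt_n by linarith
  have s_sq: "5 * real n \<le> (real s)\<^sup>2"
    using power_mono[OF s(1), of 2] by simp
  have s_pos: "0 < real s" using s(1) n by (smt (verit) real_sqrt_gt_0_iff of_nat_0_less_iff of_nat_le_0_iff less_le_trans zero_less_one)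
  define p where "p = pmf (Z_walk n)"
  define w where "w x = max 0 (1 - (real_of_int x)\<^sup>2 / (real s)\<^sup>2)" for x :: int
  define A where "A = set_pmf (Z_walk n) \<union> {- int s..int s}"
  have A: "finite A" by (simp add: A_def)
  have w: "0 \<le> w x" "w x \<le> 1" for x by (auto simp: w_def)
  have w_0: "w x = 0" if "x \<notin> {- int s..int s}" for x
  proof -
    from that have "real s \<le> \<bar>real_of_int x\<bar>" by auto
    then have "(real s)\<^sup>2 \<le> (real_of_int x)\<^sup>2" by (metis abs_le_square_iff abs_of_nat)
    then show ?thesis using s_pos by (simp add: w_def)
  qed
  \<comment> \<open>This value maximizes \<open>lam - lam\<^sup>2 (2 s + 1)\<close>, where \<open>2 s + 1\<close> bounds the number of sites.\<close>
  define lam where "lam = 1 / (2 * (2 * real s + 1))"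
  have lam: "0 < lam" using s_pos by (simp add: lam_def)
  have "pmf (Z_walk (2 * n)) 0 = measure_pmf.expectation (Z_walk n) p"
    unfolding mult_2 Z_walk_add pmf_map_add_pair by (simp add: pmf_Z_walk_uminus p_def)
  also have "\<dots> = (\<Sum>x\<in>A. p x * p x)"
    unfolding p_def by (rule integral_measure_pmf_real[OF A]) (simp add: A_def)
  also have "\<dots> \<ge> (\<Sum>x\<in>A. 2 * lam * (p x * w x) - lam\<^sup>2 * (w x)\<^sup>2)"
  proof (rule sum_mono)
    fix x show "2 * lam * (p x * w x) - lam\<^sup>2 * (w x)\<^sup>2 \<le> p x * p x"
      using zero_le_power2[of "p x - lam * w x"] by (simp add: power2_eq_square algebra_simps)
  qed
  also have "(\<Sum>x\<in>A. 2 * lam * (p x * w x) - lam\<^sup>2 * (w x)\<^sup>2) =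
      2 * lam * (\<Sum>x\<in>A. p x * w x) - lam\<^sup>2 * (\<Sum>x\<in>A. (w x)\<^sup>2)"
    by (simp add: sum_subtractf sum_distrib_left)
  finally have main: "2 * lam * (\<Sum>x\<in>A. p x * w x) - lam\<^sup>2 * (\<Sum>x\<in>A. (w x)\<^sup>2) \<le> pmf (Z_walk (2 * n)) 0" .
  have "1 / 2 \<le> 1 - 5 / 2 * real n / (real s)\<^sup>2"
    using s_sq s_pos by (simp add: field_simps)
  also have "\<dots> = measure_pmf.expectation (Z_walk n) (\<lambda>x. 1 + (- 1 / (real s)\<^sup>2) * (real_of_int x)\<^sup>2)"
    by (subst expectation_add_pmf) (simp_all add: Z_walk_second_moment)
  also have "\<dots> = (\<Sum>x\<in>A. (1 + (- 1 / (real s)\<^sup>2) * (real_of_int x)\<^sup>2) * p x)"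
    unfolding p_def by (rule integral_measure_pmf_real[OF A]) (simp add: A_def)
  also have "\<dots> \<le> (\<Sum>x\<in>A. p x * w x)"
    by (rule sum_mono) (auto simp: p_def w_def mult.commute intro!: mult_left_mono)
  finally have p_w: "1 / 2 \<le> (\<Sum>x\<in>A. p x * w x)" .
  have "(\<Sum>x\<in>A. (w x)\<^sup>2) = (\<Sum>x\<in>{- int s..int s}. (w x)\<^sup>2)"
    using w_0 by (intro sum.mono_neutral_right A) (auto simp: A_def)
  also have "\<dots> \<le> (\<Sum>x\<in>{- int s..int s}. 1)"
    by (intro sum_mono) (use w in \<open>simp add: power_le_one\<close>)
  also have "\<dots> = 2 * real s + 1" by simp
  finally have w_sq: "(\<Sum>x\<in>A. (w x)\<^sup>2) \<le> 2 * real s + 1" .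
  have "1 / (32 * sqrt (real n)) \<le> 1 / (4 * (2 * real s + 1))"
    using s_le s_pos sqrt_n by (intro divide_left_mono mult_pos_pos) auto
  also have "\<dots> = lam - lam\<^sup>2 * (2 * real s + 1)"
  proof -
    have "1 / (4 * N) = 1 / (2 * N) - (1 / (2 * N))\<^sup>2 * N" if "0 < N" for N :: real
      using that by (simp add: field_simps power2_eq_square)
    from this[of "2 * real s + 1"] show ?thesis by (simp add: lam_def)
  qed
  also have "\<dots> \<le> 2 * lam * (\<Sum>x\<in>A. p x * w x) - lam\<^sup>2 * (\<Sum>x\<in>A. (w x)\<^sup>2)"
  proof (rule diff_mono)
    show "lam \<le> 2 * lam * (\<Sum>x\<in>A. p x * w x)"
      using mult_left_mono[OF p_w, of "2 * lam"] lam by simp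
    show "lam\<^sup>2 * (\<Sum>x\<in>A. (w x)\<^sup>2) \<le> lam\<^sup>2 * (2 * real s + 1)"
      by (rule mult_left_mono[OF w_sq]) simp
  qed
  finally show ?thesis using main by linarith
qed

text \<open>
  By induction on the square, since \<open>(2 m + 1) (2 m + 3) \<le> (2 m + 2)\<^sup>2\<close>.
\<close>
lemma central_binomial_le: "real (2 * m choose m) / 4 ^ m \<le> 1 / sqrt (2 * real m + 1)"
proof -
  have "(real (2 * m choose m) / 4 ^ m)\<^sup>2 * (2 * real m + 1) \<le> 1"
  proof (induction m)
    case (Suc m)
    let ?b = "real (2 * m choose m) / 4 ^ m"
    have "real (Suc m) * real (2 * Suc m choose Suc m) = 2 * (2 * real m + 1) * real (2 * m choose m)"
    proof -
      have sym: "(2 * m + 1) choose Suc m = (2 * m + 1) choose m"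
        by (subst binomial_symmetric) auto
      have "Suc m * (2 * Suc m choose Suc m) = 2 * (Suc m * ((2 * m + 1) choose m))"
        using Suc_times_binomial_eq[of "2 * m + 1" m] by (simp add: algebra_simps del: binomial_Suc_Suc)
      also have "Suc m * ((2 * m + 1) choose m) = (2 * m + 1) * (2 * m choose m)"
        using Suc_times_binomial_eq[of "2 * m" m] sym by (simp add: algebra_simps del: binomial_Suc_Suc)
      finally have "real (Suc m * (2 * Suc m choose Suc m)) = real (2 * ((2 * m + 1) * (2 * m choose m)))"
        by (rule arg_cong)
      then show ?thesis by (simp only: of_nat_mult of_nat_add of_nat_numeral of_nat_1 mult.assoc)
    qed
    moreover have "a / (4 * p) = b / p * ((2 * x + 1) / (2 * x + 2))"
      if "(x + 1) * a = 2 * (2 * x + 1) * b" "0 < p" "0 \<le> x" for a b p x :: real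
    proof -
      have "a * (p * (2 * x + 2)) = 2 * p * ((x + 1) * a)" by (simp add: algebra_simps)
      also have "\<dots> = (b * (2 * x + 1)) * (4 * p)" unfolding that(1) by (simp add: algebra_simps)
      finally have "a / (4 * p) = (b * (2 * x + 1)) / (p * (2 * x + 2))"
        using that(2,3) by (subst frac_eq_eq) auto
      then show ?thesis by simp
    qed
    ultimately have eq: "real (2 * Suc m choose Suc m) / 4 ^ Suc m = ?b * ((2 * real m + 1) / (2 * real m + 2))"
      by (simp add: add.commute[of 1] del: binomial_Suc_Suc)
    have "(real (2 * Suc m choose Suc m) / 4 ^ Suc m)\<^sup>2 * (2 * real (Suc m) + 1) =
      (?b\<^sup>2 * (2 * real m + 1)) * ((2 * real m + 1) * (2 * real m + 3) / (2 * real m + 2)\<^sup>2)"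
      unfolding eq by (simp add: power2_eq_square ac_simps)
    also have "\<dots> \<le> 1 * 1"
    proof (rule mult_mono[OF Suc])
      have "(2 * real m + 1) * (2 * real m + 3) \<le> (2 * real m + 2)\<^sup>2"
        by (simp add: power2_eq_square algebra_simps)
      moreover have "0 < (2 * real m + 2)\<^sup>2" by (rule zero_less_power) simp
      ultimately show "(2 * real m + 1) * (2 * real m + 3) / (2 * real m + 2)\<^sup>2 \<le> 1"
        by (subst divide_le_eq_1_pos)
    qed auto
    finally show ?case by simp
  qed simp
  then have "(real (2 * m choose m) / 4 ^ m)\<^sup>2 \<le> (1 / sqrt (2 * real m + 1))\<^sup>2"
    by (simp add: field_simps)
  then show ?thesis by (rule power2_le_imp_le) simp
qed

lemma pmf_coin_walk:
  "pmf (conv_power integer_group (pmf_of_set {0, 1}) n) x =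
     (if x < 0 then 0 else real (n choose nat x) / 2 ^ n)"
proof (induction n arbitrary: x)
  case 0
  show ?case by (auto simp: indicator_def)
next
  case (Suc n)
  have "nat x = Suc (nat (x - 1))" if "0 < x" using that by simp
  then show ?case using Suc[of x] Suc[of "x - 1"]
    by (cases "x \<le> 0") (auto simp: pmf_integer_Suc field_simps)
qed

lemma pmf_coin_walk_le:
  assumes "1 \<le> n"
  shows "pmf (conv_power integer_group (pmf_of_set {0, 1}) n) x \<le> 1 / sqrt (real n)"
proof -
  let ?m = "n div 2"
  have "real (n choose ?m) / 2 ^ n \<le> real (2 * ?m choose ?m) / 4 ^ ?m"
  proof (cases "even n")
    case True
    then have n: "2 * ?m = n" by simp
    have "(4::real) ^ ?m = 2 ^ (2 * ?m)" by (simp add: power_mult)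
    then show ?thesis by (simp only: n)
  next
    case False
    then have n: "Suc (2 * ?m) = n" by simp
    have "Suc (2 * ?m) choose ?m \<le> 2 * (2 * ?m choose ?m)"
      using binomial_maximum'[of ?m "?m - 1"] by (cases ?m) auto
    then have "n choose ?m \<le> 2 * (2 * ?m choose ?m)" by (simp only: n)
    then have "real (n choose ?m) \<le> 2 * real (2 * ?m choose ?m)"
      by (metis of_nat_le_iff of_nat_mult of_nat_numeral)
    moreover have "(2::real) ^ n = 2 * 4 ^ ?m"
      by (subst n[symmetric]) (simp add: power_mult)
    ultimately show ?thesis by (simp add: field_simps)
  qed
  also have "\<dots> \<le> 1 / sqrt (2 * real ?m + 1)" by (rule central_binomial_le)
  also have "\<dots> \<le> 1 / sqrt (real n)"
  proof -
    have "real n \<le> real (2 * ?m + 1)" by (rule of_nat_mono) simp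
    then show ?thesis using assms by (intro divide_left_mono) auto
  qed
  finally have *: "real (n choose ?m) / 2 ^ n \<le> 1 / sqrt (real n)" .
  have "real (n choose nat x) / 2 ^ n \<le> real (n choose ?m) / 2 ^ n"
    by (intro divide_right_mono of_nat_mono binomial_maximum) auto
  with * show ?thesis by (auto simp: pmf_coin_walk)
qed

lemma conv_power_integer_add:
  "conv_power integer_group (map_pmf (\<lambda>(x, y). x + y) (pair_pmf p q)) n =
   map_pmf (\<lambda>(x, y). x + y) (pair_pmf (conv_power integer_group p n) (conv_power integer_group q n))"
proof (induction n)
  case 0
  show ?case by simp
next
  case (Suc n)
  let ?P = "conv_power integer_group p n" and ?Q = "conv_power integer_group q n"
  have "conv_power integer_group (map_pmf (\<lambda>(x, y). x + y) (pair_pmf p q)) (Suc n) =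
    bind_pmf p (\<lambda>a. bind_pmf q (\<lambda>b. bind_pmf ?P (\<lambda>x. bind_pmf ?Q (\<lambda>y. return_pmf ((a + b) + (x + y))))))"
    unfolding conv_power_integer_Suc Suc
    by (simp add: pair_pmf_def map_pmf_def bind_assoc_pmf bind_return_pmf)
  also have "\<dots> = bind_pmf p (\<lambda>a. bind_pmf ?P (\<lambda>x. bind_pmf q (\<lambda>b. bind_pmf ?Q (\<lambda>y. return_pmf ((a + b) + (x + y))))))"
    by (subst bind_commute_pmf[of q ?P]) (rule refl)
  also have "\<dots> = map_pmf (\<lambda>(x, y). x + y) (pair_pmf (conv_power integer_group p (Suc n)) (conv_power integer_group q (Suc n)))"
    unfolding conv_power_integer_Suc
    by (simp add: pair_pmf_def map_pmf_def bind_assoc_pmf bind_return_pmf algebra_simps)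
  finally show ?case .
qed

lemma Z_steps_split: "pmf_of_set Z_steps = map_pmf (\<lambda>(x, y). x + y) (pair_pmf (pmf_of_set {-2, 1}) (pmf_of_set {0, 1}))"
proof -
  have "Z_steps = (\<lambda>(x, y). x + y) ` ({-2, 1} \<times> {0, 1})" by (auto simp: Z_steps_def image_iff)
  moreover have "inj_on (\<lambda>(x, y). x + y) ({-2, 1::int} \<times> {0, 1})" by (auto simp: inj_on_def)
  ultimately show ?thesis
    by (simp add: map_pmf_of_set_inj pmf_of_set_Times[symmetric])
qed

text \<open>
  By the splitting of the steps, the walk is the sum of an independent variable and a walk with steps \<open>0\<close>
  and \<open>1\<close>.  The latter is binomial, with largest weight at most \<open>1 / \<surd>n\<close>, and adding an independent
  variable does not increase the largest weight.
\<close>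
lemma Z_walk_pmf_upper:
  assumes "1 \<le> n"
  shows "pmf (Z_walk n) x \<le> 1 / sqrt (real n)"
proof -
  have "pmf (Z_walk n) x = measure_pmf.expectation (conv_power integer_group (pmf_of_set {-2, 1}) n)
      (\<lambda>a. pmf (conv_power integer_group (pmf_of_set {0, 1}) n) (x - a))"
    unfolding Z_steps_split conv_power_integer_add pmf_map_add_pair ..
  also have "\<dots> \<le> measure_pmf.expectation (conv_power integer_group (pmf_of_set {-2, 1}) n) (\<lambda>a. 1 / sqrt (real n))"
    by (intro expectation_mono_pmf finite_conv_power pmf_coin_walk_le assms) simp
  finally show ?thesis by simp
qed

lemma sum_inverse_sqrt_le: "(\<Sum>k=1..n. 1 / sqrt (real k)) \<le> 2 * sqrt (real n)"
proof (induction n)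
  case (Suc n)
  have "1 / sqrt (real (Suc n)) \<le> 2 * (sqrt (real (Suc n)) - sqrt (real n))"
  proof -
    have "1 = (sqrt (real (Suc n)))\<^sup>2 - (sqrt (real n))\<^sup>2" by simp
    also have "\<dots> = (sqrt (real (Suc n)) - sqrt (real n)) * (sqrt (real (Suc n)) + sqrt (real n))"
      by (simp only: power2_eq_square square_diff_square_factored mult.commute)
    also have "\<dots> \<le> (sqrt (real (Suc n)) - sqrt (real n)) * (2 * sqrt (real (Suc n)))"
      by (intro mult_left_mono) simp_all
    finally have "1 \<le> 2 * (sqrt (real (Suc n)) - sqrt (real n)) * sqrt (real (Suc n))"
      by (simp only: ac_simps)
    then show ?thesis by (subst pos_divide_le_eq) auto
  qed
  with Suc show ?case by simp
qed simp

lemma sum_inverse_le: "1 \<le> n \<Longrightarrow> (\<Sum>k=1..n. 1 / real k) \<le> 1 + ln (real n)"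
proof (induction n rule: dec_induct)
  case (step n)
  have "ln (real n / real (Suc n)) \<le> real n / real (Suc n) - 1"
    using step by (intro ln_le_minus_one) simp
  then have "1 / real (Suc n) \<le> ln (real (Suc n)) - ln (real n)"
    using step by (simp add: ln_div field_simps)
  with step show ?case by simp
qed simp

lemma sum_inverse_ge: "ln (real n + 1) \<le> (\<Sum>k=1..n. 1 / real k)"
  using ln_le_harm[of n] by (simp add: harm_def inverse_eq_divide)

lemma finite_walk_Z: "finite_walk integer_group (pmf_of_set Z_steps)"
  by (intro finite_walk.intro finite_walk_axioms.intro) simp_all

lemma green_split_upper:
  fixes r b :: "nat \<Rightarrow> real"
  assumes "\<And>k. 1 \<le> k \<Longrightarrow> r k \<le> b k" "r 0 \<le> (1::real)"
  shows "(\<Sum>k\<le>n. r k) \<le> 1 + (\<Sum>k=1..n. b k)"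
proof -
  have "{..n} = insert 0 {1..n}" by auto
  then have "(\<Sum>k\<le>n. r k) = r 0 + (\<Sum>k=1..n. r k)" by simp
  also have "\<dots> \<le> 1 + (\<Sum>k=1..n. b k)" using assms by (intro add_mono sum_mono) auto
  finally show ?thesis .
qed

text \<open>
  A lower bound on the return probabilities at even times is enough for the order of the Green function.
\<close>
lemma green_split_lower:
  fixes r b :: "nat \<Rightarrow> real"
  assumes "\<And>k. 1 \<le> k \<Longrightarrow> b k \<le> r (2 * k)" "r 0 = (1::real)" "\<And>k. 0 \<le> r k"
  shows "1 + (\<Sum>k=1..n div 2. b k) \<le> (\<Sum>k\<le>n. r k)"
proof -
  have "1 + (\<Sum>k=1..n div 2. b k) \<le> r 0 + (\<Sum>k=1..n div 2. r (2 * k))"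
    using assms by (intro add_mono sum_mono) auto
  also have "(\<Sum>k=1..n div 2. r (2 * k)) = (\<Sum>k\<in>(\<lambda>k. 2 * k) ` {1..n div 2}. r k)"
    by (subst sum.reindex) (auto simp: inj_on_def)
  also have "r 0 + \<dots> = (\<Sum>k\<in>insert 0 ((\<lambda>k. 2 * k) ` {1..n div 2}). r k)"
    by (subst sum.insert) auto
  also have "\<dots> \<le> (\<Sum>k\<le>n. r k)" by (intro sum_mono2) (auto simp: assms)
  finally show ?thesis .
qed

lemma green_gauge_Z: "green_gauge integer_group Z_steps sqrt"
proof -
  interpret Z: finite_walk integer_group "pmf_of_set Z_steps" by (rule finite_walk_Z)
  have g: "Z.green n = (\<Sum>k\<le>n. pmf (Z_walk k) 0)" for n
    by (simp add: Z.green_def Z.return_prob_def)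
  have upper: "Z.green n \<le> 3 * sqrt (real n)" if "1 \<le> n" for n
  proof -
    have "Z.green n \<le> 1 + (\<Sum>k=1..n. 1 / sqrt (real k))"
      unfolding g by (rule green_split_upper) (auto intro: Z_walk_pmf_upper simp: pmf_le_1)
    moreover have "1 \<le> sqrt (real n)" using that by simp
    ultimately show ?thesis using sum_inverse_sqrt_le[of n] by linarith
  qed
  have lower: "1 / 64 * sqrt (real n) \<le> Z.green n" if n: "1 \<le> n" for n
  proof -
    have s: "1 \<le> sqrt (real n)" using n by simp
    have "real n \<le> 2 * real (n div 2) + 1" by linarith
    then have "1 / 64 * real n \<le> sqrt (real n) + real (n div 2) / 32" using s by linarith
    then have "1 / 64 * (sqrt (real n) * sqrt (real n)) \<le> (1 + real (n div 2) * (1 / (32 * sqrt (real n)))) * sqrt (real n)"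
      using s by (simp add: distrib_right)
    then have "1 / 64 * sqrt (real n) \<le> 1 + real (n div 2) * (1 / (32 * sqrt (real n)))"
      using s by (simp add: mult.assoc[symmetric] del: real_sqrt_mult_self real_sqrt_mult)
    also have "real (n div 2) * (1 / (32 * sqrt (real n))) = (\<Sum>k=1..n div 2. 1 / (32 * sqrt (real n)))" by simp
    also have "\<dots> \<le> (\<Sum>k=1..n div 2. 1 / (32 * sqrt (real k)))"
      by (intro sum_mono divide_left_mono) (use n in auto)
    also have "1 + \<dots> \<le> Z.green n"
      unfolding g by (rule green_split_lower) (auto intro: Z_return_lower)
    finally show ?thesis by simp
  qed
  show ?thesis
    unfolding green_gauge_def
    by (rule exI[of _ "1 / 64"], rule conjI, simp, rule exI[of _ 3]) (use upper lower in auto)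
qed

lemma aperiodic_Z: "aperiodic_symmetric integer_group Z_steps" and zero_notin_Z_steps: "0 \<notin> Z_steps"
proof -
  have gen: "generate integer_group A = UNIV" if "1 \<in> A" for A
  proof -
    have pos: "int n \<in> generate integer_group A" for n
    proof (induction n)
      case 0
      show ?case using generate.one[of integer_group A] by simp
    next
      case (Suc n)
      then show ?case using generate.eng[OF Suc generate.incl[OF that]] by (simp add: add.commute)
    qed
    moreover have "- int n \<in> generate integer_group A" for n
    proof (induction n)
      case 0
      show ?case using generate.one[of integer_group A] by simp
    next
      case (Suc n)
      then show ?case using generate.eng[OF Suc generate.inv[OF that]] by (simp add: add.commute)
    qed
    ultimately show ?thesis by (metis UNIV_eq_I int_cases2)
  qed
  have "1 \<in> Z_steps <#>\<^bsub>integer_group\<^esub> Z_steps"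
    by (auto simp: set_mult_def Z_steps_def)
  then show "aperiodic_symmetric integer_group Z_steps"
    using gen[of Z_steps] gen[of "Z_steps <#>\<^bsub>integer_group\<^esub> Z_steps"]
    unfolding aperiodic_symmetric_def finite_generating_set_def by (auto simp: Z_steps_def)
  show "0 \<notin> Z_steps" by (simp add: Z_steps_def)
qed

lemma gauge_function_id: "gauge_function (\<lambda>x. x)"
  by (auto simp: gauge_function_def)

lemma gauge_function_sqrt: "gauge_function sqrt"
  by (auto simp: gauge_function_def real_div_sqrt)

lemma gauge_function_ln: "gauge_function (\<lambda>x. 1 + ln x)"
  unfolding gauge_function_def
proof (intro conjI allI impI)
  fix x y :: real assume xy: "1 \<le> x" "x \<le> y"
  have "ln (y / x) \<le> y / x - 1" using xy by (intro ln_le_minus_one) simp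
  then have "ln y \<le> ln x + (y / x - 1)" using xy by (simp add: ln_div)
  then have "x * (1 + ln y) \<le> x * (1 + (ln x + (y / x - 1)))" using xy by (intro mult_left_mono) auto
  also have "\<dots> = x * ln x + y" using xy by (simp add: algebra_simps)
  also have "\<dots> \<le> y * (1 + ln x)" using xy mult_right_mono[of x y "ln x"] by (simp add: algebra_simps)
  finally have "x * (1 + ln y) \<le> y * (1 + ln x)" .
  then show "x / (1 + ln x) \<le> y / (1 + ln y)"
  proof -
    have "x / a \<le> y / b" if "0 < a" "0 < b" "x * b \<le> y * a" for a b :: real
      using that by (simp add: field_simps)
    moreover have "0 < 1 + ln x" "0 < 1 + ln y" using xy by (auto intro!: add_pos_nonneg)
    ultimately show ?thesis by (metis \<open>x * (1 + ln y) \<le> y * (1 + ln x)\<close>)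
  qed
  show "1 + ln x \<le> 1 + ln y" using xy by simp
qed (simp add: add_pos_nonneg)

text \<open>
  The word length lies between \<open>|x| / 2\<close> and \<open>|x|\<close>, so the drift is of the order of the first absolute moment.
  The second moment bounds it from above; together with the fourth moment it bounds it from below, because
  \<open>y \<ge> y\<^sup>2 - y\<^sup>4\<close> for \<open>y \<ge> 0\<close>.
\<close>
lemma drift_gauge_Z: "drift_gauge integer_group Z_steps sqrt"
proof -
  interpret Z: marked_group integer_group Z_steps
    using aperiodic_Z
    by (intro marked_group.intro marked_group_axioms.intro) (simp_all add: aperiodic_symmetric_def)
  have letters: "Z.letters = Z_steps" by (auto simp: Z_steps_def)
  have len_le: "real (Z.len x) \<le> \<bar>real_of_int x\<bar>" for x
  proof -
    have "Z.len (word_prod integer_group (replicate n s)) \<le> n" if "s \<in> Z_steps" for n s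
    proof -
      have "set (replicate n s) \<subseteq> Z.letters" using that by (auto simp: letters set_replicate_conv_if)
      from Z.word_length_le[OF this] show ?thesis by (simp only: length_replicate)
    qed
    moreover have "word_prod integer_group (replicate n s) = int n * s" for n s
      by (induction n) (auto simp: algebra_simps)
    ultimately have *: "s \<in> Z_steps \<Longrightarrow> Z.len (int n * s) \<le> n" for n s by metis
    show ?thesis using *[of 1 "nat x"] *[of "-1" "nat (-x)"] by (cases "0 \<le> x") (auto simp: Z_steps_def)
  qed
  have len_ge: "\<bar>real_of_int x\<bar> \<le> 2 * real (Z.len x)" for x
  proof -
    obtain xs where xs: "length xs = Z.len x" "set xs \<subseteq> Z.letters" "x = word_prod integer_group xs"
      using Z.word_length_attained[of x] by auto
    from xs(2) have "\<bar>word_prod integer_group xs\<bar> \<le> 2 * int (length xs)"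
      unfolding letters by (induction xs) (auto simp: Z_steps_def)
    then have "\<bar>x\<bar> \<le> 2 * int (Z.len x)" using xs(1,3) by simp
    then have "real_of_int \<bar>x\<bar> \<le> real_of_int (2 * int (Z.len x))" by (simp only: of_int_le_iff)
    then show ?thesis by simp
  qed
  define m where "m k = measure_pmf.expectation (Z_walk k) (\<lambda>x. \<bar>real_of_int x\<bar>)" for k
  have upper: "m k \<le> 2 * (real k / sqrt (real k))" if "1 \<le> k" for k
  proof -
    let ?s = "sqrt (real k)"
    have s: "0 < ?s" using that by simp
    have "m k \<le> measure_pmf.expectation (Z_walk k) (\<lambda>x. ?s / 2 + 1 / (2 * ?s) * (real_of_int x)\<^sup>2)"
      unfolding m_def
    proof (rule expectation_mono_pmf[OF finite_Z_walk])
      fix x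
      have "0 \<le> (\<bar>real_of_int x\<bar> - ?s)\<^sup>2" by simp
      also have "\<dots> = \<bar>real_of_int x\<bar>\<^sup>2 + ?s\<^sup>2 - 2 * \<bar>real_of_int x\<bar> * ?s" by (rule power2_diff)
      finally have "2 * ?s * \<bar>real_of_int x\<bar> \<le> ?s * ?s + (real_of_int x)\<^sup>2"
        by (simp add: power2_eq_square ac_simps)
      then have "\<bar>real_of_int x\<bar> \<le> (?s * ?s + (real_of_int x)\<^sup>2) / (2 * ?s)"
        using s by (subst pos_le_divide_eq) (auto simp: mult.commute)
      also have "\<dots> = ?s / 2 + 1 / (2 * ?s) * (real_of_int x)\<^sup>2"
        using s by (simp add: add_divide_distrib real_div_sqrt)
      finally show "\<bar>real_of_int x\<bar> \<le> ?s / 2 + 1 / (2 * ?s) * (real_of_int x)\<^sup>2" .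
    qed
    also have "\<dots> = ?s / 2 + 1 / (2 * ?s) * (5 / 2 * real k)"
      by (subst expectation_add_pmf) (simp_all add: Z_walk_second_moment)
    also have "\<dots> = ?s / 2 + 5 / 4 * (real k / ?s)" by simp
    also have "\<dots> \<le> 2 * (real k / ?s)" by (simp add: real_div_sqrt)
    finally show ?thesis .
  qed
  have lower: "1 / 4 * (real k / sqrt (real k)) \<le> m k" if "1 \<le> k" for k
  proof -
    \<comment> \<open>The factor 5 balances the two moments: \<open>(5/2) / 5 - 28 / 5\<^sup>3 > 1/4\<close>.\<close>
    let ?s = "5 * sqrt (real k)"
    have s: "0 < ?s" using that by simp
    have k: "sqrt (real k) * sqrt (real k) = real k" by simp
    have "1 / 4 * (real k / sqrt (real k)) = 1 / 4 * sqrt (real k)" by (simp add: real_div_sqrt)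
    also have "\<dots> \<le> 5 / 2 * real k / ?s - 28 * (real k)\<^sup>2 / ?s ^ 3"
    proof -
      have "5 / 2 * (t * t) / (5 * t) = 1 / 2 * t" "28 * (t * t)\<^sup>2 / (5 * t) ^ 3 = 28 / 125 * t"
        if "0 < t" for t :: real
        using that by (simp_all add: power2_eq_square power3_eq_cube)
      from this[of "sqrt (real k)"]
      have e1: "5 / 2 * real k / ?s = 1 / 2 * sqrt (real k)"
        and e2: "28 * (real k)\<^sup>2 / ?s ^ 3 = 28 / 125 * sqrt (real k)"
        unfolding k using that by simp_all
      show ?thesis unfolding e1 e2 using s by simp
    qed
    also have "\<dots> \<le> 1 / ?s * (5 / 2 * real k) - 1 / ?s ^ 3 * measure_pmf.expectation (Z_walk k) (\<lambda>x. (real_of_int x) ^ 4)"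
      using mult_left_mono[OF Z_walk_fourth_moment[of k], of "1 / ?s ^ 3"] s by simp
    also have "\<dots> = measure_pmf.expectation (Z_walk k)
        (\<lambda>x. 1 / ?s * (real_of_int x)\<^sup>2 + (- 1 / ?s ^ 3) * (real_of_int x) ^ 4)"
    proof -
      have "measure_pmf.expectation (Z_walk k) (\<lambda>x. a * (real_of_int x)\<^sup>2 + b * (real_of_int x) ^ 4) =
          a * (5 / 2 * real k) + b * measure_pmf.expectation (Z_walk k) (\<lambda>x. (real_of_int x) ^ 4)" for a b
        by (subst expectation_add_pmf[OF finite_Z_walk]) (simp add: Z_walk_second_moment)
      from this[of "1 / ?s" "- 1 / ?s ^ 3"] show ?thesis by simp
    qed
    also have "\<dots> \<le> m k"
      unfolding m_def
    proof (rule expectation_mono_pmf[OF finite_Z_walk])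
      fix x
      define y where "y = \<bar>real_of_int x\<bar> / ?s"
      have y: "0 \<le> y" "\<bar>real_of_int x\<bar> = ?s * y" using s by (auto simp: y_def)
      have "y\<^sup>2 - y ^ 4 \<le> y"
      proof (cases "y \<le> 1")
        case True
        then have "y\<^sup>2 \<le> y" using y(1) mult_left_mono[of y 1 y] by (simp add: power2_eq_square)
        then show ?thesis using y(1) zero_le_power[OF y(1), of 4] by linarith
      next
        case False
        then have "y\<^sup>2 \<le> y ^ 4" by (intro power_increasing) auto
        then show ?thesis using y(1) by linarith
      qed
      then have "?s * (y\<^sup>2 - y ^ 4) \<le> ?s * y" using s by (intro mult_left_mono) auto
      moreover have "(real_of_int x)\<^sup>2 = (?s * y)\<^sup>2" "(real_of_int x) ^ 4 = (?s * y) ^ 4"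
        unfolding y(2)[symmetric] by (simp_all add: power_even_abs)
      moreover have "1 / t * (t * y)\<^sup>2 + (- 1 / t ^ 3) * (t * y) ^ 4 = t * (y\<^sup>2 - y ^ 4)" if "0 < t" for t :: real
        using that by (simp add: power_mult_distrib power2_eq_square power3_eq_cube power4_eq_xxxx algebra_simps)
      ultimately show "1 / ?s * (real_of_int x)\<^sup>2 + (- 1 / ?s ^ 3) * (real_of_int x) ^ 4 \<le> \<bar>real_of_int x\<bar>"
        using s y(2) by metis
    qed
    finally show ?thesis .
  qed
  have d_upper: "drift integer_group Z_steps (pmf_of_set Z_steps) k \<le> m k" for k
    unfolding drift_def m_def by (intro expectation_mono_pmf finite_Z_walk len_le)
  have d_lower: "m k \<le> 2 * drift integer_group Z_steps (pmf_of_set Z_steps) k" for k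
  proof -
    have "m k \<le> measure_pmf.expectation (Z_walk k) (\<lambda>x. 2 * real (Z.len x))"
      unfolding m_def by (intro expectation_mono_pmf finite_Z_walk len_ge)
    then show ?thesis by (simp add: drift_def)
  qed
  show ?thesis
    unfolding drift_gauge_def
  proof (rule exI[of _ "1 / 8"], rule conjI, simp, rule exI[of _ 2], intro conjI allI impI)
    fix k :: nat assume k: "1 \<le> k"
    show "1 / 8 * (real k / sqrt (real k)) \<le> drift integer_group Z_steps (pmf_of_set Z_steps) k"
      using lower[OF k] d_lower[of k] by linarith
    show "drift integer_group Z_steps (pmf_of_set Z_steps) k \<le> 2 * (real k / sqrt (real k))"
      using upper[OF k] d_upper[of k] by linarith
  qed simp
qed

lemma group_Z2: "group Z2_group"
  unfolding Z2_group_def by (intro DirProd_group group_integer)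

lemma Z2_simps [simp]:
  "carrier Z2_group = UNIV" "\<one>\<^bsub>Z2_group\<^esub> = (0, 0)"
  "p \<otimes>\<^bsub>Z2_group\<^esub> q = (fst p + fst q, snd p + snd q)"
  by (auto simp: Z2_group_def DirProd_def case_prod_unfold)

lemma inv_Z2 [simp]: "inv\<^bsub>Z2_group\<^esub> p = (- fst p, - snd p)"
  by (rule group.inv_equality[OF group_Z2]) auto

lemma conv_power_Z2:
  "conv_power Z2_group (pair_pmf p q) n = pair_pmf (conv_power integer_group p n) (conv_power integer_group q n)"
proof (induction n)
  case 0
  show ?case by (simp add: pair_return_pmf1)
next
  case (Suc n)
  let ?P = "conv_power integer_group p n" and ?Q = "conv_power integer_group q n"
  have "conv_power Z2_group (pair_pmf p q) (Suc n) =
     bind_pmf ?P (\<lambda>x. bind_pmf ?Q (\<lambda>y. bind_pmf p (\<lambda>a. bind_pmf q (\<lambda>b. return_pmf (x + a, y + b)))))"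
    unfolding conv_power.simps(2) Suc
    by (simp add: pair_pmf_def map_pmf_def bind_assoc_pmf bind_return_pmf)
  also have "\<dots> = bind_pmf ?P (\<lambda>x. bind_pmf p (\<lambda>a. bind_pmf ?Q (\<lambda>y. bind_pmf q (\<lambda>b. return_pmf (x + a, y + b)))))"
    by (subst bind_commute_pmf[of ?Q p]) (rule refl)
  also have "\<dots> = pair_pmf (conv_power integer_group p (Suc n)) (conv_power integer_group q (Suc n))"
    unfolding conv_power.simps(2)
    by (simp add: pair_pmf_def map_pmf_def bind_assoc_pmf bind_return_pmf)
  finally show ?case .
qed

abbreviation "Z2_steps \<equiv> Z_steps \<times> Z_steps"

lemma finite_walk_Z2: "finite_walk Z2_group (pmf_of_set Z2_steps)"
  by (intro finite_walk.intro finite_walk_axioms.intro group_Z2) simp_all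

lemma Z2_return: "pmf (conv_power Z2_group (pmf_of_set Z2_steps) n) (0, 0) = (pmf (Z_walk n) 0)\<^sup>2"
  by (simp add: pmf_of_set_Times conv_power_Z2 pmf_pair power2_eq_square)

lemma green_gauge_Z2: "green_gauge Z2_group Z2_steps (\<lambda>x. 1 + ln x)"
proof -
  interpret Z2: finite_walk Z2_group "pmf_of_set Z2_steps" by (rule finite_walk_Z2)
  have g: "Z2.green n = (\<Sum>k\<le>n. (pmf (Z_walk k) 0)\<^sup>2)" for n
    by (simp add: Z2.green_def Z2.return_prob_def Z2_return)
  have upper: "Z2.green n \<le> 2 * (1 + ln (real n))" if "1 \<le> n" for n
  proof -
    have "Z2.green n \<le> 1 + (\<Sum>k=1..n. 1 / real k)"
      unfolding g
    proof (rule green_split_upper)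
      fix k :: nat assume k: "1 \<le> k"
      have "(pmf (Z_walk k) 0)\<^sup>2 \<le> (1 / sqrt (real k))\<^sup>2"
        by (intro power_mono Z_walk_pmf_upper k) simp
      then show "(pmf (Z_walk k) 0)\<^sup>2 \<le> 1 / real k" by (simp add: power_divide)
    qed simp
    moreover have "0 \<le> ln (real n)" using that by simp
    ultimately show ?thesis using sum_inverse_le[OF that] unfolding distrib_left by linarith
  qed
  have lower: "1 / 1024 * (1 + ln (real n)) \<le> Z2.green n" if n: "1 \<le> n" for n
  proof -
    have "real n \<le> 2 * real (n div 2) + 2" by linarith
    then have "ln (real n) \<le> ln (2 * (real (n div 2) + 1))" using n by (subst ln_le_cancel_iff) auto
    also have "\<dots> = ln 2 + ln (real (n div 2) + 1)" by (subst ln_mult_pos) auto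
    also have "\<dots> \<le> 1 + (\<Sum>k=1..n div 2. 1 / real k)"
      using sum_inverse_ge[of "n div 2"] ln_2_less_1 by (intro add_mono) auto
    finally have "1 / 1024 * (1 + ln (real n)) \<le> 1 + (1 / 1024) * (\<Sum>k=1..n div 2. 1 / real k)"
      unfolding distrib_left by linarith
    also have "(1 / 1024) * (\<Sum>k=1..n div 2. 1 / real k) = (\<Sum>k=1..n div 2. 1 / (1024 * real k))"
      by (simp add: sum_distrib_left)
    also have "1 + \<dots> \<le> Z2.green n"
      unfolding g
    proof (rule green_split_lower)
      fix k :: nat assume k: "1 \<le> k"
      have "(1 / (32 * sqrt (real k)))\<^sup>2 \<le> (pmf (Z_walk (2 * k)) 0)\<^sup>2"
        by (intro power_mono Z_return_lower k) simp
      then show "1 / (1024 * real k) \<le> (pmf (Z_walk (2 * k)) 0)\<^sup>2"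
        by (simp add: power_divide power_mult_distrib)
    qed auto
    finally show ?thesis .
  qed
  show ?thesis
    unfolding green_gauge_def
    by (rule exI[of _ "1 / 1024"], rule conjI, simp, rule exI[of _ 2]) (use upper lower in auto)
qed

lemma aperiodic_Z2: "aperiodic_symmetric Z2_group Z2_steps"
proof -
  have gen: "generate Z2_group A = UNIV" if A: "(1, 0) \<in> A" "(0, 1) \<in> A" for A
  proof -
    have nat_mult: "(int n * a, int n * b) \<in> generate Z2_group A" if "(a, b) \<in> generate Z2_group A" for n a b
    proof (induction n)
      case 0
      show ?case using generate.one[of Z2_group A] by simp
    next
      case (Suc n)
      then show ?case using generate.eng[OF Suc that] by (simp add: algebra_simps)
    qed
    have int_mult: "(k * a, k * b) \<in> generate Z2_group A" if "(a, b) \<in> A" for k a b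
    proof (cases "0 \<le> k")
      case True
      then show ?thesis using nat_mult[OF generate.incl[OF that], of "nat k"] by simp
    next
      case False
      have "(- a, - b) \<in> generate Z2_group A" using generate.inv[OF that, of Z2_group] by simp
      from nat_mult[OF this, of "nat (- k)"] False show ?thesis by simp
    qed
    have "(x, y) \<in> generate Z2_group A" for x y
      using generate.eng[OF int_mult[OF A(1), of x] int_mult[OF A(2), of y]] by simp
    then show ?thesis by auto
  qed
  have "(1, 0) \<in> Z2_steps <#>\<^bsub>Z2_group\<^esub> Z2_steps" "(0, 1) \<in> Z2_steps <#>\<^bsub>Z2_group\<^esub> Z2_steps"
    unfolding set_mult_def by (force simp: Z_steps_def)+
  then have SS: "generate Z2_group (Z2_steps <#>\<^bsub>Z2_group\<^esub> Z2_steps) = UNIV" by (rule gen)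
  interpret group Z2_group by (rule group_Z2)
  have "generate Z2_group (Z2_steps <#>\<^bsub>Z2_group\<^esub> Z2_steps) \<subseteq> generate Z2_group Z2_steps"
  proof (rule generate_subgroup_incl)
    show "Z2_steps <#>\<^bsub>Z2_group\<^esub> Z2_steps \<subseteq> generate Z2_group Z2_steps"
      unfolding set_mult_def by (blast intro: generate.incl generate.eng)
    show "subgroup (generate Z2_group Z2_steps) Z2_group" by (rule generate_is_subgroup) simp
  qed
  then have "generate Z2_group Z2_steps = UNIV" using SS by blast
  then show ?thesis
    unfolding aperiodic_symmetric_def finite_generating_set_def
    using SS group_Z2 by (auto simp: Z_steps_def)
qed

section \<open>Finite groups\<close>

lemma (in group) conv_power_uniform:
  assumes "finite (carrier G)"
  shows "conv_power G (pmf_of_set (carrier G)) (Suc n) = pmf_of_set (carrier G)"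
proof (induction n)
  case 0
  have "carrier G \<noteq> {}" by auto
  then have "map_pmf ((\<otimes>) \<one>) (pmf_of_set (carrier G)) = map_pmf id (pmf_of_set (carrier G))"
    by (intro map_pmf_cong refl) (use assms in simp)
  then show ?case
    by (simp add: conv_power.simps(2) pair_return_pmf1 pmf.map_comp o_def pmf.map_id)
next
  case (Suc n)
  have ne: "carrier G \<noteq> {}" by auto
  have shift: "map_pmf ((\<otimes>) x) (pmf_of_set (carrier G)) = pmf_of_set (carrier G)" if x: "x \<in> carrier G" for x
  proof -
    have "map_pmf ((\<otimes>) x) (pmf_of_set (carrier G)) = pmf_of_set ((\<otimes>) x ` carrier G)"
      by (rule map_pmf_of_set_inj) (use x assms ne in \<open>auto intro: inj_onI\<close>)
    also have "(\<otimes>) x ` carrier G = carrier G"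
      using x by (rule surj_const_mult)
    finally show ?thesis .
  qed
  have "conv_power G (pmf_of_set (carrier G)) (Suc (Suc n)) =
      bind_pmf (pmf_of_set (carrier G)) (\<lambda>x. map_pmf ((\<otimes>) x) (pmf_of_set (carrier G)))"
    by (subst conv_power_Suc_bind) (use assms ne in \<open>simp_all add: Suc\<close>)
  also have "\<dots> = bind_pmf (pmf_of_set (carrier G)) (\<lambda>x. pmf_of_set (carrier G))"
    by (intro bind_pmf_cong refl shift) (use assms ne in simp)
  finally show ?case by simp
qed

text \<open>
  After one uniform step the walk is in its stationary law, so the drift is a positive constant, which is of
  the order of \<open>k / \<psi>(k)\<close> for \<open>\<psi>(k) = k\<close>.
\<close>
lemma finite_group_gauge:
  assumes F: "group F" "finite (carrier F)" "carrier F \<noteq> {\<one>\<^bsub>F\<^esub>}"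
  shows "aperiodic_symmetric F (carrier F)" "drift_gauge F (carrier F) (\<lambda>x. x)"
proof -
  interpret group F by fact
  have ne: "carrier F \<noteq> {}" by auto
  have "carrier F <#>\<^bsub>F\<^esub> carrier F = carrier F"
    by (rule set_mult_carrier_idem[OF subgroup_self])
  moreover have "generate F (carrier F) = carrier F"
    using generate_incl[of "carrier F"] by (auto intro: generate.incl)
  ultimately show ap: "aperiodic_symmetric F (carrier F)"
    using assms by (auto simp: aperiodic_symmetric_def finite_generating_set_def)
  interpret F: marked_group F "carrier F"
    using ap F(1) by (intro marked_group.intro marked_group_axioms.intro) (simp_all add: aperiodic_symmetric_def)
  define d where "d = measure_pmf.expectation (pmf_of_set (carrier F)) (\<lambda>g. real (F.len g))"
  obtain g where g: "g \<in> carrier F" "g \<noteq> \<one>\<^bsub>F\<^esub>" using F(3) one_closed by blast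
  have "0 < (\<Sum>h\<in>carrier F. real (F.len h))"
    by (rule sum_pos2[OF F(2) g(1)]) (use F.word_length_pos[OF g] in auto)
  then have "0 < d" using F(2) ne by (simp add: d_def integral_pmf_of_set card_gt_0_iff)
  moreover have "drift F (carrier F) (pmf_of_set (carrier F)) k = d" if "1 \<le> k" for k
    using conv_power_uniform[OF F(2), of "k - 1"] that by (simp add: drift_def d_def)
  ultimately show "drift_gauge F (carrier F) (\<lambda>x. x)"
    unfolding drift_gauge_def by (intro exI[of _ d]) auto
qed

section \<open>Iterated wreath products\<close>

lemma image_group_simps:
  assumes "inj f"
  shows "carrier (image_group f G) = f ` carrier G" "\<one>\<^bsub>image_group f G\<^esub> = f \<one>\<^bsub>G\<^esub>"
    "x \<in> carrier G \<Longrightarrow> y \<in> carrier G \<Longrightarrow> f x \<otimes>\<^bsub>image_group f G\<^esub> f y = f (x \<otimes>\<^bsub>G\<^esub> y)"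
  using inj_on_subset[OF assms subset_UNIV, of "carrier G"] by (auto simp: image_group_def inv_into_f_f)

lemma group_hom_image_group:
  assumes "group G" "inj f"
  shows "group_hom G (image_group f G) f"
  using image_group_iso[OF assms] assms(1)
  by (auto simp: group_hom_def group_hom_axioms_def iso_def)

text \<open>
  The levels of the iterated wreath product are copies of wreath products along the constructors of the type
  of towers; the walk, its generating sets and its drift are carried along.
\<close>
lemma image_group_transfer:
  assumes ap: "aperiodic_symmetric G S" and drift: "drift_gauge G S \<psi>" and f: "inj f"
  shows "aperiodic_symmetric (image_group f G) (f ` S)" "drift_gauge (image_group f G) (f ` S) \<psi>"
proof -
  let ?H = "image_group f G"
  interpret G: marked_group G S
    using ap by (intro marked_group.intro marked_group_axioms.intro) (simp_all add: aperiodic_symmetric_def)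
  interpret h: group_hom G ?H f by (rule group_hom_image_group[OF G.group_axioms f])
  note im = image_group_simps[OF f, where G = G]
  have inv: "inv\<^bsub>?H\<^esub> (f x) = f (inv\<^bsub>G\<^esub> x)" if "x \<in> carrier G" for x
    using h.hom_inv[OF that] by simp
  have gen: "generate ?H (f ` A) = f ` generate G A" if "A \<subseteq> carrier G" for A
    using h.generate_img[OF that] by simp
  have "f ` S <#>\<^bsub>?H\<^esub> f ` S = (\<Union>x\<in>S. \<Union>y\<in>S. {f x \<otimes>\<^bsub>?H\<^esub> f y})"
    by (simp add: set_mult_def)
  also have "\<dots> = (\<Union>x\<in>S. \<Union>y\<in>S. {f (x \<otimes>\<^bsub>G\<^esub> y)})"
  proof (intro SUP_cong refl)
    fix x y assume "x \<in> S" "y \<in> S"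
    then have "x \<in> carrier G" "y \<in> carrier G" using G.S_carrier by blast+
    then show "{f x \<otimes>\<^bsub>?H\<^esub> f y} = {f (x \<otimes>\<^bsub>G\<^esub> y)}" by (simp only: im(3))
  qed
  also have "\<dots> = f ` (S <#>\<^bsub>G\<^esub> S)"
    by (simp add: set_mult_def image_UN)
  finally have set_mult: "f ` S <#>\<^bsub>?H\<^esub> f ` S = f ` (S <#>\<^bsub>G\<^esub> S)" .
  have "S <#>\<^bsub>G\<^esub> S \<subseteq> carrier G" using G.S_carrier unfolding set_mult_def by blast
  then have "generate ?H (f ` S <#>\<^bsub>?H\<^esub> f ` S) = carrier ?H"
    unfolding set_mult im(1) using gen ap by (simp add: aperiodic_symmetric_def)
  moreover have "generate ?H (f ` S) = carrier ?H"
    unfolding im(1) using gen[OF G.S_carrier] ap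
    by (simp add: aperiodic_symmetric_def finite_generating_set_def)
  moreover have "inv\<^bsub>?H\<^esub> y \<in> f ` S" if y: "y \<in> f ` S" for y
  proof -
    from y obtain x where x: "y = f x" "x \<in> S" by blast
    then have "inv\<^bsub>?H\<^esub> y = f (inv\<^bsub>G\<^esub> x)" using inv G.S_carrier by blast
    moreover have "inv\<^bsub>G\<^esub> x \<in> S" using ap x by (simp add: aperiodic_symmetric_def)
    ultimately show ?thesis by blast
  qed
  moreover have "f ` S \<subseteq> carrier ?H" "finite (f ` S)" "f ` S \<noteq> {}"
    using ap G.S_carrier by (auto simp: im(1) aperiodic_symmetric_def finite_generating_set_def)
  ultimately show "aperiodic_symmetric ?H (f ` S)"
    unfolding aperiodic_symmetric_def finite_generating_set_def
    using image_group_iso(1)[OF G.group_axioms f] by blast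
  have S: "finite S" "S \<noteq> {}" using ap by (auto simp: aperiodic_symmetric_def finite_generating_set_def)
  have pmf: "pmf_of_set (f ` S) = map_pmf f (pmf_of_set S)"
    by (rule map_pmf_of_set_inj[symmetric]) (use f S in \<open>auto intro: inj_on_subset\<close>)
  have cp_carrier: "set_pmf (conv_power G (pmf_of_set S) n) \<subseteq> carrier G" for n
    by (rule G.conv_power_carrier) (use S G.S_carrier in simp)
  have cp: "conv_power ?H (pmf_of_set (f ` S)) n = map_pmf f (conv_power G (pmf_of_set S) n)" for n
  proof (induction n)
    case 0
    show ?case by simp
  next
    case (Suc n)
    have "conv_power ?H (pmf_of_set (f ` S)) (Suc n) =
      map_pmf (\<lambda>(x, y). f x \<otimes>\<^bsub>?H\<^esub> f y) (pair_pmf (conv_power G (pmf_of_set S) n) (pmf_of_set S))"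
      unfolding conv_power.simps(2) Suc unfolding pmf
      by (simp add: pair_map_pmf1 pair_map_pmf2 pmf.map_comp o_def case_prod_unfold)
    also have "\<dots> = map_pmf (\<lambda>(x, y). f (x \<otimes>\<^bsub>G\<^esub> y)) (pair_pmf (conv_power G (pmf_of_set S) n) (pmf_of_set S))"
      using cp_carrier[of n] S G.S_carrier by (intro map_pmf_cong refl) (auto simp: subset_iff)
    also have "\<dots> = map_pmf f (conv_power G (pmf_of_set S) (Suc n))"
      unfolding conv_power.simps(2) by (simp add: pmf.map_comp o_def case_prod_unfold)
    finally show ?case .
  qed
  have letters: "f ` S \<union> m_inv ?H ` f ` S = f ` G.letters"
  proof -
    have "m_inv ?H ` f ` S = f ` m_inv G ` S"
      unfolding image_image using G.S_carrier by (intro image_cong refl inv) auto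
    then show ?thesis by (simp add: image_Un)
  qed
  have wp: "word_prod ?H (map f xs) = f (word_prod G xs)" if "set xs \<subseteq> carrier G" for xs
    using that by (induction xs) (auto simp: G.word_prod_closed)
  have len: "word_length ?H (f ` S) (f g) = G.len g" for g
  proof -
    have "(\<exists>xs. length xs = n \<and> set xs \<subseteq> f ` G.letters \<and> f g = word_prod ?H xs) \<longleftrightarrow>
      (\<exists>ys. length ys = n \<and> set ys \<subseteq> G.letters \<and> g = word_prod G ys)" (is "?L \<longleftrightarrow> ?R") for n
    proof
      assume ?L
      then obtain xs where xs: "length xs = n" "set xs \<subseteq> f ` G.letters" "f g = word_prod ?H xs" by blast
      from xs(2) have "xs \<in> lists (f ` G.letters)" by (simp add: lists_eq_set)
      then have "xs \<in> map f ` lists G.letters" by (simp only: lists_image)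
      then obtain ys where ys: "xs = map f ys" "set ys \<subseteq> G.letters" by (auto simp: lists_eq_set)
      then have "set ys \<subseteq> carrier G" using G.letters_carrier by blast
      from wp[OF this] xs(1,3) ys f show ?R by (auto simp: inj_eq)
    next
      assume ?R
      then obtain ys where ys: "length ys = n" "set ys \<subseteq> G.letters" "g = word_prod G ys" by blast
      then have "set ys \<subseteq> carrier G" using G.letters_carrier by blast
      then have "f g = word_prod ?H (map f ys)" unfolding ys(3) by (rule wp[symmetric])
      moreover have "set (map f ys) \<subseteq> f ` G.letters" using ys(2) by auto
      ultimately show ?L using ys(1) by (metis length_map)
    qed
    then show ?thesis unfolding word_length_def letters by simp
  qed
  have "drift ?H (f ` S) (pmf_of_set (f ` S)) n = drift G S (pmf_of_set S) n" for n
    unfolding drift_def cp by (simp add: len)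
  then show "drift_gauge ?H (f ` S) \<psi>" using drift by (simp add: drift_gauge_def)
qed

lemma funpow_ge_one:
  fixes \<gamma> :: "real \<Rightarrow> real"
  assumes "\<And>x. 1 \<le> x \<Longrightarrow> 1 \<le> \<gamma> x" "1 \<le> x"
  shows "1 \<le> (\<gamma> ^^ i) x"
  using assms by (induction i) auto

lemma gauge_function_funpow:
  assumes "gauge_function \<gamma>" "\<And>x. 1 \<le> x \<Longrightarrow> 1 \<le> \<gamma> x"
  shows "gauge_function (\<gamma> ^^ i)"
proof (induction i)
  case 0
  show ?case by (simp add: gauge_function_def)
next
  case (Suc i)
  have "gauge_function (\<lambda>x. \<gamma> ((\<gamma> ^^ i) x))"
    by (rule gauge_function_comp[OF assms(1) Suc funpow_ge_one]) (use assms in auto)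
  then show ?case by (simp add: o_def)
qed

lemma drift_gauge_iter_wreath:
  assumes C: "aperiodic_symmetric C S" "\<one>\<^bsub>C\<^esub> \<notin> S" and green: "green_gauge C S \<gamma>"
    and \<gamma>: "gauge_function \<gamma>" "\<And>x. 1 \<le> x \<Longrightarrow> 1 \<le> \<gamma> x"
    and D: "aperiodic_symmetric D T" "drift_gauge D T \<psi>" "gauge_function \<psi>"
  shows "\<exists>U. aperiodic_symmetric (iter_wreath C D i) U \<and>
             drift_gauge (iter_wreath C D i) U (\<lambda>x. \<psi> ((\<gamma> ^^ i) x))"
proof (induction i)
  case 0
  have "inj Base" by (simp add: inj_def)
  from image_group_transfer[OF D(1,2) this] show ?case by auto
next
  case (Suc i)
  then obtain U where U: "aperiodic_symmetric (iter_wreath C D i) U"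
    "drift_gauge (iter_wreath C D i) U (\<lambda>x. \<psi> ((\<gamma> ^^ i) x))" by blast
  have "gauge_function (\<lambda>x. \<psi> ((\<gamma> ^^ i) x))"
    by (rule gauge_function_comp[OF D(3) gauge_function_funpow[OF \<gamma>] funpow_ge_one]) (use \<gamma>(2) in auto)
  from drift_gauge_wreath[OF C green \<gamma>(2) U this]
  obtain V where V: "aperiodic_symmetric (wreath C (iter_wreath C D i)) V"
    "drift_gauge (wreath C (iter_wreath C D i)) V (\<lambda>x. \<psi> ((\<gamma> ^^ i) (\<gamma> x)))" by blast
  have "inj (\<lambda>(c, f). Level c f)" by (auto simp: inj_def)
  from image_group_transfer[OF V this] show ?case by (auto simp: funpow_swap1)
qed

section \<open>Iterated logarithms and roots\<close>

lemma filterlim_funpow_ln: "filterlim (ln ^^ i :: real \<Rightarrow> real) at_top at_top"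
proof (induction i)
  case 0
  show ?case by (simp add: id_def filterlim_ident)
next
  case (Suc i)
  from filterlim_compose[OF ln_at_top Suc] show ?case by (simp add: o_def)
qed

lemma funpow_ln_comparable:
  "\<forall>\<^sub>F x in at_top. (ln ^^ i) x \<le> ((\<lambda>x. 1 + ln x) ^^ i) x \<and> ((\<lambda>x. 1 + ln x) ^^ i) x \<le> 2 * (ln ^^ i) (x :: real)"
proof (induction i)
  case 0
  show ?case using eventually_ge_at_top[of 0] by eventually_elim simp
next
  case (Suc i)
  have "\<forall>\<^sub>F x in at_top. 1 \<le> (ln ^^ i) (x :: real)" "\<forall>\<^sub>F x in at_top. 2 \<le> (ln ^^ Suc i) (x :: real)"
    using filterlim_funpow_ln unfolding filterlim_at_top by blast+
  with Suc show ?case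
  proof eventually_elim
    case (elim x)
    let ?l = "(ln ^^ i) x" and ?g = "((\<lambda>x. 1 + ln x) ^^ i) x"
    have "ln ?l \<le> ln ?g" using elim by (subst ln_le_cancel_iff) auto
    moreover have "ln ?g \<le> ln (2 * ?l)" using elim by (subst ln_le_cancel_iff) auto
    moreover have "ln (2 * ?l) = ln 2 + ln ?l" using elim by (subst ln_mult_pos) auto
    moreover have "2 \<le> ln ?l" using elim by simp
    ultimately have "ln ?l \<le> 1 + ln ?g" "1 + ln ?g \<le> 2 * ln ?l" using ln_2_less_1 by linarith+
    then show ?case by simp
  qed
qed

lemma root_two_le: "1 \<le> k \<Longrightarrow> root k 2 \<le> 2"
proof -
  assume k: "1 \<le> k"
  have "root k 2 \<le> root k (2 ^ k)"
    using k power_increasing[of 1 k "2::real"] by (subst real_root_le_iff) auto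
  also have "\<dots> = 2" using k by (simp add: real_root_power_cancel)
  finally show ?thesis .
qed

lemma funpow_sqrt_eq_root: "(sqrt ^^ i) x = root (2 ^ i) x"
proof (induction i)
  case (Suc i)
  have "root (2 ^ Suc i) x = root 2 (root (2 ^ i) x)"
    using real_root_mult_exp[of 2 "2 ^ i" x] by simp
  with Suc show ?case by (simp add: sqrt_def)
qed simp

text \<open>
  The passage from uniform bounds for one generating set to asymptotics for every generating set.  The factor
  \<open>2\<close> leaves room for replacing the iterates of \<open>1 + ln x\<close> by iterated logarithms.
\<close>
lemma drift_asymp_of_gauge:
  assumes ap: "aperiodic_symmetric G U" and drift: "drift_gauge G U \<psi>"
    and t: "\<forall>\<^sub>F n in sequentially. 0 < t n \<and> t n \<le> \<psi> (real n) \<and> \<psi> (real n) \<le> 2 * t n"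
  shows "\<exists>\<mu>. simple_walk_measure G \<mu> \<and>
    (\<forall>S. finite_generating_set G S \<longrightarrow> drift G S \<mu> \<asymp> (\<lambda>n. real n / t n))"
proof (intro exI conjI allI impI)
  let ?\<mu> = "pmf_of_set U"
  interpret group G using ap by (simp add: aperiodic_symmetric_def)
  have U: "finite U" "U \<noteq> {}" "U \<subseteq> carrier G" "generate G U = carrier G"
    using ap by (auto simp: aperiodic_symmetric_def finite_generating_set_def)
  have inv_iff: "inv\<^bsub>G\<^esub> g \<in> U \<longleftrightarrow> g \<in> U" if "g \<in> carrier G" for g
    using ap that by (metis aperiodic_symmetric_def inv_inv)
  show "simple_walk_measure G ?\<mu>"
    unfolding simple_walk_measure_def walk_measure_def
    using U inv_iff by (auto simp: indicator_def)
  have mU: "marked_group G U"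
    using ap by (intro marked_group.intro marked_group_axioms.intro) (simp_all add: aperiodic_symmetric_def)
  fix S assume "finite_generating_set G S"
  then have mS: "marked_group G S"
    by (intro marked_group.intro marked_group_axioms.intro is_group)
  have fin: "finite (set_pmf ?\<mu>)" "set_pmf ?\<mu> \<subseteq> carrier G" using U by auto
  obtain K1 :: real where K1: "K1 \<ge> 1" "\<And>n. drift G S ?\<mu> n \<le> K1 * drift G U ?\<mu> n"
    using drift_comparable[OF mU mS fin] by blast
  obtain K2 :: real where K2: "K2 \<ge> 1" "\<And>n. drift G U ?\<mu> n \<le> K2 * drift G S ?\<mu> n"
    using drift_comparable[OF mS mU fin] by blast
  obtain c1 c2 where c: "0 < c1" "0 < c2" "\<And>k. 1 \<le> k \<Longrightarrow> c1 * (real k / \<psi> (real k)) \<le> drift G U ?\<mu> k"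
    "\<And>k. 1 \<le> k \<Longrightarrow> drift G U ?\<mu> k \<le> c2 * (real k / \<psi> (real k))"
    using drift unfolding drift_gauge_def by blast
  show "drift G S ?\<mu> \<asymp> (\<lambda>n. real n / t n)"
    unfolding asymp_order_def
  proof (intro exI conjI)
    show "0 < c1 / (2 * K2)" "0 < K1 * c2" using c K1 K2 by auto
    show "\<forall>\<^sub>F n in sequentially. c1 / (2 * K2) * (real n / t n) \<le> drift G S ?\<mu> n \<and>
        drift G S ?\<mu> n \<le> K1 * c2 * (real n / t n)"
      using t eventually_ge_at_top[of 1]
    proof eventually_elim
      case (elim n)
      then have "0 < \<psi> (real n)" by linarith
      have "real n / (2 * t n) \<le> real n / \<psi> (real n)" "real n / \<psi> (real n) \<le> real n / t n"
        using elim \<open>0 < \<psi> (real n)\<close> by (auto intro!: divide_left_mono mult_pos_pos)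
      then have "c1 * (real n / (2 * t n)) \<le> K2 * drift G S ?\<mu> n"
        "c2 * (real n / \<psi> (real n)) \<le> c2 * (real n / t n)"
        using c(3)[OF elim(2)] K2(2)[of n] mult_left_mono[of _ _ c1] mult_left_mono[of _ _ c2] c(1,2)
        by (meson less_imp_le order_trans)+
      then have upper: "drift G S ?\<mu> n \<le> K1 * (c2 * (real n / t n))"
        using K1 c(4)[OF elim(2)] mult_left_mono[of "drift G U ?\<mu> n" "c2 * (real n / t n)" K1]
        by (meson order_trans zero_le_one)
      have "(c1 * (real n / (2 * t n))) / K2 \<le> drift G S ?\<mu> n"
        using \<open>c1 * (real n / (2 * t n)) \<le> _\<close> K2(1) by (subst pos_divide_le_eq) (auto simp: mult.commute)
      with upper show ?case by (simp add: ac_simps)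
    qed
  qed
qed

theorem theorem1:
  fixes F :: "('f, 'm) monoid_scheme"
  shows
    "(group F \<and> finite (carrier F) \<and> carrier F \<noteq> {\<one>\<^bsub>F\<^esub>} \<longrightarrow>
       (\<forall>i\<ge>1. \<exists>\<mu>. simple_walk_measure (Z2_tower F i) \<mu> \<and>
          (\<forall>S. finite_generating_set (Z2_tower F i) S \<longrightarrow>
             drift (Z2_tower F i) S \<mu> \<asymp> (\<lambda>n. real n / (ln ^^ i) (real n))))) \<and>
     (\<forall>i\<ge>1. \<forall>j\<ge>1. \<exists>\<mu>. simple_walk_measure (Z2_Z_tower j i) \<mu> \<and>
        (\<forall>S. finite_generating_set (Z2_Z_tower j i) S \<longrightarrow>
           drift (Z2_Z_tower j i) S \<mu> \<asymp> (\<lambda>n. real n / root (2 ^ i) ((ln ^^ j) (real n)))))"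
proof (intro conjI impI allI)
  have Z2: "\<one>\<^bsub>Z2_group\<^esub> \<notin> Z2_steps" using zero_notin_Z_steps by simp
  have ln_ge: "1 \<le> 1 + ln x" if "1 \<le> x" for x :: real using that by simp
  note iter_Z2 = drift_gauge_iter_wreath[OF aperiodic_Z2 Z2 green_gauge_Z2 gauge_function_ln ln_ge]
  have ev: "\<forall>\<^sub>F n in sequentially. 0 < (ln ^^ i) (real n) \<and> (ln ^^ i) (real n) \<le> ((\<lambda>x. 1 + ln x) ^^ i) (real n) \<and>
      ((\<lambda>x. 1 + ln x) ^^ i) (real n) \<le> 2 * (ln ^^ i) (real n)" for i
  proof -
    have "\<forall>\<^sub>F x in at_top. 0 < (ln ^^ i) (x :: real)"
      using filterlim_funpow_ln[of i] unfolding filterlim_at_top_dense by blast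
    then have "\<forall>\<^sub>F x in at_top. 0 < (ln ^^ i) x \<and> (ln ^^ i) x \<le> ((\<lambda>x. 1 + ln x) ^^ i) x \<and>
      ((\<lambda>x. 1 + ln x) ^^ i) x \<le> 2 * (ln ^^ i) (x :: real)"
      using funpow_ln_comparable[of i] by eventually_elim auto
    then show ?thesis by (rule eventually_compose_filterlim[OF _ filterlim_real_sequentially])
  qed
  {
    fix i :: nat
    assume F: "group F \<and> finite (carrier F) \<and> carrier F \<noteq> {\<one>\<^bsub>F\<^esub>}"
    obtain U where "aperiodic_symmetric (Z2_tower F i) U"
      "drift_gauge (Z2_tower F i) U (\<lambda>x. ((\<lambda>x. 1 + ln x) ^^ i) x)"
      using iter_Z2[OF _ finite_group_gauge gauge_function_id, of F i] F unfolding Z2_tower_def by auto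
    then show "\<exists>\<mu>. simple_walk_measure (Z2_tower F i) \<mu> \<and>
          (\<forall>S. finite_generating_set (Z2_tower F i) S \<longrightarrow>
             drift (Z2_tower F i) S \<mu> \<asymp> (\<lambda>n. real n / (ln ^^ i) (real n)))"
      using ev by (rule drift_asymp_of_gauge)
  }
  fix i j :: nat assume i: "1 \<le> i"
  have Z: "\<one>\<^bsub>integer_group\<^esub> \<notin> Z_steps" using zero_notin_Z_steps by simp
  have sqrt_ge: "1 \<le> sqrt x" if "1 \<le> x" for x using that by simp
  obtain T where T: "aperiodic_symmetric (Z_tower i) T"
    "drift_gauge (Z_tower i) T (\<lambda>x. sqrt ((sqrt ^^ (i - 1)) x))"
    using drift_gauge_iter_wreath[OF aperiodic_Z Z green_gauge_Z gauge_function_sqrt sqrt_ge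
        aperiodic_Z drift_gauge_Z gauge_function_sqrt, of "i - 1"]
    unfolding Z_tower_def by auto
  have root: "(\<lambda>x. sqrt ((sqrt ^^ (i - 1)) x)) = root (2 ^ i)"
  proof
    fix x
    have "sqrt ((sqrt ^^ (i - 1)) x) = (sqrt ^^ Suc (i - 1)) x" by simp
    also have "\<dots> = root (2 ^ i) x" using i unfolding funpow_sqrt_eq_root by simp
    finally show "sqrt ((sqrt ^^ (i - 1)) x) = root (2 ^ i) x" .
  qed
  have gauge_root: "gauge_function (root (2 ^ i))"
    using gauge_function_funpow[OF gauge_function_sqrt sqrt_ge, of i]
    by (simp add: funpow_sqrt_eq_root[abs_def])
  obtain U where U: "aperiodic_symmetric (Z2_Z_tower j i) U"
    "drift_gauge (Z2_Z_tower j i) U (\<lambda>x. root (2 ^ i) (((\<lambda>x. 1 + ln x) ^^ j) x))"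
    using iter_Z2[OF _ T[unfolded root] gauge_root, of j] unfolding Z2_Z_tower_def by auto
  show "\<exists>\<mu>. simple_walk_measure (Z2_Z_tower j i) \<mu> \<and>
        (\<forall>S. finite_generating_set (Z2_Z_tower j i) S \<longrightarrow>
           drift (Z2_Z_tower j i) S \<mu> \<asymp> (\<lambda>n. real n / root (2 ^ i) ((ln ^^ j) (real n))))"
  proof (rule drift_asymp_of_gauge[OF U])
    show "\<forall>\<^sub>F n in sequentially. 0 < root (2 ^ i) ((ln ^^ j) (real n)) \<and>
        root (2 ^ i) ((ln ^^ j) (real n)) \<le> root (2 ^ i) (((\<lambda>x. 1 + ln x) ^^ j) (real n)) \<and>
        root (2 ^ i) (((\<lambda>x. 1 + ln x) ^^ j) (real n)) \<le> 2 * root (2 ^ i) ((ln ^^ j) (real n))"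
      using ev[of j]
    proof eventually_elim
      case (elim n)
      let ?l = "(ln ^^ j) (real n)" and ?g = "((\<lambda>x. 1 + ln x) ^^ j) (real n)"
      have "root (2 ^ i) ?g \<le> root (2 ^ i) (2 * ?l)" using elim by (subst real_root_le_iff) auto
      also have "\<dots> = root (2 ^ i) 2 * root (2 ^ i) ?l" by (rule real_root_mult)
      also have "\<dots> \<le> 2 * root (2 ^ i) ?l"
        using elim by (intro mult_right_mono root_two_le) auto
      finally show ?case using elim by auto
    qed
  qed
qed

end
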